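(* Let $M$ be flat or compact. Then $$E_{\min}:=\min\{\mathcal{E}(\gamma)\mid\gamma\in W^{2,2}([-1,1],\mathbb{R}^n)\text{ is an immersion with }\mathcal{L}(\gamma)=L_0\text{ and satisfying (OBC)}\}$$ exists and the following are equivalent: (a) We have that $E_{\min}>0$. (b) There exists $\zeta>0$ such that, for any immersion $\gamma\in W^{2,2}([-1,1],\mathbb{R}^n)$ with $\mathcal{L}(\gamma)=L_0$, $\mathcal{E}(\gamma)\le E$ and (OBC), we have $L_0-|\gamma(1)-\gamma(-1)|\ge\zeta$. If $M$ is flat, then $E_{\min}=\frac{\pi^2}{L_0}$. Furthermore, if $M=\partial\Omega$ is the boundary of a compact convex set $\Omega$, $\xi$ is outward-pointing and $\tau_0(-1)=1$, then $E_{\min}>0$.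
   Context: $n\ge2$ and $M\subseteq\mathbb{R}^n$ is a complete embedded hypersurface with smooth unit normal field $\xi\colon M\to\mathbb{S}^{n-1}$; "flat" means that $M$ is a hyperplane. It is assumed throughout that $M$ has a uniform tubular neighborhood: there is $\delta>0$ such that $\Phi^M\colon M\times(-\delta,\delta)\to B_\delta(M)$, $(x,r)\mapsto x+r\xi(x)$, is a smooth diffeomorphism onto the $\delta$-neighborhood $B_\delta(M)$ of $M$, and, for each $k\in\mathbb{N}$, the $k$-th derivatives of $\Phi^M$ and of $(\Phi^M)^{-1}$ are uniformly bounded. The following data are fixed: a map $\tau_0\colon\{\pm1\}\to\{\pm1\}$, a length $L_0>0$, and an energy bound $E>0$. It is assumed that $E$ is chosen sufficiently large that there exists an immersion $\gamma\in W^{2,2}([-1,1],\mathbb{R}^n)$ with $\mathcal{L}(\gamma)=L_0$, $\mathcal{E}(\gamma)\le E$ satisfying (OBC): $\gamma(\pm1)\in M$ and $\partial_s\gamma(\pm1)=\tau_0(\pm1)\,\xi(\gamma(\pm1))$. Here $\partial_s=\frac1{|\partial_x\gamma|}\partial_x$, $\mathrm{d}s=|\partial_x\gamma|\,\mathrm{d}x$, $\vec\kappa=\partial_s^2\gamma$, $\mathcal{L}(\gamma)=\int_{-1}^1\mathrm{d}s$, $\mathcal{E}(\gamma)=\int_{-1}^1|\vec\kappa|^2\,\mathrm{d}s$.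
   Formalization: For flat M the formal statement asserts E_min ≥ π²/L₀ for every τ₀, and E_min = π²/L₀ only if τ₀(-1) ≠ τ₀(1); if τ₀(-1) = τ₀(1) the stated equality is false, since the tangent must turn by more than π and E_min > π²/L₀. *)

theory Defs
  imports "HOL-Analysis.Analysis"
begin

section \<open>Smooth maps, hypersurfaces and unit normal fields\<close>

text \<open>Meaningful for open sets \<open>U\<close> only: the derivatives are taken at full neighbourhoods.\<close>

primrec Ck_on :: "nat \<Rightarrow> 'a::euclidean_space set \<Rightarrow> ('a \<Rightarrow> 'b::euclidean_space) \<Rightarrow> bool" where
  "Ck_on 0 U f \<longleftrightarrow> continuous_on U f"
| "Ck_on (Suc k) U f \<longleftrightarrow>
     (\<forall>x\<in>U. f differentiable (at x)) \<and>
     (\<forall>v. Ck_on k U (\<lambda>x. frechet_derivative f (at x) v))"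

definition smooth_on_open :: "'a::euclidean_space set \<Rightarrow> ('a \<Rightarrow> 'b::euclidean_space) \<Rightarrow> bool" where
  "smooth_on_open U f \<longleftrightarrow> open U \<and> (\<forall>k. Ck_on k U f)"

text \<open>A map on an arbitrary subset of a Euclidean space is smooth if it extends locally to
  smooth maps on open sets.\<close>

definition smooth_map_on :: "'a::euclidean_space set \<Rightarrow> ('a \<Rightarrow> 'b::euclidean_space) \<Rightarrow> bool" where
  "smooth_map_on S f \<longleftrightarrow>
     (\<forall>x\<in>S. \<exists>U g. x \<in> U \<and> smooth_on_open U g \<and> (\<forall>y\<in>S \<inter> U. g y = f y))"

text \<open>Embedded submanifold of codimension one (without boundary), by slice charts.\<close>

definition embedded_hypersurface :: "'a::euclidean_space set \<Rightarrow> bool" where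
  "embedded_hypersurface M \<longleftrightarrow>
     (\<forall>x\<in>M. \<exists>U V \<phi> \<psi>. \<exists>b\<in>(Basis :: 'a set).
        x \<in> U \<and> homeomorphism U V \<phi> \<psi> \<and> smooth_on_open U \<phi> \<and> smooth_on_open V \<psi> \<and>
        \<phi> ` (M \<inter> U) = {z \<in> V. z \<bullet> b = 0})"

text \<open>Completeness for the induced Riemannian distance, i.e. the infimum of the lengths of
  curves inside \<open>M\<close>. For an embedded \<open>M\<close> this distance induces the subspace topology, so
  convergence may be expressed in the ambient space. The Cauchy condition is spelled out with
  curves because the distance between different components is infinite.\<close>

definition riemannian_complete :: "'a::euclidean_space set \<Rightarrow> bool" where
  "riemannian_complete M \<longleftrightarrow>
     (\<forall>X :: nat \<Rightarrow> 'a. range X \<subseteq> M \<longrightarrow>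
        (\<forall>e>0. \<exists>N. \<forall>m\<ge>N. \<forall>n\<ge>N. \<exists>c :: real \<Rightarrow> 'a.
            c C1_differentiable_on {0..1} \<and> c ` {0..1} \<subseteq> M \<and> c 0 = X m \<and> c 1 = X n \<and>
            integral {0..1} (\<lambda>t. norm (vector_derivative c (at t))) < e) \<longrightarrow>
        (\<exists>l\<in>M. X \<longlonglongrightarrow> l))"

definition tangent_space :: "'a::euclidean_space set \<Rightarrow> 'a \<Rightarrow> 'a set" where
  "tangent_space M x =
     {v. \<exists>c e. e > 0 \<and> smooth_on_open {-e<..<e::real} c \<and> c ` {-e<..<e} \<subseteq> M \<and> c 0 = x \<and>
           (c has_vector_derivative v) (at 0)}"

definition smooth_unit_normal :: "'a::euclidean_space set \<Rightarrow> ('a \<Rightarrow> 'a) \<Rightarrow> bool" where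
  "smooth_unit_normal M \<xi> \<longleftrightarrow>
     smooth_map_on M \<xi> \<and>
     (\<forall>x\<in>M. norm (\<xi> x) = 1 \<and> (\<forall>v\<in>tangent_space M x. \<xi> x \<bullet> v = 0))"

definition is_hyperplane :: "'a::euclidean_space set \<Rightarrow> bool" where
  "is_hyperplane M \<longleftrightarrow> (\<exists>a b. a \<noteq> 0 \<and> M = {x. a \<bullet> x = b})"

definition outward_pointing :: "'a::euclidean_space set \<Rightarrow> ('a \<Rightarrow> 'a) \<Rightarrow> bool" where
  "outward_pointing \<Omega> \<xi> \<longleftrightarrow>
     (\<forall>x\<in>frontier \<Omega>. \<exists>\<epsilon>>0. \<forall>t\<in>{0<..<\<epsilon>}. x + t *\<^sub>R \<xi> x \<notin> \<Omega>)"


section \<open>Uniform tubular neighbourhoods\<close>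

text \<open>The derivative of a map along a submanifold \<open>S\<close>, extended by zero to the normal space.
  If \<open>S\<close> is open, this is the usual derivative.\<close>

definition tangential_derivative ::
    "'a::euclidean_space set \<Rightarrow> ('a \<Rightarrow> 'b::euclidean_space) \<Rightarrow> 'a \<Rightarrow> 'a \<Rightarrow> 'b" where
  "tangential_derivative S f x =
     (THE f'. (f has_derivative f') (at x within S) \<and>
        (\<forall>w. (\<forall>v\<in>tangent_space S x. w \<bullet> v = 0) \<longrightarrow> f' w = 0))"

primrec iterated_derivative ::
    "'a::euclidean_space set \<Rightarrow> ('a \<Rightarrow> 'b::euclidean_space) \<Rightarrow> 'a list \<Rightarrow> 'a \<Rightarrow> 'b" where
  "iterated_derivative S f [] = f"
| "iterated_derivative S f (v # vs) =
     (\<lambda>x. tangential_derivative S (iterated_derivative S f vs) x v)"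

definition bounded_derivative ::
    "nat \<Rightarrow> 'a::euclidean_space set \<Rightarrow> ('a \<Rightarrow> 'b::euclidean_space) \<Rightarrow> bool" where
  "bounded_derivative k S f \<longleftrightarrow>
     (\<exists>C. \<forall>x\<in>S. \<forall>vs. length vs = k \<and> (\<forall>v\<in>set vs. norm v \<le> 1) \<longrightarrow>
        norm (iterated_derivative S f vs x) \<le> C)"

definition tubular_map :: "('a::euclidean_space \<Rightarrow> 'a) \<Rightarrow> 'a \<times> real \<Rightarrow> 'a" where
  "tubular_map \<xi> = (\<lambda>(x, r). x + r *\<^sub>R \<xi> x)"

text \<open>The derivatives are bounded for orders \<open>k \<ge> 1\<close>; for \<open>k = 0\<close> this would force \<open>M\<close> to be
  bounded.\<close>

definition uniform_tubular_neighborhood :: "'a::euclidean_space set \<Rightarrow> ('a \<Rightarrow> 'a) \<Rightarrow> bool" where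
  "uniform_tubular_neighborhood M \<xi> \<longleftrightarrow>
     (\<exists>\<delta>>0.
        let D = M \<times> {-\<delta><..<\<delta>};
            B = (\<Union>x\<in>M. ball x \<delta>);
            \<Phi> = tubular_map \<xi>;
            \<Psi> = inv_into D \<Phi>
        in bij_betw \<Phi> D B \<and> smooth_map_on D \<Phi> \<and> smooth_map_on B \<Psi> \<and>
           (\<forall>k\<ge>1. bounded_derivative k D \<Phi> \<and> bounded_derivative k B \<Psi>))"


section \<open>Sobolev curves on the interval from -1 to 1\<close>

text \<open>Compactly supported C1 functions give the same weak derivatives as smooth ones.\<close>

definition test_function :: "(real \<Rightarrow> real) \<Rightarrow> bool" where
  "test_function \<phi> \<longleftrightarrow>
     \<phi> C1_differentiable_on UNIV \<and>
     (\<exists>K. compact K \<and> K \<subseteq> {-1<..<1} \<and> (\<forall>x. x \<notin> K \<longrightarrow> \<phi> x = 0))"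

definition square_integrable :: "(real \<Rightarrow> 'a::euclidean_space) \<Rightarrow> bool" where
  "square_integrable u \<longleftrightarrow>
     set_borel_measurable lborel {-1<..<1} u \<and>
     set_integrable lborel {-1<..<1} (\<lambda>x. (norm (u x))\<^sup>2)"

text \<open>\<open>u\<close> belongs to the space W12 and \<open>g\<close> is its weak derivative.\<close>

definition has_weak_derivative ::
    "(real \<Rightarrow> 'a::euclidean_space) \<Rightarrow> (real \<Rightarrow> 'a) \<Rightarrow> bool" where
  "has_weak_derivative u g \<longleftrightarrow>
     square_integrable u \<and> square_integrable g \<and>
     (\<forall>\<phi>. test_function \<phi> \<longrightarrow>
        (LINT x:{-1<..<1}|lborel. deriv \<phi> x *\<^sub>R u x) =
        - (LINT x:{-1<..<1}|lborel. \<phi> x *\<^sub>R g x))"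

definition weak_derivative :: "(real \<Rightarrow> 'a::euclidean_space) \<Rightarrow> real \<Rightarrow> 'a" where
  "weak_derivative u = (SOME g. has_weak_derivative u g)"

text \<open>Membership in W22; of the functions in an almost-everywhere class, only the continuous
  representative is admitted, which is then automatically of class C1 up to the boundary.\<close>

definition W22_curve :: "(real \<Rightarrow> 'a::euclidean_space) \<Rightarrow> bool" where
  "W22_curve \<gamma> \<longleftrightarrow>
     continuous_on {-1..1} \<gamma> \<and>
     (\<exists>g h. has_weak_derivative \<gamma> g \<and> has_weak_derivative g h)"

abbreviation velocity :: "(real \<Rightarrow> 'a::euclidean_space) \<Rightarrow> real \<Rightarrow> 'a" where
  "velocity \<gamma> x \<equiv> vector_derivative \<gamma> (at x within {-1..1})"

definition W22_immersion :: "(real \<Rightarrow> 'a::euclidean_space) \<Rightarrow> bool" where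
  "W22_immersion \<gamma> \<longleftrightarrow> W22_curve \<gamma> \<and> (\<forall>x\<in>{-1..1}. velocity \<gamma> x \<noteq> 0)"

text \<open>The first arc-length derivative is a pointwise object (it is evaluated at the end points),
  while the second one exists only as a weak derivative, up to null sets.\<close>

definition unit_tangent :: "(real \<Rightarrow> 'a::euclidean_space) \<Rightarrow> real \<Rightarrow> 'a" where
  "unit_tangent \<gamma> x = (1 / norm (velocity \<gamma> x)) *\<^sub>R velocity \<gamma> x"

definition curvature :: "(real \<Rightarrow> 'a::euclidean_space) \<Rightarrow> real \<Rightarrow> 'a" where
  "curvature \<gamma> x = (1 / norm (velocity \<gamma> x)) *\<^sub>R weak_derivative (unit_tangent \<gamma>) x"

definition curve_length :: "(real \<Rightarrow> 'a::euclidean_space) \<Rightarrow> real" where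
  "curve_length \<gamma> = (LINT x:{-1<..<1}|lborel. norm (velocity \<gamma> x))"

definition elastic_energy :: "(real \<Rightarrow> 'a::euclidean_space) \<Rightarrow> real" where
  "elastic_energy \<gamma> =
     (LINT x:{-1<..<1}|lborel. (norm (curvature \<gamma> x))\<^sup>2 * norm (velocity \<gamma> x))"

text \<open>The orthogonal boundary conditions.\<close>

definition OBC ::
    "'a::euclidean_space set \<Rightarrow> ('a \<Rightarrow> 'a) \<Rightarrow> (real \<Rightarrow> real) \<Rightarrow> (real \<Rightarrow> 'a) \<Rightarrow> bool" where
  "OBC M \<xi> \<tau>\<^sub>0 \<gamma> \<longleftrightarrow>
     (\<forall>y\<in>{-1, 1}. \<gamma> y \<in> M \<and> unit_tangent \<gamma> y = \<tau>\<^sub>0 y *\<^sub>R \<xi> (\<gamma> y))"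

definition admissible ::
    "'a::euclidean_space set \<Rightarrow> ('a \<Rightarrow> 'a) \<Rightarrow> (real \<Rightarrow> real) \<Rightarrow> real \<Rightarrow> (real \<Rightarrow> 'a) \<Rightarrow> bool" where
  "admissible M \<xi> \<tau>\<^sub>0 L\<^sub>0 \<gamma> \<longleftrightarrow> W22_immersion \<gamma> \<and> curve_length \<gamma> = L\<^sub>0 \<and> OBC M \<xi> \<tau>\<^sub>0 \<gamma>"

end

theory Submission
  imports Defs "HOL-Complex_Analysis.Great_Picard"
begin

text \<open>At fixed length the energy depends on a curve only through its unit tangent. After reparametrisation
by constant speed an admissible curve is \<open>\<gamma> x = p + (L / 2) \<integral> T\<close>, where \<open>T\<close> is a curve in the unit
sphere defined on \<open>[-1, 1]\<close>; its energy is \<open>(2 / L) \<integral> |T'|\<^sup>2\<close>, and the boundary conditions become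
conditions on \<open>p\<close>, on the mean of \<open>T\<close> and on \<open>T (-1)\<close>, \<open>T 1\<close> (\<open>tangent_profile\<close>). So the problem
concerns spherical curves with square integrable derivative, and first derivatives only.

Such functions are described in three ways, each convenient for a different purpose: as primitives
of square integrable functions (\<open>H1\<close>), by weak derivatives (\<open>weak_derivative_imp_H1\<close>,
\<open>H1_has_weak_derivative\<close>), and, following F. Riesz, as the continuous functions whose difference
quotients over the dyadic partitions are bounded in the mean square (\<open>H1_if_dyadic_energy_bounded\<close>).
The last description mentions values of the function only. It therefore passes to pointwise limits,
which gives lower semicontinuity of the energy, and it survives composition with a Lipschitz map or
with a change of parameter, where a chain rule for almost everywhere derivatives would otherwise be
called for: this is how the tangent \<open>sgn v\<close> of a curve with velocity \<open>v\<close> and its arc length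
reparametrisation are handled.

Existence of a minimiser is the direct method. An energy bound makes the tangents equicontinuous,
and Arzela-Ascoli gives a uniform limit (\<open>tangent_profile_compactness\<close>). The starting points stay
bounded when \<open>M\<close> is compact; when \<open>M\<close> is a hyperplane its normal is constant and the curve may be
translated along \<open>M\<close> to a fixed starting point.

Energy zero means constant tangent, that is, a segment, whose end points have distance \<open>L\<^sub>0\<close>. Hence a
uniform lower bound for the chord deficit \<open>L\<^sub>0 - |\<gamma> 1 - \<gamma> (-1)|\<close> excludes energy zero. Conversely, if
the deficits of admissible curves of bounded energy accumulate at zero, then by compactness some
admissible curve has chord \<open>L\<^sub>0\<close>, equality holds in \<open>|\<integral> T| \<le> 2\<close>, and the minimum is zero
(\<open>chord_deficit_if_no_straight_curve\<close>).

For a hyperplane with normal \<open>\<nu>\<close> the tangent starts and ends at \<open>\<plusminus>\<nu>\<close>, while \<open>T \<bullet> \<nu>\<close> has mean zero and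
so vanishes at some \<open>t\<close>: the tangent turns by a right angle on each side of \<open>t\<close>. A quarter turn on an
interval of length \<open>l\<close> costs at least \<open>(\<pi> / 2)\<^sup>2 / l\<close> (\<open>quarter_turn_energy\<close>), and the two costs add up
to at least \<open>\<pi>\<^sup>2 / 2\<close> because the two lengths have sum 2. The semicircle attains this value when
\<open>\<tau>\<^sub>0 (-1) \<noteq> \<tau>\<^sub>0 1\<close>. Finally, a segment that leaves a convex body along an outward direction cannot
return to it, so a convex boundary with \<open>\<tau>\<^sub>0 (-1) = 1\<close> admits no curve of energy zero.\<close>

section \<open>Square integrable functions and their primitives\<close>

text \<open>Borel rather than Lebesgue measurability is demanded because it is what
\<^const>\<open>square_integrable\<close> asks for.\<close>

definition L2 :: "real \<Rightarrow> real \<Rightarrow> (real \<Rightarrow> 'a::euclidean_space) \<Rightarrow> bool" where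
  "L2 a b w \<longleftrightarrow>
     set_borel_measurable borel {a..b} w \<and> (\<lambda>x. (norm (w x))\<^sup>2) integrable_on {a..b}"

text \<open>The absolutely continuous functions \<open>u\<close> with square integrable derivative \<open>w\<close>. The derivative is an
argument of its own because it is determined only up to a null set.\<close>

definition H1 :: "real \<Rightarrow> real \<Rightarrow> (real \<Rightarrow> 'a::euclidean_space) \<Rightarrow> (real \<Rightarrow> 'a) \<Rightarrow> bool" where
  "H1 a b u w \<longleftrightarrow> L2 a b w \<and> (\<forall>x\<in>{a..b}. u x = u a + integral {a..x} w)"

lemma set_borel_measurable_imp_lebesgue_on:
  fixes w :: "real \<Rightarrow> 'a::euclidean_space"
  assumes "set_borel_measurable borel {a..b} w"
  shows "w \<in> borel_measurable (lebesgue_on {a..b})"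
proof -
  have "(\<lambda>x. indicat_real {a..b} x *\<^sub>R w x) \<in> borel_measurable lebesgue"
    using assms unfolding set_borel_measurable_def
    by (intro measurable_completion) simp
  then show ?thesis
    by (subst borel_measurable_restrict_space_iff) auto
qed

lemma set_borel_measurable_continuous_Icc:
  fixes w :: "real \<Rightarrow> 'a::euclidean_space"
  assumes "continuous_on {a..b} w"
  shows "set_borel_measurable borel {a..b} w"
  using borel_measurable_continuous_on_restrict[OF assms] unfolding set_borel_measurable_def
  by (subst (asm) borel_measurable_restrict_space_iff) auto

lemma set_borel_measurable_bilinear:
  fixes u :: "real \<Rightarrow> 'a::euclidean_space" and v :: "real \<Rightarrow> 'b::euclidean_space"
    and B :: "'a \<Rightarrow> 'b \<Rightarrow> 'c::euclidean_space"
  assumes B: "bounded_bilinear B"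
    and u: "set_borel_measurable borel {a..b} u" and v: "set_borel_measurable borel {a..b} v"
  shows "set_borel_measurable borel {a..b} (\<lambda>x. B (u x) (v x))"
proof -
  interpret bounded_bilinear B by fact
  have "continuous_on UNIV (\<lambda>p. B (fst p) (snd p))"
    by (intro continuous_on continuous_intros)
  with u v have "(\<lambda>x. B (indicat_real {a..b} x *\<^sub>R u x) (indicat_real {a..b} x *\<^sub>R v x))
      \<in> borel_measurable borel"
    unfolding set_borel_measurable_def by (rule borel_measurable_continuous_Pair)
  moreover have "B (indicat_real {a..b} x *\<^sub>R u x) (indicat_real {a..b} x *\<^sub>R v x) =
      indicat_real {a..b} x *\<^sub>R B (u x) (v x)" for x
    by (auto simp: indicator_def zero_left)
  ultimately show ?thesis unfolding set_borel_measurable_def by simp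
qed

lemma set_borel_measurable_subinterval:
  fixes w :: "real \<Rightarrow> 'a::euclidean_space"
  assumes "set_borel_measurable borel {a..b} w" "{c..d} \<subseteq> {a..b}"
  shows "set_borel_measurable borel {c..d} w"
  using assms(1) by (rule set_borel_measurable_subset) (use assms in auto)

lemma L2_subinterval: "L2 a b w \<Longrightarrow> {c..d} \<subseteq> {a..b} \<Longrightarrow> L2 c d w"
  unfolding L2_def
  by (meson set_borel_measurable_subinterval integrable_on_subinterval)

lemma L2_bilinear_absolutely_integrable:
  fixes u :: "real \<Rightarrow> 'a::euclidean_space" and v :: "real \<Rightarrow> 'b::euclidean_space"
    and B :: "'a \<Rightarrow> 'b \<Rightarrow> 'c::euclidean_space"
  assumes B: "bounded_bilinear B" and u: "L2 a b u" and v: "L2 a b v"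
  shows "(\<lambda>x. B (u x) (v x)) absolutely_integrable_on {a..b}"
proof -
  interpret bounded_bilinear B by fact
  obtain K where K: "K > 0" "\<And>x y. norm (B x y) \<le> norm x * norm y * K"
    using pos_bounded by blast
  show ?thesis
  proof (rule measurable_bounded_by_integrable_imp_absolutely_integrable)
    show "(\<lambda>x. B (u x) (v x)) \<in> borel_measurable (lebesgue_on {a..b})"
      using u v unfolding L2_def
      by (metis set_borel_measurable_imp_lebesgue_on set_borel_measurable_bilinear[OF B])
    show "(\<lambda>x. ((norm (u x))\<^sup>2 + (norm (v x))\<^sup>2) * K) integrable_on {a..b}"
      using u v unfolding L2_def by (intro integrable_on_mult_left integrable_add) auto
    fix x
    have "2 * (norm (u x) * norm (v x)) \<le> (norm (u x))\<^sup>2 + (norm (v x))\<^sup>2"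
      using sum_squares_bound[of "norm (u x)" "norm (v x)"] by (simp add: mult_ac)
    moreover have "0 \<le> norm (u x) * norm (v x)" by simp
    ultimately have "norm (u x) * norm (v x) \<le> (norm (u x))\<^sup>2 + (norm (v x))\<^sup>2"
      by linarith
    then show "norm (B (u x) (v x)) \<le> ((norm (u x))\<^sup>2 + (norm (v x))\<^sup>2) * K"
      using K by (meson mult_right_mono less_imp_le order_trans)
  qed simp
qed

lemma L2_continuous:
  fixes w :: "real \<Rightarrow> 'a::euclidean_space"
  assumes "continuous_on {a..b} w"
  shows "L2 a b w"
  unfolding L2_def
  by (intro conjI set_borel_measurable_continuous_Icc integrable_continuous_real continuous_intros assms)

text \<open>A continuous function on a compact interval is bounded, so that it multiplies square integrable
functions. Products are treated for an arbitrary bounded bilinear map in order to cover scalar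
multiples and inner products at once.\<close>

lemma L2_bilinear_continuous:
  fixes u :: "real \<Rightarrow> 'a::euclidean_space" and v :: "real \<Rightarrow> 'b::euclidean_space"
    and B :: "'a \<Rightarrow> 'b \<Rightarrow> 'c::euclidean_space"
  assumes B: "bounded_bilinear B" and u: "L2 a b u" and v: "continuous_on {a..b} v"
  shows "L2 a b (\<lambda>x. B (u x) (v x))"
  unfolding L2_def
proof
  interpret bounded_bilinear B by fact
  obtain K where K: "K > 0" "\<And>x y. norm (B x y) \<le> norm x * norm y * K"
    using pos_bounded by blast
  show meas: "set_borel_measurable borel {a..b} (\<lambda>x. B (u x) (v x))"
    using u set_borel_measurable_continuous_Icc[OF v] unfolding L2_def
    by (metis set_borel_measurable_bilinear[OF B])
  have "bounded (v ` {a..b})"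
    by (intro compact_imp_bounded compact_continuous_image v) auto
  then obtain C where C: "C > 0" "\<And>x. x \<in> {a..b} \<Longrightarrow> norm (v x) \<le> C"
    unfolding bounded_pos by auto
  have "(\<lambda>x. (norm (B (u x) (v x)))\<^sup>2) absolutely_integrable_on {a..b}"
  proof (rule measurable_bounded_by_integrable_imp_absolutely_integrable)
    show "(\<lambda>x. (norm (B (u x) (v x)))\<^sup>2) \<in> borel_measurable (lebesgue_on {a..b})"
      using set_borel_measurable_imp_lebesgue_on[OF meas] by measurable
    show "(\<lambda>x. (norm (u x))\<^sup>2 * (C * K)\<^sup>2) integrable_on {a..b}"
      using u unfolding L2_def by (intro integrable_on_mult_left) auto
    fix x assume x: "x \<in> {a..b}"
    have "norm (B (u x) (v x)) \<le> norm (u x) * norm (v x) * K" by (rule K)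
    also have "\<dots> \<le> norm (u x) * C * K"
      using C(2)[OF x] K(1) by (intro mult_right_mono mult_left_mono) auto
    finally have "(norm (B (u x) (v x)))\<^sup>2 \<le> (norm (u x) * C * K)\<^sup>2"
      by (intro power_mono) auto
    then show "norm ((norm (B (u x) (v x)))\<^sup>2) \<le> (norm (u x))\<^sup>2 * (C * K)\<^sup>2"
      by (simp add: power_mult_distrib mult_ac)
  qed simp
  then show "(\<lambda>x. (norm (B (u x) (v x)))\<^sup>2) integrable_on {a..b}"
    using absolutely_integrable_on_def by blast
qed

lemma L2_absolutely_integrable:
  assumes "L2 a b w"
  shows "w absolutely_integrable_on {a..b}"
  using L2_bilinear_absolutely_integrable[OF bounded_bilinear_scaleR L2_continuous assms, of "\<lambda>_. 1"]
  by simp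

lemma L2_integrable:
  assumes "L2 a b w" "{c..d} \<subseteq> {a..b}"
  shows "w integrable_on {c..d}" "(\<lambda>x. norm (w x)) integrable_on {c..d}"
    "(\<lambda>x. (norm (w x))\<^sup>2) integrable_on {c..d}"
  using L2_absolutely_integrable[OF L2_subinterval[OF assms]] L2_subinterval[OF assms]
  unfolding absolutely_integrable_on_def L2_def by auto

lemma L2_add:
  assumes u: "L2 a b u" and w: "L2 a b w"
  shows "L2 a b (\<lambda>x. u x + w x)"
  unfolding L2_def
proof
  show "set_borel_measurable borel {a..b} (\<lambda>x. u x + w x)"
    using u w unfolding L2_def set_borel_measurable_def scaleR_add_right
    by (intro borel_measurable_add) auto
  have "(\<lambda>x. u x \<bullet> w x) integrable_on {a..b}"
    using L2_bilinear_absolutely_integrable[OF bounded_bilinear_inner u w]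
      absolutely_integrable_on_def by blast
  then have "(\<lambda>x. (norm (u x))\<^sup>2 + (norm (w x))\<^sup>2 + 2 * (u x \<bullet> w x)) integrable_on {a..b}"
    using u w unfolding L2_def by (intro integrable_add integrable_on_mult_right) auto
  then show "(\<lambda>x. (norm (u x + w x))\<^sup>2) integrable_on {a..b}"
    by (rule integrable_eq) (simp add: power2_norm_eq_inner algebra_simps inner_commute)
qed

lemma L2_scaleR:
  assumes "L2 a b w"
  shows "L2 a b (\<lambda>x. c *\<^sub>R w x)"
  using L2_bilinear_continuous[OF bounded_bilinear.flip[OF bounded_bilinear_scaleR] assms, of "\<lambda>_. c"]
  by simp

lemma L2_diff:
  assumes u: "L2 a b u" and w: "L2 a b w"
  shows "L2 a b (\<lambda>x. u x - w x)"
  using L2_add[OF u L2_scaleR[OF w, of "-1"]] by simp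

text \<open>The right-hand side is smallest at \<open>t = sqrt (A / B)\<close>, where it equals \<open>2 sqrt (A B)\<close>.\<close>

lemma square_le_mult_if_weighted_means:
  fixes N A B :: real
  assumes "\<And>t. t > 0 \<Longrightarrow> 2 * N \<le> t * B + A / t" "A \<ge> 0" "B \<ge> 0" "N \<ge> 0"
  shows "N\<^sup>2 \<le> A * B"
proof (cases "N = 0")
  case False
  then have N: "N > 0" using assms by simp
  show ?thesis
  proof (cases "A = 0")
    case True
    \<comment> \<open>The bound \<open>t B\<close> tends to zero with \<open>t\<close>; this \<open>t\<close> is small enough to make it at most \<open>N\<close>.\<close>
    have "2 * N \<le> N / (B + 1) * B" using assms(1)[of "N / (B + 1)"] True N assms by simp
    also have "\<dots> \<le> N" using N assms by (simp add: field_simps)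
    finally show ?thesis using N by simp
  next
    case False
    \<comment> \<open>The choice \<open>t = A / N\<close> avoids square roots and is optimal in the case of equality.\<close>
    then have "2 * N \<le> A / N * B + A / (A / N)"
      using assms N by (intro assms(1)) simp
    then have "N \<le> A * B / N" using False N by simp
    then show ?thesis using N by (simp add: field_simps power2_eq_square)
  qed
qed (use assms in auto)

text \<open>Integrate \<open>2 |w| \<le> t |w|\<^sup>2 / \<rho> + \<rho> / t\<close> and optimise in \<open>t\<close>. With \<open>\<rho>\<close> the speed of a curve and \<open>w\<close> the
derivative of its tangent, this compares the turning of the curve with its energy and its length,
without a change of variables.\<close>

lemma L2_Cauchy_Schwarz_weighted:
  assumes w: "L2 a b w" and \<rho>: "continuous_on {a..b} \<rho>" "\<And>x. x \<in> {a..b} \<Longrightarrow> \<rho> x > 0"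
  shows "(integral {a..b} (\<lambda>x. norm (w x)))\<^sup>2 \<le>
    integral {a..b} \<rho> * integral {a..b} (\<lambda>x. (norm (w x))\<^sup>2 / \<rho> x)"
proof -
  have \<rho>i: "\<rho> integrable_on {a..b}" using \<rho> integrable_continuous_real by blast
  have "continuous_on {a..b} (\<lambda>x. 1 / sqrt (\<rho> x))"
    using \<rho> by (intro continuous_intros) force+
  then have "L2 a b (\<lambda>x. (1 / sqrt (\<rho> x)) *\<^sub>R w x)"
    using L2_bilinear_continuous[OF bounded_bilinear.flip[OF bounded_bilinear_scaleR] w] by simp
  then have "(\<lambda>x. (norm ((1 / sqrt (\<rho> x)) *\<^sub>R w x))\<^sup>2) integrable_on {a..b}"
    unfolding L2_def by simp
  then have wi: "(\<lambda>x. (norm (w x))\<^sup>2 / \<rho> x) integrable_on {a..b}"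
    by (rule integrable_eq) (use \<rho>(2) in \<open>auto simp: power_divide less_imp_le\<close>)
  show ?thesis
  proof (rule square_le_mult_if_weighted_means)
    fix t :: real assume t: "t > 0"
    have "integral {a..b} (\<lambda>x. 2 * norm (w x)) \<le>
        integral {a..b} (\<lambda>x. t * ((norm (w x))\<^sup>2 / \<rho> x) + \<rho> x / t)"
    proof (rule integral_le)
      show "(\<lambda>x. 2 * norm (w x)) integrable_on {a..b}"
        using L2_integrable(2)[OF w order_refl] by (intro integrable_on_mult_right)
      show "(\<lambda>x. t * ((norm (w x))\<^sup>2 / \<rho> x) + \<rho> x / t) integrable_on {a..b}"
        using wi \<rho>i by (intro integrable_add integrable_on_mult_right integrable_on_divide)
      fix x assume "x \<in> {a..b}"
      then have r: "\<rho> x > 0" using \<rho> by simp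
      have "2 * norm (w x) * (t * \<rho> x) \<le> (t * norm (w x))\<^sup>2 + (\<rho> x)\<^sup>2"
        using sum_squares_bound[of "t * norm (w x)" "\<rho> x"] by (simp add: mult_ac)
      then show "2 * norm (w x) \<le> t * ((norm (w x))\<^sup>2 / \<rho> x) + \<rho> x / t"
        using r t by (simp add: field_simps power2_eq_square)
    qed
    also have "\<dots> = t * integral {a..b} (\<lambda>x. (norm (w x))\<^sup>2 / \<rho> x) + integral {a..b} \<rho> / t"
      using integrable_on_mult_right[OF wi, of t] integrable_on_divide[OF \<rho>i, of t]
      by (subst integral_add) (simp_all only: integral_mult_right integral_divide)
    finally show "2 * integral {a..b} (\<lambda>x. norm (w x)) \<le>
      t * integral {a..b} (\<lambda>x. (norm (w x))\<^sup>2 / \<rho> x) + integral {a..b} \<rho> / t" by simp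
  qed (use \<rho>(2) in \<open>force intro!: integral_nonneg \<rho>i wi L2_integrable(2)[OF w order_refl]\<close>)+
qed

lemma L2_Cauchy_Schwarz:
  assumes w: "L2 a b w" and "a \<le> b"
  shows "(integral {a..b} (\<lambda>x. norm (w x)))\<^sup>2 \<le> (b - a) * integral {a..b} (\<lambda>x. (norm (w x))\<^sup>2)"
  using L2_Cauchy_Schwarz_weighted[OF w, of "\<lambda>_. 1"] assms by simp

lemma L2_norm_integral_le:
  assumes w: "L2 a b w"
  shows "norm (integral {a..b} w) \<le> integral {a..b} (\<lambda>x. norm (w x))"
  using L2_integrable[OF w order_refl] by (intro integral_norm_bound_integral) auto

lemma H1_L2: "H1 a b u w \<Longrightarrow> L2 a b w"
  by (simp add: H1_def)

lemma H1_eq: "H1 a b u w \<Longrightarrow> x \<in> {a..b} \<Longrightarrow> u x = u a + integral {a..x} w"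
  unfolding H1_def by blast

lemma H1_increment:
  assumes "H1 a b u w" "a \<le> x" "x \<le> y" "y \<le> b"
  shows "u y - u x = integral {x..y} w"
proof -
  have "integral {a..x} w + integral {x..y} w = integral {a..y} w"
    using assms L2_integrable(1)[OF H1_L2[OF assms(1)], of a y]
    by (intro Henstock_Kurzweil_Integration.integral_combine) auto
  moreover have "u y = u a + integral {a..y} w" "u x = u a + integral {a..x} w"
    using H1_eq[OF assms(1), of y] H1_eq[OF assms(1), of x] assms(2-4) by auto
  ultimately show ?thesis by (metis add_diff_cancel_left add_diff_cancel_left')
qed

lemma H1_norm_increment_le:
  assumes "H1 a b u w" "a \<le> x" "x \<le> y" "y \<le> b"
  shows "norm (u y - u x) \<le> integral {x..y} (\<lambda>t. norm (w t))"
    "(norm (u y - u x))\<^sup>2 \<le> (y - x) * integral {x..y} (\<lambda>t. (norm (w t))\<^sup>2)"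
proof -
  have w: "L2 x y w" using assms L2_subinterval[OF H1_L2[OF assms(1)], of x y] by auto
  show 1: "norm (u y - u x) \<le> integral {x..y} (\<lambda>t. norm (w t))"
    unfolding H1_increment[OF assms] by (rule L2_norm_integral_le[OF w])
  have "(norm (u y - u x))\<^sup>2 \<le> (integral {x..y} (\<lambda>t. norm (w t)))\<^sup>2"
    using 1 by (intro power_mono) auto
  also note L2_Cauchy_Schwarz[OF w assms(3)]
  finally show "(norm (u y - u x))\<^sup>2 \<le> (y - x) * integral {x..y} (\<lambda>t. (norm (w t))\<^sup>2)" .
qed

lemma H1_continuous:
  assumes "H1 a b u w"
  shows "continuous_on {a..b} u"
proof -
  have "continuous_on {a..b} (\<lambda>x. u a + integral {a..x} w)"
    by (intro continuous_intros indefinite_integral_continuous_1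
        L2_integrable(1)[OF H1_L2[OF assms] order_refl])
  then show ?thesis
    by (rule continuous_on_eq) (rule H1_eq[OF assms, symmetric])
qed

lemma H1_cong: "H1 a b u w \<Longrightarrow> (\<And>x. x \<in> {a..b} \<Longrightarrow> v x = u x) \<Longrightarrow> H1 a b v w"
  unfolding H1_def
proof (intro conjI ballI)
  fix x assume u: "L2 a b w \<and> (\<forall>x\<in>{a..b}. u x = u a + integral {a..x} w)"
    and v: "\<And>x. x \<in> {a..b} \<Longrightarrow> v x = u x" and x: "x \<in> {a..b}"
  have "v a = u a" using v[of a] x by auto
  moreover have "u x = u a + integral {a..x} w" using u x by blast
  ultimately show "v x = v a + integral {a..x} w" using v[OF x] by simp
qed blast

lemma H1_subinterval:
  assumes "H1 a b u w" "a \<le> c" "d \<le> b"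
  shows "H1 c d u w"
  unfolding H1_def
proof (intro conjI ballI)
  show "L2 c d w" using assms by (intro L2_subinterval[OF H1_L2[OF assms(1)]]) auto
  fix x assume "x \<in> {c..d}"
  then have "u x - u c = integral {c..x} w"
    using assms by (intro H1_increment[OF assms(1)]) auto
  then show "u x = u c + integral {c..x} w" by (metis add.commute diff_add_cancel)
qed

lemma H1_indefinite_integral:
  assumes "L2 a b w"
  shows "H1 a b (\<lambda>x. c + integral {a..x} w) w"
  using assms unfolding H1_def by auto

lemma H1_of_C1:
  fixes u :: "real \<Rightarrow> 'a::euclidean_space"
  assumes "\<And>x. x \<in> {a..b} \<Longrightarrow> (u has_vector_derivative w x) (at x within {a..b})"
    "continuous_on {a..b} w"
  shows "H1 a b u w"
  unfolding H1_def
proof (intro conjI ballI)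
  show "L2 a b w" by (intro L2_continuous assms)
  fix x assume x: "x \<in> {a..b}"
  have "(w has_integral u x - u a) {a..x}"
    using x by (intro fundamental_theorem_of_calculus)
      (auto intro: has_vector_derivative_within_subset[OF assms(1)])
  then show "u x = u a + integral {a..x} w" by (simp add: integral_unique)
qed

lemma H1_bounded_linear:
  fixes u :: "real \<Rightarrow> 'a::euclidean_space" and f :: "'a \<Rightarrow> 'b::euclidean_space"
  assumes f: "bounded_linear f" and u: "H1 a b u w"
  shows "H1 a b (\<lambda>x. f (u x)) (\<lambda>x. f (w x))"
proof -
  interpret bounded_linear f by fact
  have "bounded_bilinear (\<lambda>(r::real) x. r *\<^sub>R f x)"
    by (rule bounded_bilinear.comp[OF bounded_bilinear_scaleR bounded_linear_ident f])
  then have "bounded_bilinear (\<lambda>x (r::real). r *\<^sub>R f x)"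
    by (rule bounded_bilinear.flip)
  from L2_bilinear_continuous[OF this H1_L2[OF u], of "\<lambda>_. 1"]
  have "L2 a b (\<lambda>x. (1::real) *\<^sub>R f (w x))" by simp
  then have L2: "L2 a b (\<lambda>x. f (w x))" unfolding scaleR_one .
  have int: "integral {a..x} (\<lambda>t. f (w t)) = f (integral {a..x} w)" if "x \<in> {a..b}" for x
    using integral_linear[OF L2_integrable(1)[OF H1_L2[OF u], of a x] f] that by (simp add: o_def)
  have "f (u x) = f (u a) + integral {a..x} (\<lambda>t. f (w t))" if "x \<in> {a..b}" for x
    unfolding int[OF that] by (subst H1_eq[OF u that]) (rule add)
  with L2 show ?thesis unfolding H1_def by blast
qed

text \<open>The bound makes \<open>F\<close> differentiable everywhere with derivative zero, since \<open>G\<close> is continuous.\<close>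

lemma constant_if_increments_small:
  fixes F :: "real \<Rightarrow> 'a::real_normed_vector"
  assumes incr: "\<And>x y. a \<le> x \<Longrightarrow> x \<le> y \<Longrightarrow> y \<le> b \<Longrightarrow>
      norm (F y - F x) \<le> K * (y - x) * \<bar>G y - G x\<bar>"
    and G: "continuous_on {a..b} (G :: real \<Rightarrow> real)" and x: "x \<in> {a..b}"
  shows "F x = F a"
proof -
  have "(F has_derivative (\<lambda>h. 0)) (at x within {a..b})" if x: "x \<in> {a..b}" for x
  proof (rule has_derivativeI_sandwich[where e=1])
    show "((\<lambda>y. \<bar>K\<bar> * \<bar>G y - G x\<bar>) \<longlongrightarrow> 0) (at x within {a..b})"
      using G x by (auto intro!: tendsto_eq_intros simp: continuous_on_def)
    fix y assume y: "y \<in> {a..b}" "y \<noteq> x"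
    have "norm (F y - F x) \<le> K * \<bar>y - x\<bar> * \<bar>G y - G x\<bar>"
      using incr[of x y] incr[of y x] x y by (cases "x \<le> y") (auto simp: norm_minus_commute abs_minus_commute)
    also have "\<dots> \<le> \<bar>K\<bar> * \<bar>y - x\<bar> * \<bar>G y - G x\<bar>" by (intro mult_right_mono) auto
    finally show "norm (F y - F x - 0) / norm (y - x) \<le> \<bar>K\<bar> * \<bar>G y - G x\<bar>"
      using y by (simp add: field_simps)
  qed auto
  then obtain c where "\<forall>x\<in>{a..b}. F x = c"
    using has_derivative_zero_constant[of "{a..b}" F] by auto
  then show ?thesis using x by simp
qed

text \<open>Let \<open>F\<close> be the difference of the two sides.
Replacing the factors without derivative by their values at \<open>x\<close> and \<open>y\<close> turns the integral over
\<open>[x, y]\<close> into the increment of \<open>B (u x) (v x)\<close>, and the error is at most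
\<open>2 K (\<integral> |w|) (\<integral> |z|) \<le> K (y - x) (\<integral> |w|\<^sup>2 + |z|\<^sup>2)\<close> by Cauchy-Schwarz, integrals over \<open>[x, y]\<close>. The
last integral is an increment of a continuous function, so \<open>F\<close> is constant.\<close>

lemma H1_product_rule:
  fixes u :: "real \<Rightarrow> 'a::euclidean_space" and v :: "real \<Rightarrow> 'b::euclidean_space"
    and B :: "'a \<Rightarrow> 'b \<Rightarrow> 'c::euclidean_space"
  assumes B: "bounded_bilinear B" and u: "H1 a b u w" and v: "H1 a b v z" and "x \<in> {a..b}"
  shows "B (u x) (v x) = B (u a) (v a) + integral {a..x} (\<lambda>t. B (w t) (v t) + B (u t) (z t))"
proof -
  interpret bounded_bilinear B by fact
  obtain K where K: "K > 0" "\<And>x y. norm (B x y) \<le> norm x * norm y * K"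
    using pos_bounded by blast
  note uc = H1_continuous[OF u] and vc = H1_continuous[OF v]
  note w = H1_L2[OF u] and z = H1_L2[OF v]
  define G where "G x = integral {a..x} (\<lambda>t. (norm (w t))\<^sup>2 + (norm (z t))\<^sup>2)" for x
  define P where "P t = B (w t) (v t) + B (u t) (z t)" for t
  define F where "F x = B (u x) (v x) - integral {a..x} P" for x
  have wi: "(\<lambda>t. (norm (w t))\<^sup>2 + (norm (z t))\<^sup>2) integrable_on {a..b}"
    using w z unfolding L2_def by (intro integrable_add) auto
  have Gc: "continuous_on {a..b} G"
    unfolding G_def by (intro indefinite_integral_continuous_1 wi)
  have Bw: "(\<lambda>t. B (w t) (v' t)) integrable_on {x..y}"
    if "continuous_on {a..b} v'" "{x..y} \<subseteq> {a..b}" for v' x y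
    using L2_bilinear_absolutely_integrable[OF B L2_subinterval[OF w that(2)]
        L2_continuous[OF continuous_on_subset[OF that]]]
    unfolding absolutely_integrable_on_def by auto
  have Bz: "(\<lambda>t. B (u' t) (z t)) integrable_on {x..y}"
    if "continuous_on {a..b} u'" "{x..y} \<subseteq> {a..b}" for u' x y
    using L2_bilinear_absolutely_integrable[OF B
        L2_continuous[OF continuous_on_subset[OF that]] L2_subinterval[OF z that(2)]]
    unfolding absolutely_integrable_on_def by auto
  have Pi: "P integrable_on {x..y}" if "{x..y} \<subseteq> {a..b}" for x y
    unfolding P_def by (intro integrable_add Bw Bz uc vc that)
  have "norm (F y - F x) \<le> K * (y - x) * \<bar>G y - G x\<bar>" if xy: "a \<le> x" "x \<le> y" "y \<le> b" for x y
  proof -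
    define W where "W = integral {x..y} (\<lambda>t. norm (w t))"
    define Z where "Z = integral {x..y} (\<lambda>t. norm (z t))"
    have sub: "{x..y} \<subseteq> {a..b}" using xy by auto
    have nn: "W \<ge> 0" "Z \<ge> 0" unfolding W_def Z_def
      by (intro integral_nonneg L2_integrable[OF w sub] L2_integrable[OF z sub] norm_ge_zero)+
    have Wt: "norm (u x - u t) \<le> W" and Zt: "norm (v y - v t) \<le> Z" if "t \<in> {x..y}" for t
    proof -
      have "norm (u x - u t) \<le> integral {x..t} (\<lambda>t. norm (w t))"
        using H1_norm_increment_le(1)[OF u, of x t] xy that by (simp add: norm_minus_commute)
      also have "\<dots> \<le> W" unfolding W_def
        using xy that by (intro integral_subset_le L2_integrable[OF w]) auto
      finally show "norm (u x - u t) \<le> W" .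
      have "norm (v y - v t) \<le> integral {t..y} (\<lambda>t. norm (z t))"
        using H1_norm_increment_le(1)[OF v, of t y] xy that by simp
      also have "\<dots> \<le> Z" unfolding Z_def
        using xy that by (intro integral_subset_le L2_integrable[OF z]) auto
      finally show "norm (v y - v t) \<le> Z" .
    qed
    have "integral {a..x} P + integral {x..y} P = integral {a..y} P"
      using xy by (intro Henstock_Kurzweil_Integration.integral_combine Pi) auto
    then have "F y - F x = B (u y) (v y) - B (u x) (v x) - integral {x..y} P"
      unfolding F_def by (simp add: algebra_simps)
    also have "\<dots> = B (u y - u x) (v y) + B (u x) (v y - v x) - integral {x..y} P"
      by (simp add: diff_left diff_right)
    also have "B (u y - u x) (v y) = integral {x..y} (\<lambda>t. B (w t) (v y))"
      unfolding H1_increment[OF u xy]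
      using integral_linear[OF L2_integrable(1)[OF w sub] bounded_linear_left] by (simp add: o_def)
    also have "B (u x) (v y - v x) = integral {x..y} (\<lambda>t. B (u x) (z t))"
      unfolding H1_increment[OF v xy]
      using integral_linear[OF L2_integrable(1)[OF z sub] bounded_linear_right] by (simp add: o_def)
    also have "integral {x..y} (\<lambda>t. B (w t) (v y)) + integral {x..y} (\<lambda>t. B (u x) (z t)) - integral {x..y} P
      = integral {x..y} (\<lambda>t. B (w t) (v y) + B (u x) (z t) - P t)"
      using sub by (simp add: integral_add integral_diff Bw Bz Pi integrable_add)
    also have "\<dots> = integral {x..y} (\<lambda>t. B (w t) (v y - v t) + B (u x - u t) (z t))"
      unfolding P_def by (simp add: diff_left diff_right algebra_simps)
    finally have "norm (F y - F x) \<le> integral {x..y} (\<lambda>t. norm (w t) * (Z * K) + norm (z t) * (W * K))"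
    proof (simp, intro integral_norm_bound_integral)
      show "(\<lambda>t. B (w t) (v y - v t) + B (u x - u t) (z t)) integrable_on {x..y}"
        by (intro integrable_add Bw Bz sub continuous_intros uc vc)
      show "(\<lambda>t. norm (w t) * (Z * K) + norm (z t) * (W * K)) integrable_on {x..y}"
        using L2_integrable(2)[OF w sub] L2_integrable(2)[OF z sub]
        by (intro integrable_add integrable_on_mult_left)
      fix t assume t: "t \<in> {x..y}"
      have "norm (B (w t) (v y - v t)) \<le> norm (w t) * norm (v y - v t) * K" by (rule K)
      also have "\<dots> \<le> norm (w t) * Z * K"
        using Zt[OF t] K by (intro mult_right_mono mult_left_mono) auto
      finally have 1: "norm (B (w t) (v y - v t)) \<le> norm (w t) * (Z * K)" by (simp add: mult_ac)
      have "norm (B (u x - u t) (z t)) \<le> norm (u x - u t) * norm (z t) * K" by (rule K)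
      also have "\<dots> \<le> W * norm (z t) * K"
        using Wt[OF t] K by (intro mult_right_mono mult_left_mono) auto
      finally have 2: "norm (B (u x - u t) (z t)) \<le> norm (z t) * (W * K)" by (simp add: mult_ac)
      show "norm (B (w t) (v y - v t) + B (u x - u t) (z t)) \<le> norm (w t) * (Z * K) + norm (z t) * (W * K)"
        using norm_triangle_ineq[of "B (w t) (v y - v t)" "B (u x - u t) (z t)"] 1 2 by linarith
    qed
    also have "\<dots> = W * (Z * K) + Z * (W * K)"
      unfolding W_def Z_def using L2_integrable(2)[OF w sub] L2_integrable(2)[OF z sub]
      by (simp add: integral_add integrable_on_mult_left)
    also have "\<dots> = K * (2 * W * Z)" by (simp add: mult_ac)
    also have "\<dots> \<le> K * (W\<^sup>2 + Z\<^sup>2)"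
      using K(1) sum_squares_bound[of W Z] by (intro mult_left_mono) auto
    also have "\<dots> \<le> K * ((y - x) * integral {x..y} (\<lambda>t. (norm (w t))\<^sup>2) +
        (y - x) * integral {x..y} (\<lambda>t. (norm (z t))\<^sup>2))"
      unfolding W_def Z_def using K(1) xy
      by (intro mult_left_mono add_mono L2_Cauchy_Schwarz L2_subinterval[OF w sub] L2_subinterval[OF z sub]) auto
    also have "\<dots> = K * (y - x) * (integral {x..y} (\<lambda>t. (norm (w t))\<^sup>2 + (norm (z t))\<^sup>2))"
      using L2_integrable(3)[OF w sub] L2_integrable(3)[OF z sub]
      by (simp add: integral_add algebra_simps)
    also have "integral {x..y} (\<lambda>t. (norm (w t))\<^sup>2 + (norm (z t))\<^sup>2) = G y - G x"
      using Henstock_Kurzweil_Integration.integral_combine[OF xy(1,2), of "\<lambda>t. (norm (w t))\<^sup>2 + (norm (z t))\<^sup>2"]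
        integrable_on_subinterval[OF wi, of a y] xy unfolding G_def by (simp add: algebra_simps)
    also have "K * (y - x) * (G y - G x) \<le> K * (y - x) * \<bar>G y - G x\<bar>"
      using K xy by (intro mult_left_mono) auto
    finally show ?thesis .
  qed
  from constant_if_increments_small[OF this Gc assms(4)]
  have "F x = F a" .
  then show ?thesis unfolding F_def P_def by (simp add: algebra_simps)
qed

section \<open>Functions determined by their integrals\<close>

lemma integral_eq_if_negligible_neq:
  assumes "negligible {x \<in> S. f x \<noteq> g x}"
  shows "integral S f = integral S g"
  using assms by (rule integral_spike) auto

lemma negligible_if_AE:
  fixes S :: "'a::euclidean_space set"
  assumes "AE x in lborel. x \<in> S \<longrightarrow> P x"
  shows "negligible {x \<in> S. \<not> P x}"
proof -
  from assms obtain N where N: "{x \<in> space lborel. \<not> (x \<in> S \<longrightarrow> P x)} \<subseteq> N" "N \<in> null_sets lborel"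
    by (rule AE_E3) blast
  then have "negligible N"
    by (simp add: negligible_iff_null_sets null_sets_completionI)
  then show ?thesis by (rule negligible_subset) (use N(1) in auto)
qed

lemma set_integrable_lborel_if_absolutely_integrable:
  fixes f :: "real \<Rightarrow> 'a::euclidean_space"
  assumes "set_borel_measurable borel {a..b} f" "f absolutely_integrable_on {a..b}"
  shows "set_integrable lborel {a..b} f"
proof -
  have "(\<lambda>x. indicat_real {a..b} x *\<^sub>R f x) \<in> borel_measurable lborel"
    using assms(1) unfolding set_borel_measurable_def by simp
  from integrable_completion[OF this] assms(2) show ?thesis
    unfolding set_integrable_def by simp
qed

text \<open>The integrals of \<open>f\<close> over half-lines vanish; these generate the Borel sets and are closed under
intersection, so the integrals over all Borel sets vanish.\<close>

lemma negligible_if_integral_zero: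
  fixes f :: "real \<Rightarrow> 'a::euclidean_space"
  assumes f: "set_integrable lborel {a..b} f"
    and zero: "\<And>x. x \<in> {a..b} \<Longrightarrow> integral {a..x} f = 0"
  shows "negligible {x \<in> {a..b}. f x \<noteq> 0}"
proof -
  define g where "g x = indicat_real {a..b} x *\<^sub>R f x" for x
  have gi: "integrable lborel g" using f unfolding g_def set_integrable_def .
  have gA: "set_integrable lborel A g" if "A \<in> sets borel" for A
    using gi that unfolding set_integrable_def by (intro integrable_mult_indicator) auto
  have halfline: "set_lebesgue_integral lborel {..x} g = 0" for x
  proof -
    have "set_lebesgue_integral lborel {..x} g = set_lebesgue_integral lborel {a..min x b} f"
      unfolding set_lebesgue_integral_def g_def
      by (intro Bochner_Integration.integral_cong) (auto simp: indicator_def)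
    also have "\<dots> = integral {a..min x b} f"
      by (intro set_borel_integral_eq_integral set_integrable_subset[OF f]) auto
    also have "\<dots> = 0" using zero[of "min x b"] by (cases "a \<le> min x b") auto
    finally show ?thesis .
  qed
  have total: "integral\<^sup>L lborel g = 0"
  proof -
    have "integral\<^sup>L lborel g = set_lebesgue_integral lborel {..b} g"
      unfolding set_lebesgue_integral_def g_def
      by (intro Bochner_Integration.integral_cong) (auto simp: indicator_def)
    then show ?thesis by (simp add: halfline)
  qed
  have stable: "Int_stable (range (\<lambda>x::real. {..x}))"
    by (auto simp: Int_stable_def)
  have PowI: "range (\<lambda>x::real. {..x}) \<subseteq> Pow UNIV" by simp
  have all: "set_lebesgue_integral lborel A g = 0" if "A \<in> sigma_sets UNIV (range (\<lambda>x::real. {..x}))" for A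
    using stable PowI that
  proof (induction A rule: sigma_sets_induct_disjoint)
    case (basic A)
    then show ?case using halfline by auto
  next
    case empty
    then show ?case by (simp add: set_lebesgue_integral_def)
  next
    case (compl A)
    have A: "A \<in> sets borel" using compl(1) unfolding borel_eq_atMost by simp
    have "set_lebesgue_integral lborel (A \<union> (UNIV - A)) g =
        set_lebesgue_integral lborel A g + set_lebesgue_integral lborel (UNIV - A) g"
      using A by (intro set_integral_Un gA) auto
    moreover have "set_lebesgue_integral lborel (A \<union> (UNIV - A)) g = integral\<^sup>L lborel g"
      by (simp add: set_lebesgue_integral_def)
    ultimately show ?case using compl(2) total by simp
  next
    case (union A)
    have A: "A i \<in> sets borel" for i using union(2) unfolding borel_eq_atMost by auto
    have "set_lebesgue_integral lborel (\<Union>i. A i) g = (\<Sum>i. set_lebesgue_integral lborel (A i) g)"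
      using A union(1) by (intro lebesgue_integral_countable_add gA) (auto simp: disjoint_family_on_def)
    then show ?case using union(3) by simp
  qed
  have "AE x in lborel. g x = 0"
    by (rule sigma_finite_measure.density_zero[OF sigma_finite_lborel gi]) (rule all, simp add: borel_eq_atMost)
  then have "AE x in lborel. x \<in> {a..b} \<longrightarrow> f x = 0" by (auto simp: g_def)
  then show ?thesis by (rule negligible_if_AE)
qed

lemma H1_derivative_unique:
  assumes w: "H1 a b u w" and w': "H1 a b u w'"
  shows "negligible {x \<in> {a..b}. w x \<noteq> w' x}"
proof -
  have d: "L2 a b (\<lambda>x. w x - w' x)" by (intro L2_diff H1_L2[OF w] H1_L2[OF w'])
  have "integral {a..x} (\<lambda>x. w x - w' x) = 0" if x: "x \<in> {a..b}" for x
  proof -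
    have "integral {a..x} w = integral {a..x} w'"
      using H1_eq[OF w x] H1_eq[OF w' x] by (metis add_left_imp_eq)
    moreover have "w integrable_on {a..x}" "w' integrable_on {a..x}"
      using x by (intro L2_integrable[OF H1_L2[OF w]] L2_integrable[OF H1_L2[OF w']]; auto)+
    ultimately show ?thesis by (simp add: integral_diff)
  qed
  with set_integrable_lborel_if_absolutely_integrable[OF _ L2_absolutely_integrable[OF d]] d
  have "negligible {x \<in> {a..b}. w x - w' x \<noteq> 0}"
    by (intro negligible_if_integral_zero) (auto simp: L2_def)
  then show ?thesis by simp
qed

lemma continuous_eq_if_negligible_neq:
  fixes u v :: "real \<Rightarrow> 'a::euclidean_space"
  assumes "a < b" and c: "continuous_on {a..b} u" "continuous_on {a..b} v"
    and neg: "negligible {x \<in> {a..b}. u x \<noteq> v x}" and x: "x \<in> {a..b}"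
  shows "u x = v x"
proof -
  have "integral {a..b} (\<lambda>x. norm (u x - v x)) = integral {a..b} (\<lambda>x. 0)"
    by (intro integral_eq_if_negligible_neq negligible_subset[OF neg]) auto
  then have "\<forall>x\<in>{a..b}. norm (u x - v x) = 0"
    using \<open>a < b\<close> c by (subst (asm) integral_0, subst (asm) integral_eq_0_iff)
      (auto intro!: continuous_intros)
  then show ?thesis using x by simp
qed

section \<open>Weak derivatives on the interval from -1 to 1\<close>

text \<open>Weak derivatives, lengths and energies are Lebesgue integrals over an open interval; the calculus
of \<^const>\<open>H1\<close> functions uses integrals over closed intervals.\<close>

lemma Lebesgue_Ioo_eq_integral_Icc:
  fixes f :: "real \<Rightarrow> 'a::euclidean_space"
  assumes "set_borel_measurable borel {a..b} f" "f absolutely_integrable_on {a..b}"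
  shows "(LINT x:{a<..<b}|lborel. f x) = integral {a..b} f"
proof -
  have "set_integrable lborel {a<..<b} f"
    using set_integrable_lborel_if_absolutely_integrable[OF assms]
    by (rule set_integrable_subset) auto
  then show ?thesis
    by (simp add: set_borel_integral_eq_integral(2) integral_open_interval_real)
qed

lemma L2_imp_square_integrable:
  assumes w: "L2 (-1) 1 w"
  shows "square_integrable w"
  unfolding square_integrable_def
proof
  have m: "set_borel_measurable borel {-1..1} w" using w unfolding L2_def by simp
  then have "set_borel_measurable borel {-1<..<1} w"
    by (rule set_borel_measurable_subset) auto
  then show "set_borel_measurable lborel {-1<..<1} w"
    by (simp add: set_borel_measurable_def)
  have "set_borel_measurable borel {-1..1} (\<lambda>x. w x \<bullet> w x)"
    by (rule set_borel_measurable_bilinear[OF bounded_bilinear_inner m m])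
  from set_integrable_lborel_if_absolutely_integrable[OF this
      L2_bilinear_absolutely_integrable[OF bounded_bilinear_inner w w]]
  have "set_integrable lborel {-1<..<1} (\<lambda>x. w x \<bullet> w x)"
    by (rule set_integrable_subset) auto
  then show "set_integrable lborel {-1<..<1} (\<lambda>x. (norm (w x))\<^sup>2)"
    by (simp add: power2_norm_eq_inner)
qed

text \<open>Square integrability constrains a function on the open interval only. Setting the function to zero
at and beyond the end points makes it Borel measurable on the closed interval.\<close>

definition restrict_Ioo :: "(real \<Rightarrow> 'a::real_vector) \<Rightarrow> real \<Rightarrow> 'a" where
  "restrict_Ioo w x = indicat_real {-1<..<1} x *\<^sub>R w x"

lemma restrict_Ioo_eq: "x \<in> {-1<..<1} \<Longrightarrow> restrict_Ioo w x = w x"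
  by (simp add: restrict_Ioo_def)

lemma negligible_restrict_Ioo: "negligible {x \<in> {-1..1}. restrict_Ioo w x \<noteq> w x}"
  by (rule negligible_subset[of "{-1, 1}"]) (auto simp: restrict_Ioo_def indicator_def)

lemma square_integrable_imp_L2:
  assumes w: "square_integrable w"
  shows "L2 (-1) 1 (restrict_Ioo w)"
  unfolding L2_def
proof
  have "restrict_Ioo w \<in> borel_measurable borel"
    using w unfolding square_integrable_def set_borel_measurable_def restrict_Ioo_def[abs_def] by simp
  then show "set_borel_measurable borel {-1..1} (restrict_Ioo w)"
    unfolding set_borel_measurable_def by measurable
  have "(\<lambda>x. (norm (w x))\<^sup>2) integrable_on {-1<..<1}"
    using w unfolding square_integrable_def
    by (intro set_borel_integral_eq_integral) auto
  then have "(\<lambda>x. (norm (w x))\<^sup>2) integrable_on {-1..1}"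
    by (simp add: integrable_on_open_interval_real)
  then show "(\<lambda>x. (norm (restrict_Ioo w x))\<^sup>2) integrable_on {-1..1}"
    by (rule integrable_spike[of _ _ "{-1,1}"]) (auto simp: restrict_Ioo_def indicator_def)
qed

lemma test_function_C1:
  assumes "test_function \<phi>"
  obtains "\<And>x. (\<phi> has_vector_derivative deriv \<phi> x) (at x)" "continuous_on UNIV (deriv \<phi>)"
    "\<phi> (-1) = 0" "\<phi> 1 = 0"
proof -
  from assms obtain D where D: "\<And>x. (\<phi> has_vector_derivative D x) (at x)" "continuous_on UNIV D"
    unfolding test_function_def C1_differentiable_on_def by auto
  then have "deriv \<phi> x = D x" for x
    by (intro DERIV_imp_deriv) (simp add: has_real_derivative_iff_has_vector_derivative)
  then have "deriv \<phi> = D" by auto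
  moreover from assms have "\<phi> (-1) = 0" "\<phi> 1 = 0" unfolding test_function_def by auto
  ultimately show ?thesis using D that by simp
qed

lemma test_function_integral_eq:
  fixes u g :: "real \<Rightarrow> 'a::euclidean_space"
  assumes "test_function \<phi>" "L2 (-1) 1 u"
  shows "(LINT x:{-1<..<1}|lborel. deriv \<phi> x *\<^sub>R u x) = integral {-1..1} (\<lambda>x. deriv \<phi> x *\<^sub>R u x)"
    "(LINT x:{-1<..<1}|lborel. \<phi> x *\<^sub>R u x) = integral {-1..1} (\<lambda>x. \<phi> x *\<^sub>R u x)"
proof -
  from test_function_C1[OF assms(1)] have
    d: "\<And>x. (\<phi> has_vector_derivative deriv \<phi> x) (at x)" and c: "continuous_on UNIV (deriv \<phi>)"
    by blast+
  have c2: "continuous_on {-1..1} \<phi>"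
    by (intro continuous_at_imp_continuous_on ballI) (use d has_vector_derivative_continuous in blast)
  have c1: "continuous_on {-1..1} (deriv \<phi>)" using c continuous_on_subset by blast
  have *: "(LINT x:{-1<..<1}|lborel. f x *\<^sub>R u x) = integral {-1..1} (\<lambda>x. f x *\<^sub>R u x)"
    if f: "continuous_on {-1..1} f" for f
    using assms(2) L2_continuous[OF f] unfolding L2_def
    by (intro Lebesgue_Ioo_eq_integral_Icc set_borel_measurable_bilinear[OF bounded_bilinear_scaleR]
        L2_bilinear_absolutely_integrable[OF bounded_bilinear_scaleR] L2_continuous f assms) auto
  show "(LINT x:{-1<..<1}|lborel. deriv \<phi> x *\<^sub>R u x) = integral {-1..1} (\<lambda>x. deriv \<phi> x *\<^sub>R u x)"
    "(LINT x:{-1<..<1}|lborel. \<phi> x *\<^sub>R u x) = integral {-1..1} (\<lambda>x. \<phi> x *\<^sub>R u x)"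
    using *[OF c1] *[OF c2] by auto
qed

text \<open>The product rule on the whole interval, with boundary terms that vanish.\<close>

lemma H1_integral_by_parts_test_function:
  assumes u: "H1 (-1) 1 u w" and \<phi>: "test_function \<phi>"
  shows "integral {-1..1} (\<lambda>x. deriv \<phi> x *\<^sub>R u x) = - integral {-1..1} (\<lambda>x. \<phi> x *\<^sub>R w x)"
proof -
  obtain d: "\<And>x. (\<phi> has_vector_derivative deriv \<phi> x) (at x)" and c: "continuous_on UNIV (deriv \<phi>)"
    and z: "\<phi> (-1) = 0" "\<phi> 1 = 0"
    using test_function_C1[OF \<phi>] by blast
  have H: "H1 (-1) 1 \<phi> (deriv \<phi>)"
    by (rule H1_of_C1, rule has_vector_derivative_at_within, rule d, rule continuous_on_subset[OF c])
      simp
  have i: "(\<lambda>x. deriv \<phi> x *\<^sub>R u x) integrable_on {-1..1}" "(\<lambda>x. \<phi> x *\<^sub>R w x) integrable_on {-1..1}"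
    using L2_bilinear_absolutely_integrable[OF bounded_bilinear_scaleR H1_L2[OF H]
        L2_continuous[OF H1_continuous[OF u]]]
      L2_bilinear_absolutely_integrable[OF bounded_bilinear_scaleR
        L2_continuous[OF H1_continuous[OF H]] H1_L2[OF u]]
    unfolding absolutely_integrable_on_def by auto
  have "\<phi> 1 *\<^sub>R u 1 = \<phi> (-1) *\<^sub>R u (-1) +
      integral {-1..1} (\<lambda>x. deriv \<phi> x *\<^sub>R u x + \<phi> x *\<^sub>R w x)"
    by (rule H1_product_rule[OF bounded_bilinear_scaleR H u]) simp
  then show ?thesis using i by (simp add: z integral_add eq_neg_iff_add_eq_0)
qed

lemma H1_has_weak_derivative:
  assumes u: "H1 (-1) 1 u w"
  shows "has_weak_derivative u w"
  unfolding has_weak_derivative_def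
  using test_function_integral_eq[OF _ L2_continuous[OF H1_continuous[OF u]]]
    test_function_integral_eq[OF _ H1_L2[OF u]] H1_integral_by_parts_test_function[OF u]
    L2_imp_square_integrable[OF L2_continuous[OF H1_continuous[OF u]]]
    L2_imp_square_integrable[OF H1_L2[OF u]]
  by simp

text \<open>Vanishing mean is what makes the primitive of \<open>\<psi>\<close> vanish to the right of the support of \<open>\<psi>\<close>.\<close>

lemma test_function_primitive:
  assumes c: "continuous_on UNIV \<psi>" and e: "0 < e" "e < 1"
    and supp: "\<And>x. x \<notin> {-1 + e..1 - e} \<Longrightarrow> \<psi> x = 0"
    and mean: "integral {-1..1} \<psi> = 0"
  obtains \<phi> where "test_function \<phi>" "deriv \<phi> = \<psi>"
proof
  define \<phi> where "\<phi> x = (if x < -1 + e then 0 else integral {-1 + e..x} \<psi>)" for x :: real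
  have i: "\<psi> integrable_on {x..y}" for x y
    by (intro integrable_continuous_real continuous_on_subset[OF c]) auto
  have zero: "integral S \<psi> = 0" if "\<And>x. x \<in> S \<Longrightarrow> \<psi> x = 0" for S
    using integral_cong[of S \<psi> "\<lambda>_. 0"] that by simp
  have \<psi>z: "\<psi> (-1 + e) = 0" "\<psi> (1 - e) = 0"
  proof -
    have "closure {x. x < -1 + e} \<subseteq> {x. \<psi> x = 0}"
      by (rule closure_minimal) (auto intro!: supp closed_Collect_eq c continuous_on_const)
    moreover have "-1 + e \<in> closure {..< -1 + e}" by simp
    ultimately show "\<psi> (-1 + e) = 0" by (auto simp: lessThan_def)
    have "closure {x. x > 1 - e} \<subseteq> {x. \<psi> x = 0}"
      by (rule closure_minimal) (auto intro!: supp closed_Collect_eq c continuous_on_const)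
    moreover have "1 - e \<in> closure {1 - e<..}" by simp
    ultimately show "\<psi> (1 - e) = 0" by (auto simp: greaterThan_def)
  qed
  \<comment> \<open>The first form shows that \<open>\<phi>\<close> vanishes on the left; the second, whose lower limit is any point
    to the left of the support, is differentiable also at \<open>-1 + e\<close>.\<close>
  have phi: "\<phi> x = integral {-2..x} \<psi>" for x
  proof (cases "x < -1 + e")
    case True
    have "integral {-2..x} \<psi> = 0" by (rule zero, rule supp) (use True in auto)
    then show ?thesis unfolding \<phi>_def using True by simp
  next
    case False
    have "integral {-2..-1 + e} \<psi> + integral {-1 + e..x} \<psi> = integral {-2..x} \<psi>"
      using False e by (intro Henstock_Kurzweil_Integration.integral_combine i) auto
    moreover have "integral {-2..-1 + e} \<psi> = 0"
      by (rule zero) (metis \<psi>z(1) atLeastAtMost_iff order.antisym supp)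
    ultimately show ?thesis using False by (simp add: \<phi>_def)
  qed
  have d: "(\<phi> has_vector_derivative \<psi> x) (at x)" for x
  proof (cases "x < -1 + e")
    case True
    have "((\<lambda>_. 0) has_vector_derivative \<psi> x) (at x)"
      using True by (subst supp) auto
    then show ?thesis
      by (rule has_vector_derivative_transform_within_open[of _ _ _ "{..< -1 + e}"])
        (use True in \<open>auto simp: \<phi>_def\<close>)
  next
    case False
    then have x: "x \<in> {-2<..<x + 1}" using e by auto
    have "((\<lambda>u. integral {-2..u} \<psi>) has_vector_derivative \<psi> x) (at x within {-2..x + 1})"
      using x by (intro integral_has_vector_derivative continuous_on_subset[OF c]) auto
    then have "(\<phi> has_vector_derivative \<psi> x) (at x within {-2<..<x + 1})"
      unfolding phi[abs_def] by (rule has_vector_derivative_within_subset) auto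
    then show ?thesis by (subst (asm) has_vector_derivative_within_open[OF x]) auto
  qed
  show deriv: "deriv \<phi> = \<psi>"
    by (rule ext, rule DERIV_imp_deriv) (use d in \<open>simp add: has_real_derivative_iff_has_vector_derivative\<close>)
  have "\<phi> x = 0" if "x \<notin> {-1 + e..1 - e}" for x
  proof (cases "x < -1 + e")
    case False
    then have x: "x > 1 - e" using that by auto
    have "\<phi> x = integral {-2..1 - e} \<psi> + integral {1 - e..x} \<psi>"
      unfolding phi using x e by (intro Henstock_Kurzweil_Integration.integral_combine[symmetric] i) auto
    also have "integral {1 - e..x} \<psi> = 0"
      by (rule zero) (metis \<psi>z(2) atLeastAtMost_iff order.antisym supp)
    also have "integral {-2..1 - e} \<psi> = \<phi> (1 - e)" by (simp add: phi)
    also have "\<dots> = integral {-1 + e..1 - e} \<psi>" using e by (auto simp: \<phi>_def)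
    also have "\<dots> = integral {-1..1} \<psi>"
      by (rule integral_unique[symmetric], rule has_integral_on_superset[OF integrable_integral[OF i]])
        (use e in \<open>auto intro!: supp\<close>)
    finally show ?thesis using mean by simp
  qed (simp add: \<phi>_def)
  then have "\<exists>K. compact K \<and> K \<subseteq> {-1<..<1} \<and> (\<forall>x. x \<notin> K \<longrightarrow> \<phi> x = 0)"
    using e by (intro exI[of _ "{-1 + e..1 - e}"]) auto
  moreover have "\<phi> C1_differentiable_on UNIV"
    unfolding C1_differentiable_on_def using d c by (intro exI[of _ \<psi>]) auto
  ultimately show "test_function \<phi>" unfolding test_function_def by blast
qed

text \<open>Every test function derivative is annihilated by \<open>f\<close>, hence every continuous function of mean zero
with support in the open interval. Subtracting a multiple of one fixed bump \<open>\<psi>0\<close> therefore gives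
\<open>\<integral> \<psi> f = (\<integral> \<psi>) c\<close> for every such \<open>\<psi>\<close>, with the same vector \<open>c\<close>. Trapezoids \<open>\<psi>\<close> that converge to the
indicator function of an interval turn this into the claim.\<close>

lemma du_Bois_Reymond:
  assumes f: "L2 (-1) 1 f"
    and weak: "\<And>\<phi>. test_function \<phi> \<Longrightarrow> integral {-1..1} (\<lambda>x. deriv \<phi> x *\<^sub>R f x) = 0"
  obtains c where "\<And>y. y \<in> {-1..1} \<Longrightarrow> integral {-1..y} f = (y + 1) *\<^sub>R c"
proof -
  define \<psi> where "\<psi> y n x = max 0 (min 1 (min (real n * (x + 1) - 1) (real n * (y - x) - 1)))"
    for y :: real and n :: nat and x :: real
  have \<psi>c: "continuous_on S (\<psi> y n)" for S y n
    unfolding \<psi>_def by (intro continuous_intros)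
  have \<psi>i: "(\<psi> y n) integrable_on {a..b}" for y n a b
    by (intro integrable_continuous_real \<psi>c)
  have \<psi>fi: "(\<lambda>x. \<psi> y n x *\<^sub>R f x) integrable_on {-1..1}" for y n
    using L2_bilinear_absolutely_integrable[OF bounded_bilinear_scaleR L2_continuous[OF \<psi>c] f]
    unfolding absolutely_integrable_on_def by auto
  have supp: "\<psi> y n x = 0" if "n \<ge> 2" "y \<le> 1" "x \<notin> {-1 + 1 / real n..1 - 1 / real n}" for y n x
  proof -
    have "x < -1 + 1 / real n \<or> x > 1 - 1 / real n" using that by auto
    then have "real n * (x + 1) - 1 < 0 \<or> real n * (1 - x) - 1 < 0"
      using that(1) by (auto simp: field_simps)
    moreover have "real n * (y - x) \<le> real n * (1 - x)" using that by (intro mult_left_mono) auto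
    ultimately show ?thesis unfolding \<psi>_def by auto
  qed
  define \<psi>0 where "\<psi>0 = \<psi> 1 4"
  define I0 where "I0 = integral {-1..1} \<psi>0"
  have "I0 \<noteq> 0"
  proof
    assume "I0 = 0"
    then have "\<forall>x\<in>{-1..1}. \<psi>0 x = 0"
      unfolding I0_def \<psi>0_def by (subst (asm) integral_eq_0_iff[OF \<psi>c]) (auto simp: \<psi>_def)
    then have "\<psi>0 0 = 0" by simp
    then show False by (simp add: \<psi>0_def \<psi>_def)
  qed
  define c where "c = (1 / I0) *\<^sub>R integral {-1..1} (\<lambda>x. \<psi>0 x *\<^sub>R f x)"
  have test: "integral {-1..1} (\<lambda>x. \<psi> y n x *\<^sub>R f x) = integral {-1..1} (\<psi> y n) *\<^sub>R c"
    if "n \<ge> 2" "y \<le> 1" for y n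
  proof -
    define r where "r = integral {-1..1} (\<psi> y n) / I0"
    define \<eta> where "\<eta> x = \<psi> y n x - r * \<psi>0 x" for x
    obtain \<phi> where \<phi>: "test_function \<phi>" "deriv \<phi> = \<eta>"
    proof (rule test_function_primitive)
      show "continuous_on UNIV \<eta>"
        unfolding \<eta>_def[abs_def] \<psi>0_def by (intro continuous_intros \<psi>c)
      define e where "e = 1 / real (max n 4)"
      show "0 < e" "e < 1" unfolding e_def by auto
      show "\<eta> x = 0" if x: "x \<notin> {-1 + e..1 - e}" for x
      proof -
        have "e \<le> 1 / real n" "e \<le> 1 / real 4"
          unfolding e_def using \<open>n \<ge> 2\<close> by (auto intro!: divide_left_mono)
        then have "x \<notin> {-1 + 1 / real n..1 - 1 / real n}" "x \<notin> {-1 + 1 / real 4..1 - 1 / real 4}"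
          using x by auto
        then have "\<psi> y n x = 0" "\<psi> 1 4 x = 0"
          using supp[of n y x] supp[of 4 1 x] \<open>n \<ge> 2\<close> \<open>y \<le> 1\<close> by auto
        then show ?thesis unfolding \<eta>_def \<psi>0_def by simp
      qed
      have "integral {-1..1} \<eta> = integral {-1..1} (\<psi> y n) - r * I0"
        unfolding \<eta>_def[abs_def] I0_def \<psi>0_def
        by (subst integral_diff) (auto intro!: \<psi>i integrable_on_mult_right)
      then show "integral {-1..1} \<eta> = 0" using \<open>I0 \<noteq> 0\<close> by (simp add: r_def)
    qed
    have "0 = integral {-1..1} (\<lambda>x. \<psi> y n x *\<^sub>R f x - r *\<^sub>R (\<psi>0 x *\<^sub>R f x))"
      using weak[OF \<phi>(1)] by (simp add: \<phi>(2) \<eta>_def scaleR_diff_left)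
    also have "\<dots> = integral {-1..1} (\<lambda>x. \<psi> y n x *\<^sub>R f x) - r *\<^sub>R integral {-1..1} (\<lambda>x. \<psi>0 x *\<^sub>R f x)"
      unfolding \<psi>0_def
      using integral_diff[OF \<psi>fi integrable_cmul[OF \<psi>fi]] by (simp only: integral_cmul)
    finally show ?thesis by (simp add: r_def c_def)
  qed
  have "integral {-1..y} f = (y + 1) *\<^sub>R c" if y: "y \<in> {-1..1}" for y
  proof -
    have conv: "(\<lambda>n. \<psi> y (n + 2) x) \<longlonglongrightarrow> indicat_real {-1<..<y} x" for x
    proof (cases "x \<in> {-1<..<y}")
      case True
      define m where "m = min (x + 1) (y - x)"
      have m: "m > 0" using True by (auto simp: m_def)
      have "\<psi> y (n + 2) x = 1" if "n \<ge> nat \<lceil>2 / m\<rceil>" for n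
      proof -
        have "2 / m \<le> real (n + 2)" using that by linarith
        then have "2 \<le> real (n + 2) * m" using m by (simp add: field_simps)
        moreover have "real (n + 2) * m \<le> real (n + 2) * (x + 1)" "real (n + 2) * m \<le> real (n + 2) * (y - x)"
          by (intro mult_left_mono; simp add: m_def)+
        ultimately have "1 \<le> real (n + 2) * (x + 1) - 1" "1 \<le> real (n + 2) * (y - x) - 1"
          by linarith+
        then show ?thesis unfolding \<psi>_def by simp
      qed
      then have "eventually (\<lambda>n. \<psi> y (n + 2) x = 1) sequentially"
        unfolding eventually_sequentially by blast
      then show ?thesis using True by (simp add: tendsto_eventually)
    next
      case False
      then have "x \<le> -1 \<or> x \<ge> y" by auto
      then have "real (n + 2) * (x + 1) \<le> 0 \<or> real (n + 2) * (y - x) \<le> 0" for n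
        by (auto intro!: mult_nonneg_nonpos)
      then have "\<psi> y (n + 2) x = 0" for n unfolding \<psi>_def by (smt (verit))
      then show ?thesis using False by simp
    qed
    have bnd: "\<bar>\<psi> y n x\<bar> \<le> 1" for n x by (auto simp: \<psi>_def)
    have ind: "integral {-1..1} (\<lambda>x. indicat_real {-1<..<y} x *\<^sub>R h x) = integral {-1..y} h"
      for h :: "real \<Rightarrow> 'c::euclidean_space"
    proof -
      have "integral {-1..1} (\<lambda>x. indicat_real {-1<..<y} x *\<^sub>R h x) =
          integral {-1..1} (\<lambda>x. if x \<in> {-1..y} then h x else 0)"
        by (rule integral_spike[of "{-1, y}"]) (auto simp: indicator_def)
      also have "\<dots> = integral ({-1..y} \<inter> {-1..1}) h"
        by (simp only: integral_restrict_Int)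
      also have "{-1..y} \<inter> {-1..1} = {-1..y}" using y by auto
      finally show ?thesis .
    qed
    have "(\<lambda>n. integral {-1..1} (\<lambda>x. \<psi> y (n + 2) x *\<^sub>R f x)) \<longlonglongrightarrow>
        integral {-1..1} (\<lambda>x. indicat_real {-1<..<y} x *\<^sub>R f x)"
    proof (rule dominated_convergence(2))
      show "(\<lambda>x. norm (f x)) integrable_on {-1..1}" by (rule L2_integrable[OF f order_refl])
      show "norm (\<psi> y (n + 2) x *\<^sub>R f x) \<le> norm (f x)" for n x
        using bnd[of "n + 2" x] by (simp add: mult_left_le_one_le)
      show "(\<lambda>n. \<psi> y (n + 2) x *\<^sub>R f x) \<longlonglongrightarrow> indicat_real {-1<..<y} x *\<^sub>R f x" for x
        by (intro tendsto_scaleR conv tendsto_const)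
    qed (rule \<psi>fi)
    then have 1: "(\<lambda>n. integral {-1..1} (\<psi> y (n + 2)) *\<^sub>R c) \<longlonglongrightarrow> integral {-1..y} f"
      using y by (simp add: ind test)
    have "(\<lambda>n. integral {-1..1} (\<psi> y (n + 2))) \<longlonglongrightarrow>
        integral {-1..1} (\<lambda>x. indicat_real {-1<..<y} x *\<^sub>R 1)"
    proof (rule dominated_convergence(2))
      show "(\<lambda>x. 1::real) integrable_on {-1..1::real}" by (intro integrable_continuous_real continuous_on_const)
      show "norm (\<psi> y (n + 2) x) \<le> 1" for n x using bnd by simp
      show "(\<lambda>n. \<psi> y (n + 2) x) \<longlonglongrightarrow> indicat_real {-1<..<y} x *\<^sub>R 1" for x
        using conv[of x] by simp
    qed (rule \<psi>i)
    then have "(\<lambda>n. integral {-1..1} (\<psi> y (n + 2))) \<longlonglongrightarrow> integral {-1..y} (\<lambda>_. 1)"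
      by (simp only: ind)
    then have "(\<lambda>n. integral {-1..1} (\<psi> y (n + 2))) \<longlonglongrightarrow> y + 1"
      using y by simp
    then have "(\<lambda>n. integral {-1..1} (\<psi> y (n + 2)) *\<^sub>R c) \<longlonglongrightarrow> (y + 1) *\<^sub>R c"
      by (intro tendsto_scaleR tendsto_const)
    with 1 show ?thesis by (rule LIMSEQ_unique)
  qed
  then show ?thesis by (rule that)
qed

text \<open>If \<open>G\<close> is a primitive of the weak derivative, then \<open>u - G\<close> has weak derivative zero and so is
constant almost everywhere.\<close>

lemma weak_derivative_imp_H1:
  fixes u g :: "real \<Rightarrow> 'a::euclidean_space"
  assumes ug: "has_weak_derivative u g"
  obtains v where "H1 (-1) 1 v (restrict_Ioo g)" "negligible {x \<in> {-1..1}. u x \<noteq> v x}"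
proof -
  note sq = ug[unfolded has_weak_derivative_def]
  have gL: "L2 (-1) 1 (restrict_Ioo g)" and uL: "L2 (-1) 1 (restrict_Ioo u)"
    using sq by (auto intro: square_integrable_imp_L2)
  define G where "G x = 0 + integral {-1..x} (restrict_Ioo g)" for x
  have G: "H1 (-1) 1 G (restrict_Ioo g)"
    unfolding G_def[abs_def] by (rule H1_indefinite_integral[OF gL])
  define f where "f x = restrict_Ioo u x - G x" for x
  have GL: "L2 (-1) 1 G" by (intro L2_continuous H1_continuous[OF G])
  have fL: "L2 (-1) 1 f" unfolding f_def[abs_def] by (rule L2_diff[OF uL GL])
  have "integral {-1..1} (\<lambda>x. deriv \<phi> x *\<^sub>R f x) = 0" if \<phi>: "test_function \<phi>" for \<phi>
  proof -
    have *: "(LINT x:{-1<..<1}|lborel. h x *\<^sub>R restrict_Ioo q x) = (LINT x:{-1<..<1}|lborel. h x *\<^sub>R q x)"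
      for h and q :: "real \<Rightarrow> 'a"
      by (rule set_lebesgue_integral_cong) (auto simp: restrict_Ioo_eq)
    have "integral {-1..1} (\<lambda>x. deriv \<phi> x *\<^sub>R restrict_Ioo u x) =
        - integral {-1..1} (\<lambda>x. \<phi> x *\<^sub>R restrict_Ioo g x)"
      using sq \<phi> by (simp flip: test_function_integral_eq[OF \<phi> uL] test_function_integral_eq[OF \<phi> gL]
          add: *)
    also have "\<dots> = integral {-1..1} (\<lambda>x. deriv \<phi> x *\<^sub>R G x)"
      using H1_integral_by_parts_test_function[OF G \<phi>] by simp
    finally have eq: "integral {-1..1} (\<lambda>x. deriv \<phi> x *\<^sub>R restrict_Ioo u x) =
        integral {-1..1} (\<lambda>x. deriv \<phi> x *\<^sub>R G x)" .
    have i: "(\<lambda>x. deriv \<phi> x *\<^sub>R h x) integrable_on {-1..1}" if "L2 (-1) 1 h" for h :: "real \<Rightarrow> 'a"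
    proof -
      have "continuous_on {-1..1} (deriv \<phi>)"
        using test_function_C1[OF \<phi>] continuous_on_subset by blast
      from L2_bilinear_absolutely_integrable[OF bounded_bilinear_scaleR L2_continuous[OF this] that]
      show ?thesis unfolding absolutely_integrable_on_def by auto
    qed
    show ?thesis
      unfolding f_def scaleR_diff_right by (subst integral_diff[OF i[OF uL] i[OF GL]]) (simp add: eq)
  qed
  from du_Bois_Reymond[OF fL this] obtain c where
    c: "\<And>y. y \<in> {-1..1} \<Longrightarrow> integral {-1..y} f = (y + 1) *\<^sub>R c" by blast
  have "H1 (-1) 1 (\<lambda>x. 0 + integral {-1..x} f) f" by (rule H1_indefinite_integral[OF fL])
  moreover have "H1 (-1) 1 (\<lambda>x. 0 + integral {-1..x} f) (\<lambda>_. c)"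
  proof (rule H1_cong[OF H1_indefinite_integral[of "-1" 1 "\<lambda>_. c" 0]])
    show "L2 (-1) 1 (\<lambda>_. c)" by (intro L2_continuous continuous_on_const)
    show "0 + integral {-1..x} f = 0 + integral {-1..x} (\<lambda>_. c)" if "x \<in> {-1..1}" for x
      using c[OF that] that by simp
  qed
  ultimately have "negligible {x \<in> {-1..1}. f x \<noteq> c}" by (rule H1_derivative_unique)
  then have neg: "negligible ({x \<in> {-1..1}. f x \<noteq> c} \<union> {x \<in> {-1..1}. restrict_Ioo u x \<noteq> u x})"
    by (intro negligible_Un negligible_restrict_Ioo)
  show ?thesis
  proof
    show "H1 (-1) 1 (\<lambda>x. c + integral {-1..x} (restrict_Ioo g)) (restrict_Ioo g)"
      by (rule H1_indefinite_integral[OF gL])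
    show "negligible {x \<in> {-1..1}. u x \<noteq> c + integral {-1..x} (restrict_Ioo g)}"
      by (rule negligible_subset[OF neg]) (auto simp: f_def G_def algebra_simps)
  qed
qed

lemma weak_derivative_continuous_imp_H1:
  fixes u g :: "real \<Rightarrow> 'a::euclidean_space"
  assumes ug: "has_weak_derivative u g" and c: "continuous_on {-1..1} u"
  shows "H1 (-1) 1 u (restrict_Ioo g)"
proof -
  obtain v where v: "H1 (-1) 1 v (restrict_Ioo g)" "negligible {x \<in> {-1..1}. u x \<noteq> v x}"
    using weak_derivative_imp_H1[OF ug] .
  from v(1) show ?thesis
  proof (rule H1_cong)
    fix x :: real assume "x \<in> {-1..1}"
    then show "u x = v x"
      by (intro continuous_eq_if_negligible_neq[OF _ c H1_continuous[OF v(1)] v(2)]) auto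
  qed
qed

section \<open>The dyadic characterisation of finite energy\<close>

definition dyadic :: "nat \<Rightarrow> nat \<Rightarrow> real" where
  "dyadic k i = -1 + 2 * real i / 2 ^ k"

text \<open>The integral of \<open>|g|\<^sup>2\<close> for the derivative \<open>g\<close> of the piecewise linear interpolation of \<open>u\<close> at the
dyadic points of level \<open>k\<close>.\<close>

definition dyadic_energy :: "(real \<Rightarrow> 'a::euclidean_space) \<Rightarrow> nat \<Rightarrow> real" where
  "dyadic_energy u k = (\<Sum>i<2 ^ k. 2 ^ k / 2 * (norm (u (dyadic k (Suc i)) - u (dyadic k i)))\<^sup>2)"

definition dyadic_slope :: "(real \<Rightarrow> 'a::euclidean_space) \<Rightarrow> nat \<Rightarrow> nat \<Rightarrow> 'a" where
  "dyadic_slope u k i = (2 ^ k / 2) *\<^sub>R (u (dyadic k (Suc i)) - u (dyadic k i))"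

text \<open>The derivative of the piecewise linear interpolation of \<open>u\<close>; the intervals are half-open so that
they are disjoint.\<close>

definition dyadic_derivative :: "(real \<Rightarrow> 'a::euclidean_space) \<Rightarrow> nat \<Rightarrow> real \<Rightarrow> 'a" where
  "dyadic_derivative u k x =
     (\<Sum>i<2 ^ k. indicat_real {dyadic k i..<dyadic k (Suc i)} x *\<^sub>R dyadic_slope u k i)"

lemma dyadic_0 [simp]: "dyadic k 0 = -1"
  by (simp add: dyadic_def)

lemma dyadic_top [simp]: "dyadic k (2 ^ k) = 1"
  by (simp add: dyadic_def)

lemma dyadic_mono: "i \<le> j \<Longrightarrow> dyadic k i \<le> dyadic k j"
  by (simp add: dyadic_def divide_right_mono)

lemma dyadic_Suc: "dyadic k (Suc i) = dyadic k i + 2 / 2 ^ k"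
  by (simp add: dyadic_def add_divide_distrib)

lemma dyadic_refine: "k \<le> m \<Longrightarrow> dyadic k i = dyadic m (i * 2 ^ (m - k))"
proof -
  assume "k \<le> m"
  then have "(2::real) ^ m = 2 ^ k * 2 ^ (m - k)" by (simp flip: power_add)
  then show ?thesis by (simp add: dyadic_def)
qed

lemma dyadic_mem: "i \<le> 2 ^ k \<Longrightarrow> dyadic k i \<in> {-1..1}"
  using dyadic_mono[of 0 i k] dyadic_mono[of i "2 ^ k" k] by simp

lemma dyadic_derivative_eq:
  assumes "i < 2 ^ k" "x \<in> {dyadic k i..<dyadic k (Suc i)}"
  shows "dyadic_derivative u k x = dyadic_slope u k i"
proof -
  have "indicat_real {dyadic k j..<dyadic k (Suc j)} x = (if j = i then 1 else 0)" for j
  proof -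
    have "x \<notin> {dyadic k j..<dyadic k (Suc j)}" if "j \<noteq> i"
    proof -
      have "Suc j \<le> i \<or> Suc i \<le> j" using that by auto
      then have "dyadic k (Suc j) \<le> dyadic k i \<or> dyadic k (Suc i) \<le> dyadic k j"
        using dyadic_mono by blast
      then show ?thesis using assms by auto
    qed
    then show ?thesis using assms by (auto simp: indicator_def)
  qed
  then have "dyadic_derivative u k x = (\<Sum>j<2 ^ k. if j = i then dyadic_slope u k i else 0)"
    unfolding dyadic_derivative_def by (intro sum.cong) auto
  also have "\<dots> = dyadic_slope u k i" using assms by simp
  finally show ?thesis .
qed

lemma dyadic_derivative_outside:
  assumes "x \<notin> {-1..<1}"
  shows "dyadic_derivative u k x = 0"
  unfolding dyadic_derivative_def
proof (intro sum.neutral ballI)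
  fix i assume "i \<in> {..<(2::nat) ^ k}"
  then have "{dyadic k i..<dyadic k (Suc i)} \<subseteq> {-1..<1}"
    using dyadic_mem[of i k] dyadic_mem[of "Suc i" k] by auto
  then show "indicat_real {dyadic k i..<dyadic k (Suc i)} x *\<^sub>R dyadic_slope u k i = 0"
    using assms by (auto simp: indicator_def)
qed

lemma dyadic_derivative_measurable [measurable]: "dyadic_derivative u k \<in> borel_measurable borel"
  unfolding dyadic_derivative_def[abs_def] by measurable

lemma set_borel_measurable_if_borel:
  fixes w :: "real \<Rightarrow> 'a::euclidean_space"
  assumes [measurable]: "w \<in> borel_measurable borel"
  shows "set_borel_measurable borel {a..b} w"
  unfolding set_borel_measurable_def by measurable

lemma L2_bounded:
  fixes w :: "real \<Rightarrow> 'a::euclidean_space"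
  assumes "w \<in> borel_measurable borel" "\<And>x. norm (w x) \<le> C"
  shows "L2 a b w"
proof -
  have m: "set_borel_measurable borel {a..b} w" by (rule set_borel_measurable_if_borel) fact
  have "(\<lambda>x. (norm (w x))\<^sup>2) absolutely_integrable_on {a..b}"
  proof (rule measurable_bounded_by_integrable_imp_absolutely_integrable)
    show "(\<lambda>x. (norm (w x))\<^sup>2) \<in> borel_measurable (lebesgue_on {a..b})"
      using set_borel_measurable_imp_lebesgue_on[OF m] by measurable
    show "(\<lambda>_. C\<^sup>2) integrable_on {a..b}" by (intro integrable_continuous_real continuous_on_const)
    show "norm ((norm (w x))\<^sup>2) \<le> C\<^sup>2" for x
      using power_mono[OF assms(2)[of x], of 2] by simp
  qed simp
  with m show ?thesis unfolding L2_def absolutely_integrable_on_def by blast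
qed

lemma dyadic_derivative_L2: "L2 a b (dyadic_derivative u k)"
proof (rule L2_bounded[OF dyadic_derivative_measurable])
  fix x
  show "norm (dyadic_derivative u k x) \<le> (\<Sum>i<2 ^ k. norm (dyadic_slope u k i))"
    unfolding dyadic_derivative_def
    by (rule order_trans[OF norm_sum], rule sum_mono)
      (simp add: indicator_def)
qed

lemma integral_dyadic_sum:
  fixes h :: "real \<Rightarrow> 'a::euclidean_space"
  assumes h: "h integrable_on {-1..1}" and "j \<le> 2 ^ k"
  shows "integral {-1..dyadic k j} h = (\<Sum>i<j. integral {dyadic k i..dyadic k (Suc i)} h)"
  using assms(2)
proof (induction j)
  case (Suc j)
  have "integral {-1..dyadic k j} h + integral {dyadic k j..dyadic k (Suc j)} h =
      integral {-1..dyadic k (Suc j)} h"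
    using Suc.prems dyadic_mem[of j k] dyadic_mem[of "Suc j" k]
    by (intro Henstock_Kurzweil_Integration.integral_combine integrable_on_subinterval[OF h] dyadic_mono) auto
  then show ?case using Suc by simp
qed simp

lemma integral_dyadic_piece:
  assumes "i < 2 ^ k"
  shows "integral {dyadic k i..dyadic k (Suc i)} (\<lambda>x. F x (dyadic_derivative u k x)) =
    integral {dyadic k i..dyadic k (Suc i)} (\<lambda>x. F x (dyadic_slope u k i))"
  by (rule integral_spike[of "{dyadic k (Suc i)}"]) (use assms in \<open>auto simp: dyadic_derivative_eq\<close>)

lemma integral_dyadic_derivative:
  assumes "j \<le> 2 ^ k"
  shows "integral {-1..dyadic k j} (dyadic_derivative u k) = u (dyadic k j) - u (-1)"
proof -
  have "integral {-1..dyadic k j} (dyadic_derivative u k) =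
      (\<Sum>i<j. integral {dyadic k i..dyadic k (Suc i)} (dyadic_derivative u k))"
    by (intro integral_dyadic_sum assms L2_integrable[OF dyadic_derivative_L2 order_refl])
  also have "\<dots> = (\<Sum>i<j. u (dyadic k (Suc i)) - u (dyadic k i))"
  proof (rule sum.cong)
    fix i assume "i \<in> {..<j}"
    then have "i < 2 ^ k" using assms by auto
    from integral_dyadic_piece[OF this, of "\<lambda>_ v. v" u]
    have "integral {dyadic k i..dyadic k (Suc i)} (dyadic_derivative u k) =
      (dyadic k (Suc i) - dyadic k i) *\<^sub>R dyadic_slope u k i"
      using dyadic_mono[of i "Suc i" k] by simp
    then show "integral {dyadic k i..dyadic k (Suc i)} (dyadic_derivative u k) =
        u (dyadic k (Suc i)) - u (dyadic k i)"
      by (simp add: dyadic_Suc dyadic_slope_def)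
  qed simp
  also have "\<dots> = u (dyadic k j) - u (-1)"
    using sum_lessThan_telescope[of "\<lambda>i. u (dyadic k i)" j] by simp
  finally show ?thesis .
qed

lemma integral_dyadic_derivative_piece:
  assumes "i < 2 ^ k" "k \<le> m"
  shows "integral {dyadic k i..dyadic k (Suc i)} (dyadic_derivative u m) =
    u (dyadic k (Suc i)) - u (dyadic k i)"
proof -
  have le: "j * 2 ^ (m - k) \<le> 2 ^ m" if "j \<le> 2 ^ k" for j :: nat
    using mult_right_mono[OF that, of "2 ^ (m - k)"] assms(2) by (simp flip: power_add)
  have A: "integral {-1..dyadic k j} (dyadic_derivative u m) = u (dyadic k j) - u (-1)" if "j \<le> 2 ^ k" for j
    using integral_dyadic_derivative[OF le[OF that]] dyadic_refine[OF assms(2)] by metis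
  have "integral {-1..dyadic k i} (dyadic_derivative u m) +
      integral {dyadic k i..dyadic k (Suc i)} (dyadic_derivative u m) =
      integral {-1..dyadic k (Suc i)} (dyadic_derivative u m)"
    using assms(1) dyadic_mem[of i k] dyadic_mono[of i "Suc i" k]
    by (intro Henstock_Kurzweil_Integration.integral_combine
        L2_integrable(1)[OF dyadic_derivative_L2 order_refl]) auto
  then have "integral {dyadic k i..dyadic k (Suc i)} (dyadic_derivative u m) =
      integral {-1..dyadic k (Suc i)} (dyadic_derivative u m) -
      integral {-1..dyadic k i} (dyadic_derivative u m)"
    by (metis add_diff_cancel_left')
  with A[of i] A[of "Suc i"] assms(1) show ?thesis by simp
qed

text \<open>On each interval of level \<open>k\<close> the coarse derivative is the mean value of every finer one. This is the
martingale property, and it makes the increments of the sequence orthogonal.\<close>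

lemma integral_inner_dyadic_derivative:
  assumes "k \<le> m"
  shows "integral {-1..1} (\<lambda>x. dyadic_derivative u k x \<bullet> dyadic_derivative u m x) = dyadic_energy u k"
proof -
  have "(\<lambda>x. dyadic_derivative u k x \<bullet> dyadic_derivative u m x) absolutely_integrable_on {-1..1}"
    by (intro L2_bilinear_absolutely_integrable[OF bounded_bilinear_inner] dyadic_derivative_L2)
  then have i: "(\<lambda>x. dyadic_derivative u k x \<bullet> dyadic_derivative u m x) integrable_on {-1..1}"
    unfolding absolutely_integrable_on_def by simp
  have "integral {-1..dyadic k (2 ^ k)} (\<lambda>x. dyadic_derivative u k x \<bullet> dyadic_derivative u m x) =
    (\<Sum>i<2 ^ k. integral {dyadic k i..dyadic k (Suc i)}
        (\<lambda>x. dyadic_derivative u k x \<bullet> dyadic_derivative u m x))"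
    by (intro integral_dyadic_sum i order_refl)
  also have "\<dots> = (\<Sum>i<2 ^ k. 2 ^ k / 2 * (norm (u (dyadic k (Suc i)) - u (dyadic k i)))\<^sup>2)"
  proof (rule sum.cong)
    fix i assume "i \<in> {..<(2::nat) ^ k}"
    then have i: "i < 2 ^ k" by simp
    have "integral {dyadic k i..dyadic k (Suc i)} (\<lambda>x. dyadic_derivative u k x \<bullet> dyadic_derivative u m x) =
        integral {dyadic k i..dyadic k (Suc i)} (\<lambda>x. dyadic_slope u k i \<bullet> dyadic_derivative u m x)"
      by (rule integral_dyadic_piece[OF i, of "\<lambda>x v. v \<bullet> dyadic_derivative u m x"])
    also have "\<dots> = dyadic_slope u k i \<bullet> integral {dyadic k i..dyadic k (Suc i)} (dyadic_derivative u m)"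
      using integral_linear[OF L2_integrable(1)[OF dyadic_derivative_L2 order_refl] bounded_linear_inner_right]
      by (simp add: o_def)
    also have "\<dots> = 2 ^ k / 2 * (norm (u (dyadic k (Suc i)) - u (dyadic k i)))\<^sup>2"
      by (simp add: integral_dyadic_derivative_piece[OF i assms] dyadic_slope_def power2_norm_eq_inner)
    finally show "integral {dyadic k i..dyadic k (Suc i)} (\<lambda>x. dyadic_derivative u k x \<bullet> dyadic_derivative u m x) =
        2 ^ k / 2 * (norm (u (dyadic k (Suc i)) - u (dyadic k i)))\<^sup>2" .
  qed simp
  finally show ?thesis by (simp add: dyadic_energy_def)
qed

text \<open>Pythagoras: once the dyadic energies converge, the dyadic derivatives form a Cauchy sequence in the
mean square.\<close>

lemma integral_norm_diff_dyadic_derivative: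
  assumes "k \<le> m"
  shows "integral {-1..1} (\<lambda>x. (norm (dyadic_derivative u m x - dyadic_derivative u k x))\<^sup>2) =
    dyadic_energy u m - dyadic_energy u k"
proof -
  have i: "(\<lambda>x. dyadic_derivative u j x \<bullet> dyadic_derivative u l x) integrable_on {-1..1}" for j l
    using L2_bilinear_absolutely_integrable[OF bounded_bilinear_inner
        dyadic_derivative_L2[of "-1" 1 u j] dyadic_derivative_L2[of "-1" 1 u l]]
    unfolding absolutely_integrable_on_def by blast
  have "(\<lambda>x. (norm (dyadic_derivative u m x - dyadic_derivative u k x))\<^sup>2) =
    (\<lambda>x. dyadic_derivative u m x \<bullet> dyadic_derivative u m x + dyadic_derivative u k x \<bullet> dyadic_derivative u k x
      - 2 * (dyadic_derivative u k x \<bullet> dyadic_derivative u m x))"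
    by (auto simp: power2_norm_eq_inner algebra_simps inner_commute)
  then have "integral {-1..1} (\<lambda>x. (norm (dyadic_derivative u m x - dyadic_derivative u k x))\<^sup>2) =
    integral {-1..1} (\<lambda>x. dyadic_derivative u m x \<bullet> dyadic_derivative u m x)
    + integral {-1..1} (\<lambda>x. dyadic_derivative u k x \<bullet> dyadic_derivative u k x)
    - 2 * integral {-1..1} (\<lambda>x. dyadic_derivative u k x \<bullet> dyadic_derivative u m x)"
    using integral_diff[OF integrable_add[OF i i] integrable_on_mult_right[OF i], of m m k k 2 k m]
      integral_add[OF i i, of m m k k] by (simp only: integral_mult_right)
  then show ?thesis using integral_inner_dyadic_derivative[of k m u]
    integral_inner_dyadic_derivative[of k k u] integral_inner_dyadic_derivative[of m m u] assms by simp
qed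

lemma dyadic_energy_mono:
  assumes "k \<le> m"
  shows "dyadic_energy u k \<le> dyadic_energy u m"
proof -
  have "0 \<le> integral {-1..1} (\<lambda>x. (norm (dyadic_derivative u m x - dyadic_derivative u k x))\<^sup>2)"
    by (intro integral_nonneg L2_integrable(3)[OF L2_diff[OF dyadic_derivative_L2 dyadic_derivative_L2] order_refl]) auto
  then show ?thesis using integral_norm_diff_dyadic_derivative[OF assms, of u] by simp
qed

text \<open>Each summand is bounded by an increment of \<open>\<Phi>\<close>, and the increments telescope. In the applications
\<open>\<Phi>\<close> is the energy spent up to a given parameter.\<close>

lemma dyadic_energy_le:
  fixes u :: "real \<Rightarrow> 'a::euclidean_space"
  assumes "\<And>x y. -1 \<le> x \<Longrightarrow> x \<le> y \<Longrightarrow> y \<le> 1 \<Longrightarrow> (norm (u y - u x))\<^sup>2 \<le> (y - x) * (\<Phi> y - \<Phi> x)"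
  shows "dyadic_energy u k \<le> \<Phi> 1 - \<Phi> (-1)"
proof -
  have "dyadic_energy u k \<le> (\<Sum>i<2 ^ k. \<Phi> (dyadic k (Suc i)) - \<Phi> (dyadic k i))"
    unfolding dyadic_energy_def
  proof (rule sum_mono)
    fix i assume "i \<in> {..<(2::nat) ^ k}"
    then have "(norm (u (dyadic k (Suc i)) - u (dyadic k i)))\<^sup>2 \<le>
        (dyadic k (Suc i) - dyadic k i) * (\<Phi> (dyadic k (Suc i)) - \<Phi> (dyadic k i))"
      using dyadic_mem[of i k] dyadic_mem[of "Suc i" k] dyadic_mono[of i "Suc i" k]
      by (intro assms) auto
    then show "2 ^ k / 2 * (norm (u (dyadic k (Suc i)) - u (dyadic k i)))\<^sup>2 \<le>
        \<Phi> (dyadic k (Suc i)) - \<Phi> (dyadic k i)"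
      by (simp add: dyadic_Suc field_simps)
  qed
  also have "\<dots> = \<Phi> 1 - \<Phi> (-1)"
    using sum_lessThan_telescope[of "\<lambda>i. \<Phi> (dyadic k i)" "2 ^ k"] by simp
  finally show ?thesis .
qed

lemma H1_dyadic_energy_le:
  assumes u: "H1 (-1) 1 u w"
  shows "dyadic_energy u k \<le> integral {-1..1} (\<lambda>x. (norm (w x))\<^sup>2)"
proof -
  define \<Phi> where "\<Phi> x = integral {-1..x} (\<lambda>x. (norm (w x))\<^sup>2)" for x
  have "dyadic_energy u k \<le> \<Phi> 1 - \<Phi> (-1)"
  proof (rule dyadic_energy_le)
    fix x y :: real assume xy: "-1 \<le> x" "x \<le> y" "y \<le> 1"
    have "\<Phi> x + integral {x..y} (\<lambda>x. (norm (w x))\<^sup>2) = \<Phi> y"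
      unfolding \<Phi>_def using xy
      by (intro Henstock_Kurzweil_Integration.integral_combine L2_integrable(3)[OF H1_L2[OF u]]) auto
    then show "(norm (u y - u x))\<^sup>2 \<le> (y - x) * (\<Phi> y - \<Phi> x)"
      using H1_norm_increment_le(2)[OF u xy] by (metis add_diff_cancel_left')
  qed
  then show ?thesis by (simp add: \<Phi>_def)
qed

lemma L2_nn_integral:
  assumes w: "L2 a b w"
  shows "(\<integral>\<^sup>+x. ennreal (indicat_real {a..b} x * (norm (w x))\<^sup>2) \<partial>lborel) =
    ennreal (integral {a..b} (\<lambda>x. (norm (w x))\<^sup>2))"
proof -
  have "set_borel_measurable borel {a..b} (\<lambda>x. w x \<bullet> w x)"
    using w by (intro set_borel_measurable_bilinear[OF bounded_bilinear_inner]) (auto simp: L2_def)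
  then have i: "set_integrable lborel {a..b} (\<lambda>x. w x \<bullet> w x)"
    by (rule set_integrable_lborel_if_absolutely_integrable)
      (rule L2_bilinear_absolutely_integrable[OF bounded_bilinear_inner w w])
  then have "(\<integral>\<^sup>+x. ennreal (indicat_real {a..b} x * (norm (w x))\<^sup>2) \<partial>lborel) =
      ennreal (LINT x:{a..b}|lborel. w x \<bullet> w x)"
    unfolding set_integrable_def set_lebesgue_integral_def
    by (subst nn_integral_eq_integral[symmetric]) (auto simp: power2_norm_eq_inner)
  also have "(LINT x:{a..b}|lborel. w x \<bullet> w x) = integral {a..b} (\<lambda>x. w x \<bullet> w x)"
    by (rule set_borel_integral_eq_integral[OF i])
  finally show ?thesis by (simp add: power2_norm_eq_inner)
qed

lemma L2_if_nn_integral_le: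
  fixes w :: "real \<Rightarrow> 'a::euclidean_space"
  assumes w[measurable]: "w \<in> borel_measurable borel" and S: "S \<ge> 0"
    and le: "(\<integral>\<^sup>+x. ennreal (indicat_real {a..b} x * (norm (w x))\<^sup>2) \<partial>lborel) \<le> ennreal S"
  shows "L2 a b w" "integral {a..b} (\<lambda>x. (norm (w x))\<^sup>2) \<le> S"
proof -
  have "integrable lborel (\<lambda>x. indicat_real {a..b} x * (norm (w x))\<^sup>2)"
    by (rule integrableI_nonneg) (use le in \<open>auto intro: le_less_trans[OF _ ennreal_less_top]\<close>)
  then have "set_integrable lborel {a..b} (\<lambda>x. (norm (w x))\<^sup>2)"
    unfolding set_integrable_def by simp
  then show L: "L2 a b w"
    unfolding L2_def using set_borel_integral_eq_integral(1) set_borel_measurable_if_borel[OF w] by blast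
  show "integral {a..b} (\<lambda>x. (norm (w x))\<^sup>2) \<le> S"
    using le S unfolding L2_nn_integral[OF L] by (simp add: ennreal_le_iff)
qed

text \<open>Fatou's lemma for the squared norms. The bound is assumed for large indices only, since the distance
of a later to a fixed earlier member of a Cauchy sequence is controlled only in that order.\<close>

lemma L2_Fatou:
  fixes h :: "nat \<Rightarrow> real \<Rightarrow> 'a::euclidean_space"
  assumes h[measurable]: "\<And>i. h i \<in> borel_measurable borel" and L: "\<And>i. L2 a b (h i)"
    and v[measurable]: "v \<in> borel_measurable borel"
    and lim: "AE x in lborel. (\<lambda>i. h i x) \<longlonglongrightarrow> v x"
    and S: "S \<ge> 0" "eventually (\<lambda>i. integral {a..b} (\<lambda>x. (norm (h i x))\<^sup>2) \<le> S) sequentially"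
  shows "L2 a b v" "integral {a..b} (\<lambda>x. (norm (v x))\<^sup>2) \<le> S"
proof -
  have "(\<integral>\<^sup>+x. ennreal (indicat_real {a..b} x * (norm (v x))\<^sup>2) \<partial>lborel) =
      (\<integral>\<^sup>+x. liminf (\<lambda>i. ennreal (indicat_real {a..b} x * (norm (h i x))\<^sup>2)) \<partial>lborel)"
  proof (rule nn_integral_cong_AE)
    show "AE x in lborel. ennreal (indicat_real {a..b} x * (norm (v x))\<^sup>2) =
        liminf (\<lambda>i. ennreal (indicat_real {a..b} x * (norm (h i x))\<^sup>2))"
      using lim
    proof eventually_elim
      case (elim x)
      then have "(\<lambda>i. ennreal (indicat_real {a..b} x * (norm (h i x))\<^sup>2)) \<longlonglongrightarrow>
          ennreal (indicat_real {a..b} x * (norm (v x))\<^sup>2)"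
        by (intro tendsto_ennrealI tendsto_mult tendsto_const tendsto_power tendsto_norm)
      then show ?case 
        by (intro lim_imp_Liminf[symmetric]) auto
    qed
  qed
  also have "\<dots> \<le> liminf (\<lambda>i. \<integral>\<^sup>+x. ennreal (indicat_real {a..b} x * (norm (h i x))\<^sup>2) \<partial>lborel)"
    by (rule nn_integral_liminf) simp
  also have "\<dots> = liminf (\<lambda>i. ennreal (integral {a..b} (\<lambda>x. (norm (h i x))\<^sup>2)))"
    by (simp add: L2_nn_integral[OF L])
  also have "\<dots> \<le> liminf (\<lambda>i. ennreal S)"
    by (rule Liminf_mono) (use S(2) in \<open>auto elim!: eventually_mono intro: ennreal_leI\<close>)
  also have "\<dots> = ennreal S" by (simp add: Liminf_const)
  finally have le: "(\<integral>\<^sup>+x. ennreal (indicat_real {a..b} x * (norm (v x))\<^sup>2) \<partial>lborel) \<le> ennreal S" .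
  show "L2 a b v" "integral {a..b} (\<lambda>x. (norm (v x))\<^sup>2) \<le> S"
    using L2_if_nn_integral_le[OF v S(1) le] .
qed

text \<open>The dyadic energies increase and are bounded, so by Pythagoras the dyadic derivatives \<open>g k\<close> are
Cauchy in the mean square and hence in the mean. A subsequence converges almost everywhere to some
\<open>w\<close>, and Fatou's lemma gives both the bound on \<open>w\<close> and the mean square convergence of \<open>g k\<close> to \<open>w\<close>.
Between dyadic points of level \<open>k\<close> the integral of \<open>g k\<close> is the increment of \<open>u\<close>; the limit of this
identity, together with the continuity of \<open>u\<close>, is the claim.\<close>

lemma H1_if_dyadic_energy_bounded:
  fixes u :: "real \<Rightarrow> 'a::euclidean_space"
  assumes c: "continuous_on {-1..1} u" and S: "\<And>k. dyadic_energy u k \<le> S"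
  obtains w where "H1 (-1) 1 u w" "integral {-1..1} (\<lambda>x. (norm (w x))\<^sup>2) \<le> S"
proof -
  define g where "g = dyadic_derivative u"
  note gL = dyadic_derivative_L2[of "-1" 1 u, folded g_def]
  have gm[measurable]: "g k \<in> borel_measurable borel" for k unfolding g_def by simp
  have Qmono: "incseq (dyadic_energy u)" by (intro incseq_SucI dyadic_energy_mono) simp
  have "bdd_above (range (dyadic_energy u))" using S by (auto intro!: bdd_aboveI2)
  from LIMSEQ_incseq_SUP[OF this Qmono] obtain Q where Q: "dyadic_energy u \<longlonglongrightarrow> Q" by blast
  have QS: "Q \<le> S" by (rule LIMSEQ_le_const2[OF Q]) (use S in auto)
  have leQ: "dyadic_energy u k \<le> Q" for k by (rule incseq_le[OF Qmono Q])
  have E0: "0 \<le> dyadic_energy u k" for k unfolding dyadic_energy_def by (intro sum_nonneg) auto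
  have dist_le: "integral {-1..1} (\<lambda>x. (norm (g m x - g k x))\<^sup>2) \<le> Q - dyadic_energy u k"
    if "k \<le> m" for k m
    using integral_norm_diff_dyadic_derivative[OF that, of u] leQ[of m] unfolding g_def by simp
  have L1: "set_integrable lborel {-1..1} (g k)" for k
    using gL[of k] by (intro set_integrable_lborel_if_absolutely_integrable L2_absolutely_integrable)
      (auto simp: L2_def)
  have gvan: "indicat_real {-1..1} x *\<^sub>R g k x = g k x" for k x
    using dyadic_derivative_outside[of x u k] unfolding g_def by (auto simp: indicator_def)
  have gvan0: "g k x = 0" if "\<not> (-1 \<le> x \<and> x \<le> 1)" for k x
    using that unfolding g_def by (intro dyadic_derivative_outside) auto
  have gi: "integrable lborel (g k)" for k
    using L1[of k] unfolding set_integrable_def gvan .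
  have dist1: "(LINT x|lborel. norm (g m x - g k x))\<^sup>2 \<le> 2 * (Q - dyadic_energy u k)"
    if "k \<le> m" for k m
  proof -
    have D: "L2 (-1) 1 (\<lambda>x. g m x - g k x)" by (intro L2_diff gL)
    have "(LINT x|lborel. norm (g m x - g k x)) = (LINT x:{-1..1}|lborel. norm (g m x - g k x))"
      unfolding set_lebesgue_integral_def
      by (rule Bochner_Integration.integral_cong)
        (use gvan0 in \<open>force simp: indicator_def\<close>)+
    also have "\<dots> = integral {-1..1} (\<lambda>x. norm (g m x - g k x))"
      by (intro set_borel_integral_eq_integral set_integrable_norm set_integral_diff L1)
    also have "\<dots>\<^sup>2 \<le> (1 - (-1)) * integral {-1..1} (\<lambda>x. (norm (g m x - g k x))\<^sup>2)"
      by (rule L2_Cauchy_Schwarz[OF D]) simp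
    also have "\<dots> \<le> 2 * (Q - dyadic_energy u k)" using dist_le[OF that] by simp
    finally show ?thesis .
  qed
  have "\<exists>N. \<forall>i\<ge>N. \<forall>j\<ge>N. (LINT x|lborel. norm (g i x - g j x)) < e" if e: "e > 0" for e
  proof -
    have "eventually (\<lambda>k. dyadic_energy u k > Q - e\<^sup>2 / 2) sequentially"
      using order_tendstoD(1)[OF Q, of "Q - e\<^sup>2 / 2"] e by simp
    then obtain N where N: "\<And>k. k \<ge> N \<Longrightarrow> dyadic_energy u k > Q - e\<^sup>2 / 2"
      unfolding eventually_sequentially by blast
    have *: "(LINT x|lborel. norm (g m x - g k x)) < e" if "k \<ge> N" "k \<le> m" for k m
    proof -
      have "(LINT x|lborel. norm (g m x - g k x))\<^sup>2 < e\<^sup>2"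
        using dist1[OF that(2)] N[OF that(1)] by simp
      then show ?thesis using e by (intro power_less_imp_less_base[of _ 2 e]) auto
    qed
    have "(LINT x|lborel. norm (g i x - g j x)) < e" if "i \<ge> N" "j \<ge> N" for i j
      using *[of i j] *[of j i] that by (cases "i \<le> j") (auto simp: norm_minus_commute)
    then show ?thesis by blast
  qed
  from cauchy_L1_AE_cauchy_subseq[OF gi this] obtain r where
    r: "strict_mono r" "AE x in lborel. Cauchy (\<lambda>i. g (r i) x)" by blast
  define w where "w x = lim (\<lambda>i. g (r i) x)" for x
  have wm[measurable]: "w \<in> borel_measurable borel"
    unfolding w_def[abs_def] by (rule borel_measurable_lim_metric) simp
  have conv: "AE x in lborel. (\<lambda>i. g (r i) x) \<longlonglongrightarrow> w x"
    using r(2) by eventually_elim (unfold w_def, rule convergent_LIMSEQ_iff[THEN iffD1, OF Cauchy_convergent])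
  have normg: "integral {-1..1} (\<lambda>x. (norm (g k x))\<^sup>2) \<le> S" for k
    using integral_inner_dyadic_derivative[of k k u] S[of k] unfolding g_def
    by (simp add: power2_norm_eq_inner)
  have S0: "S \<ge> 0" using E0[of 0] S[of 0] by simp
  have wL: "L2 (-1) 1 w" and wS: "integral {-1..1} (\<lambda>x. (norm (w x))\<^sup>2) \<le> S"
    by (rule L2_Fatou[OF gm gL wm conv S0]; simp add: normg)+
  \<comment> \<open>Fatou once more, for fixed \<open>k\<close>: convergence in the mean square of the whole sequence.\<close>
  have wg: "integral {-1..1} (\<lambda>x. (norm (w x - g k x))\<^sup>2) \<le> Q - dyadic_energy u k" for k
  proof (rule L2_Fatou(2)[of "\<lambda>i x. g (r i) x - g k x"])
    show "AE x in lborel. (\<lambda>i. g (r i) x - g k x) \<longlonglongrightarrow> w x - g k x"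
      using conv by eventually_elim (intro tendsto_diff tendsto_const)
    show "\<forall>\<^sub>F i in sequentially.
        integral {-1..1} (\<lambda>x. (norm (g (r i) x - g k x))\<^sup>2) \<le> Q - dyadic_energy u k"
      using eventually_ge_at_top[of k]
      by eventually_elim (rule dist_le, use seq_suble[OF r(1)] order_trans in blast)
  qed (use leQ[of k] in \<open>auto intro!: L2_diff gL\<close>)
  have "u x = u (-1) + integral {-1..x} w" if x: "x \<in> {-1..1}" for x
  proof -
    \<comment> \<open>\<open>y k\<close> is the largest dyadic point of level \<open>k\<close> that does not exceed \<open>x\<close>.\<close>
    define j where "j k = nat \<lfloor>(x + 1) * 2 ^ k / 2\<rfloor>" for k
    define y where "y k = dyadic k (j k)" for k
    have j: "real (j k) \<le> (x + 1) * 2 ^ k / 2" "(x + 1) * 2 ^ k / 2 < real (j k) + 1" for k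
    proof -
      have "0 \<le> (x + 1) * 2 ^ k / 2" using x by simp
      then have "real (j k) = of_int \<lfloor>(x + 1) * 2 ^ k / 2\<rfloor>" unfolding j_def by simp
      then show "real (j k) \<le> (x + 1) * 2 ^ k / 2" "(x + 1) * 2 ^ k / 2 < real (j k) + 1"
        by linarith+
    qed
    have yx: "y k \<le> x" "x - y k \<le> 2 * (1/2) ^ k" for k
    proof -
      have eq: "x - y k = ((x + 1) * 2 ^ k / 2 - real (j k)) * (2 * (1/2) ^ k)"
        unfolding y_def dyadic_def by (simp add: field_simps power_divide)
      have "0 \<le> x - y k" unfolding eq using j(1)[of k] by (intro mult_nonneg_nonneg) auto
      then show "y k \<le> x" by simp
      have "x - y k \<le> 1 * (2 * (1/2) ^ k)"
        unfolding eq using j(2)[of k] by (intro mult_right_mono) auto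
      then show "x - y k \<le> 2 * (1/2) ^ k" by simp
    qed
    have y1: "-1 \<le> y k" for k unfolding y_def dyadic_def by simp
    have yI: "y k \<in> {-1..1}" for k using yx[of k] y1[of k] x by auto
    have jk: "j k \<le> 2 ^ k" for k
    proof -
      have "real (j k) \<le> 2 ^ k" using yI[of k] unfolding y_def dyadic_def by (simp add: field_simps)
      then have "real (j k) \<le> real (2 ^ k)" by simp
      then show ?thesis by (rule of_nat_le_iff[THEN iffD1])
    qed
    have "(\<lambda>k. x - y k) \<longlonglongrightarrow> 0"
    proof (rule tendsto_sandwich[OF _ _ tendsto_const])
      show "(\<lambda>k. 2 * (1/2) ^ k :: real) \<longlonglongrightarrow> 0"
        by (intro tendsto_mult_right_zero LIMSEQ_realpow_zero) auto
    qed (use yx in auto)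
    then have y: "y \<longlonglongrightarrow> x" using tendsto_diff[OF tendsto_const, of "\<lambda>k. x - y k" 0 _ x] by simp
    have uy: "(\<lambda>k. u (y k)) \<longlonglongrightarrow> u x"
      by (rule continuous_on_tendsto_compose[OF c y]) (use x yI in auto)
    have iy: "(\<lambda>k. integral {-1..y k} w) \<longlonglongrightarrow> integral {-1..x} w"
      by (rule continuous_on_tendsto_compose[OF
            indefinite_integral_continuous_1[OF L2_integrable(1)[OF wL order_refl]] y])
        (use x yI in auto)
    have diff: "norm (u (y k) - u (-1) - integral {-1..y k} w) \<le> sqrt (2 * (Q - dyadic_energy u k))" for k
    proof -
      have sub: "{-1..y k} \<subseteq> {-1..1}" using yI[of k] by auto
      have D: "L2 (-1) 1 (\<lambda>x. w x - g k x)" by (intro L2_diff gL wL)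
      have "u (y k) - u (-1) - integral {-1..y k} w = - integral {-1..y k} (\<lambda>x. w x - g k x)"
        using integral_diff[OF L2_integrable(1)[OF wL sub] L2_integrable(1)[OF gL[of k] sub]]
          integral_dyadic_derivative[OF jk[of k], of u] unfolding g_def y_def by simp
      then have "(norm (u (y k) - u (-1) - integral {-1..y k} w))\<^sup>2 =
          (norm (integral {-1..y k} (\<lambda>x. w x - g k x)))\<^sup>2" by simp
      also have "\<dots> \<le> (integral {-1..y k} (\<lambda>x. norm (w x - g k x)))\<^sup>2"
        by (intro power_mono L2_norm_integral_le L2_subinterval[OF D sub]) auto
      also have "\<dots> \<le> (integral {-1..1} (\<lambda>x. norm (w x - g k x)))\<^sup>2"
        by (intro power_mono integral_subset_le sub integral_nonneg L2_integrable(2)[OF D]) auto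
      also have "\<dots> \<le> (1 - (-1)) * integral {-1..1} (\<lambda>x. (norm (w x - g k x))\<^sup>2)"
        by (rule L2_Cauchy_Schwarz[OF D]) simp
      also have "\<dots> \<le> 2 * (Q - dyadic_energy u k)" using wg[of k] by simp
      finally show ?thesis by (rule real_le_rsqrt)
    qed
    have "(\<lambda>k. sqrt (2 * (Q - dyadic_energy u k))) \<longlonglongrightarrow> sqrt (2 * (Q - Q))"
      by (intro tendsto_real_sqrt tendsto_mult tendsto_diff tendsto_const Q)
    then have "(\<lambda>k. u (y k) - u (-1) - integral {-1..y k} w) \<longlonglongrightarrow> 0"
      by (intro Lim_null_comparison[OF always_eventually[OF allI[OF diff]]]) simp
    moreover have "(\<lambda>k. u (y k) - u (-1) - integral {-1..y k} w) \<longlonglongrightarrow> u x - u (-1) - integral {-1..x} w"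
      by (intro tendsto_diff uy iy tendsto_const)
    ultimately have "u x - u (-1) - integral {-1..x} w = 0" by (rule LIMSEQ_unique[rotated])
    then show ?thesis by (simp add: algebra_simps)
  qed
  then have "H1 (-1) 1 u w" unfolding H1_def using wL by blast
  then show ?thesis using wS by (rule that)
qed

section \<open>Admissible curves and their unit tangents\<close>

lemma H1_cong_derivative:
  assumes u: "H1 a b u w" and w': "L2 a b w'" and neg: "negligible {x \<in> {a..b}. w x \<noteq> w' x}"
  shows "H1 a b u w'"
  unfolding H1_def
proof (intro conjI ballI w')
  fix x assume x: "x \<in> {a..b}"
  have "integral {a..x} w = integral {a..x} w'"
    by (intro integral_eq_if_negligible_neq negligible_subset[OF neg]) (use x in auto)
  with H1_eq[OF u x] show "u x = u a + integral {a..x} w'" by simp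
qed

lemma W22_curve_imp_H1:
  fixes \<gamma> :: "real \<Rightarrow> 'a::euclidean_space"
  assumes "W22_curve \<gamma>"
  obtains v h where "H1 (-1) 1 \<gamma> v" "H1 (-1) 1 v h"
proof -
  from assms obtain g h where c: "continuous_on {-1..1} \<gamma>"
    and g: "has_weak_derivative \<gamma> g" and h: "has_weak_derivative g h"
    unfolding W22_curve_def by blast
  obtain v where v: "H1 (-1) 1 v (restrict_Ioo h)" "negligible {x \<in> {-1..1}. g x \<noteq> v x}"
    using weak_derivative_imp_H1[OF h] .
  have "negligible ({x \<in> {-1..1}. g x \<noteq> v x} \<union> {x \<in> {-1..1}. restrict_Ioo g x \<noteq> g x})"
    by (intro negligible_Un v(2) negligible_restrict_Ioo)
  then have "negligible {x \<in> {-1..1}. restrict_Ioo g x \<noteq> v x}"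
    by (rule negligible_subset) auto
  from H1_cong_derivative[OF weak_derivative_continuous_imp_H1[OF g c] L2_continuous[OF H1_continuous[OF v(1)]] this]
  show ?thesis using v(1) by (rule that)
qed

lemma H1_imp_W22_curve:
  assumes "H1 (-1) 1 \<gamma> v" "H1 (-1) 1 v h"
  shows "W22_curve \<gamma>"
  unfolding W22_curve_def
  using H1_continuous[OF assms(1)] H1_has_weak_derivative[OF assms(1)] H1_has_weak_derivative[OF assms(2)]
  by blast

lemma H1_has_vector_derivative:
  assumes u: "H1 a b u w" and c: "continuous_on {a..b} w" and x: "x \<in> {a..b}"
  shows "(u has_vector_derivative w x) (at x within {a..b})"
proof -
  have "((\<lambda>y. u a + integral {a..y} w) has_vector_derivative 0 + w x) (at x within {a..b})"
    by (intro has_vector_derivative_add has_vector_derivative_const integral_has_vector_derivative c x)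
  then have "((\<lambda>y. u a + integral {a..y} w) has_vector_derivative w x) (at x within {a..b})"
    by simp
  then show ?thesis
    by (rule has_vector_derivative_transform[OF x, rotated]) (rule H1_eq[OF u])
qed

lemma velocity_eq:
  assumes "H1 (-1) 1 \<gamma> v" "continuous_on {-1..1} v" "x \<in> {-1..1}"
  shows "velocity \<gamma> x = v x"
  using H1_has_vector_derivative[OF assms] assms(3)
  by (intro vector_derivative_within_closed_interval) auto

lemma curve_length_eq:
  assumes \<gamma>: "H1 (-1) 1 \<gamma> v" and v: "continuous_on {-1..1} v"
  shows "curve_length \<gamma> = integral {-1..1} (\<lambda>x. norm (v x))"
proof -
  have "curve_length \<gamma> = (LINT x:{-1<..<1}|lborel. norm (v x))"
    unfolding curve_length_def
    by (rule set_lebesgue_integral_cong) (auto simp: velocity_eq[OF \<gamma> v])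
  also have "\<dots> = integral {-1..1} (\<lambda>x. norm (v x))"
    by (intro Lebesgue_Ioo_eq_integral_Icc set_borel_measurable_continuous_Icc
        absolutely_integrable_continuous_real continuous_intros v)
  finally show ?thesis .
qed

lemma L2_norm_square_divide:
  assumes w: "L2 a b w" and \<rho>: "continuous_on {a..b} \<rho>" "\<And>x. x \<in> {a..b} \<Longrightarrow> \<rho> x > 0"
  shows "set_borel_measurable borel {a..b} (\<lambda>x. (norm (w x))\<^sup>2 / \<rho> x)"
    "(\<lambda>x. (norm (w x))\<^sup>2 / \<rho> x) absolutely_integrable_on {a..b}"
proof -
  have c: "continuous_on {a..b} (\<lambda>x. 1 / \<rho> x)"
    using \<rho> by (intro continuous_intros) force+
  have w': "L2 a b (\<lambda>x. (1 / \<rho> x) *\<^sub>R w x)"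
    by (rule L2_bilinear_continuous[OF bounded_bilinear.flip[OF bounded_bilinear_scaleR] w c])
  have eq: "(\<lambda>x. (norm (w x))\<^sup>2 / \<rho> x) = (\<lambda>x. w x \<bullet> ((1 / \<rho> x) *\<^sub>R w x))"
    by (auto simp: power2_norm_eq_inner)
  show "(\<lambda>x. (norm (w x))\<^sup>2 / \<rho> x) absolutely_integrable_on {a..b}"
    unfolding eq by (rule L2_bilinear_absolutely_integrable[OF bounded_bilinear_inner w w'])
  show "set_borel_measurable borel {a..b} (\<lambda>x. (norm (w x))\<^sup>2 / \<rho> x)"
    unfolding eq using w w' by (intro set_borel_measurable_bilinear[OF bounded_bilinear_inner]) (auto simp: L2_def)
qed

text \<open>The weak derivative in the definition of the curvature is an arbitrary choice, but any two choices
agree almost everywhere.\<close>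

lemma elastic_energy_eq:
  assumes \<gamma>: "H1 (-1) 1 \<gamma> v" and v: "continuous_on {-1..1} v" "\<And>x. x \<in> {-1..1} \<Longrightarrow> v x \<noteq> 0"
    and T: "H1 (-1) 1 (unit_tangent \<gamma>) w"
  shows "elastic_energy \<gamma> = integral {-1..1} (\<lambda>x. (norm (w x))\<^sup>2 / norm (v x))"
proof -
  \<comment> \<open>A weak derivative exists, so the choice operator does return one.\<close>
  define z where "z = weak_derivative (unit_tangent \<gamma>)"
  have z: "has_weak_derivative (unit_tangent \<gamma>) z"
    unfolding z_def weak_derivative_def by (rule someI[of _ w]) (rule H1_has_weak_derivative[OF T])
  have Hz: "H1 (-1) 1 (unit_tangent \<gamma>) (restrict_Ioo z)"
    by (rule weak_derivative_continuous_imp_H1[OF z H1_continuous[OF T]])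
  have "elastic_energy \<gamma> = (LINT x:{-1<..<1}|lborel. (norm (restrict_Ioo z x))\<^sup>2 / norm (v x))"
    unfolding elastic_energy_def
  proof (rule set_lebesgue_integral_cong)
    show "\<forall>x. x \<in> {-1<..<1} \<longrightarrow> (norm (curvature \<gamma> x))\<^sup>2 * norm (velocity \<gamma> x) =
        (norm (restrict_Ioo z x))\<^sup>2 / norm (v x)"
    proof (intro allI impI)
      fix x :: real assume x: "x \<in> {-1<..<1}"
      then have "velocity \<gamma> x = v x" "v x \<noteq> 0" using velocity_eq[OF \<gamma> v(1), of x] v(2)[of x] by auto
      then show "(norm (curvature \<gamma> x))\<^sup>2 * norm (velocity \<gamma> x) = (norm (restrict_Ioo z x))\<^sup>2 / norm (v x)"
        unfolding curvature_def z_def[symmetric] restrict_Ioo_eq[OF x]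
        by (simp add: power2_eq_square)
    qed
  qed simp
  also have "\<dots> = integral {-1..1} (\<lambda>x. (norm (restrict_Ioo z x))\<^sup>2 / norm (v x))"
    by (intro Lebesgue_Ioo_eq_integral_Icc L2_norm_square_divide H1_L2[OF Hz] continuous_intros v(1))
      (use v(2) in auto)
  also have "\<dots> = integral {-1..1} (\<lambda>x. (norm (w x))\<^sup>2 / norm (v x))"
    by (intro integral_eq_if_negligible_neq negligible_subset[OF H1_derivative_unique[OF Hz T]]) auto
  finally show ?thesis .
qed

lemma norm_sgn_diff_le:
  fixes a b :: "'a::real_normed_vector"
  assumes "a \<noteq> 0" "b \<noteq> 0"
  shows "norm (sgn a - sgn b) \<le> 2 / norm a * norm (a - b)"
proof -
  have "norm a *\<^sub>R (sgn a - sgn b) = (a - b) + (norm b - norm a) *\<^sub>R sgn b"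
    using assms by (simp add: sgn_div_norm algebra_simps)
  then have "norm a * norm (sgn a - sgn b) = norm ((a - b) + (norm b - norm a) *\<^sub>R sgn b)"
    by (metis norm_scaleR abs_norm_cancel)
  also have "\<dots> \<le> norm (a - b) + \<bar>norm b - norm a\<bar>"
    using norm_triangle_ineq[of "a - b" "(norm b - norm a) *\<^sub>R sgn b"] assms by (simp add: norm_sgn)
  also have "\<dots> \<le> 2 * norm (a - b)"
    using norm_triangle_ineq3[of b a] by (simp add: norm_minus_commute)
  finally show ?thesis using assms by (simp add: field_simps)
qed

text \<open>Away from zero the normalisation is Lipschitz, so it increases the dyadic energies by at most a
constant factor.\<close>

lemma H1_normalise:
  assumes v: "H1 (-1) 1 v h" and nz: "\<And>x. x \<in> {-1..1} \<Longrightarrow> v x \<noteq> 0"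
  obtains w where "H1 (-1) 1 (\<lambda>x. sgn (v x)) w"
proof -
  note c = H1_continuous[OF v]
  have "\<exists>x\<in>{-1..1}. \<forall>y\<in>{-1..1}. norm (v x) \<le> norm (v y)"
    by (rule continuous_attains_inf) (auto intro!: continuous_intros c)
  then obtain x0 where x0: "x0 \<in> {-1..1}" "\<And>y. y \<in> {-1..1} \<Longrightarrow> norm (v x0) \<le> norm (v y)" by blast
  define m where "m = norm (v x0)"
  have m: "m > 0" unfolding m_def using nz[OF x0(1)] by simp
  have sc: "continuous_on {-1..1} (\<lambda>x. sgn (v x))"
    using nz c by (intro continuous_intros) auto
  have "dyadic_energy (\<lambda>x. sgn (v x)) k \<le> (2 / m)\<^sup>2 * integral {-1..1} (\<lambda>x. (norm (h x))\<^sup>2)" for k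
  proof -
    have "dyadic_energy (\<lambda>x. sgn (v x)) k \<le> (2 / m)\<^sup>2 * dyadic_energy v k"
      unfolding dyadic_energy_def sum_distrib_left
    proof (rule sum_mono)
      fix i assume "i \<in> {..<(2::nat) ^ k}"
      then have mem: "dyadic k i \<in> {-1..1}" "dyadic k (Suc i) \<in> {-1..1}"
        using dyadic_mem[of i k] dyadic_mem[of "Suc i" k] by auto
      have "norm (sgn (v (dyadic k (Suc i))) - sgn (v (dyadic k i))) \<le>
          2 / norm (v (dyadic k (Suc i))) * norm (v (dyadic k (Suc i)) - v (dyadic k i))"
        by (intro norm_sgn_diff_le nz mem)
      also have "\<dots> \<le> 2 / m * norm (v (dyadic k (Suc i)) - v (dyadic k i))"
        using x0(2)[OF mem(2)] m nz[OF mem(2)] unfolding m_def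
        by (intro mult_right_mono divide_left_mono mult_pos_pos) auto
      finally have "(norm (sgn (v (dyadic k (Suc i))) - sgn (v (dyadic k i))))\<^sup>2 \<le>
          (2 / m * norm (v (dyadic k (Suc i)) - v (dyadic k i)))\<^sup>2"
        by (intro power_mono) auto
      then have "2 ^ k / 2 * (norm (sgn (v (dyadic k (Suc i))) - sgn (v (dyadic k i))))\<^sup>2 \<le>
          2 ^ k / 2 * (2 / m * norm (v (dyadic k (Suc i)) - v (dyadic k i)))\<^sup>2"
        by (intro mult_left_mono) auto
      then show "2 ^ k / 2 * (norm (sgn (v (dyadic k (Suc i))) - sgn (v (dyadic k i))))\<^sup>2 \<le>
          (2 / m)\<^sup>2 * (2 ^ k / 2 * (norm (v (dyadic k (Suc i)) - v (dyadic k i)))\<^sup>2)"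
        by (simp add: power_mult_distrib power_divide mult_ac)
    qed
    also have "\<dots> \<le> (2 / m)\<^sup>2 * integral {-1..1} (\<lambda>x. (norm (h x))\<^sup>2)"
      by (intro mult_left_mono H1_dyadic_energy_le[OF v]) auto
    finally show ?thesis .
  qed
  from H1_if_dyadic_energy_bounded[OF sc this] show ?thesis using that by blast
qed

text \<open>Here \<open>\<rho>\<close> is the speed of a curve and \<open>T\<close> its unit tangent; \<open>\<sigma>\<close> is arc length scaled to \<open>[-1, 1]\<close> and
\<open>\<tau>\<close> its inverse. The weighted Cauchy-Schwarz inequality on \<open>[\<tau> x, \<tau> y]\<close> bounds \<open>|T' y - T' x|\<^sup>2\<close> by the
length \<open>L / 2 (y - x)\<close> of that piece times its energy, which is what the dyadic criterion asks for.
The last conclusion says that the displacement of the curve does not change.\<close>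

lemma arclength_reparametrisation:
  fixes T :: "real \<Rightarrow> 'a::euclidean_space" and \<rho> :: "real \<Rightarrow> real"
  assumes T: "H1 (-1) 1 T w" and \<rho>: "continuous_on {-1..1} \<rho>" "\<And>x. x \<in> {-1..1} \<Longrightarrow> \<rho> x > 0"
    and L: "L = integral {-1..1} \<rho>"
  obtains T' w' where "H1 (-1) 1 T' w'"
    "integral {-1..1} (\<lambda>x. (norm (w' x))\<^sup>2) \<le> L / 2 * integral {-1..1} (\<lambda>x. (norm (w x))\<^sup>2 / \<rho> x)"
    "T' (-1) = T (-1)" "T' 1 = T 1" "\<And>x. x \<in> {-1..1} \<Longrightarrow> T' x \<in> T ` {-1..1}"
    "(L / 2) *\<^sub>R integral {-1..1} T' = integral {-1..1} (\<lambda>x. \<rho> x *\<^sub>R T x)"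
proof -
  define R where "R x = 0 + integral {-1..x} \<rho>" for x
  have HR: "H1 (-1) 1 R \<rho>"
    unfolding R_def[abs_def] by (intro H1_indefinite_integral L2_continuous \<rho>(1))
  have Rless: "R x < R y" if "-1 \<le> x" "x < y" "y \<le> 1" for x y
  proof -
    have "R y - R x = integral {x..y} \<rho>" using H1_increment[OF HR, of x y] that by simp
    also have "\<dots> > 0"
    proof -
      have c: "continuous_on {x..y} \<rho>" using \<rho>(1) by (rule continuous_on_subset) (use that in auto)
      have "integral {x..y} \<rho> \<ge> 0"
        using that \<rho>(2) by (intro integral_nonneg integrable_continuous_real c) (auto intro: less_imp_le)
      moreover have "integral {x..y} \<rho> \<noteq> 0"
      proof
        assume "integral {x..y} \<rho> = 0"
        then have "\<rho> x = 0"
          by (subst (asm) integral_eq_0_iff[OF c that(2)]) (use that \<rho>(2) in \<open>auto intro: less_imp_le\<close>)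
        then show False using \<rho>(2)[of x] that by auto
      qed
      ultimately show ?thesis by simp
    qed
    finally show ?thesis by simp
  qed
  have R0: "R (-1) = 0" and R1: "R 1 = L" unfolding R_def L by simp_all
  have L0: "L > 0" using Rless[of "-1" 1] R0 R1 by simp
  define \<sigma> where "\<sigma> x = -1 + 2 / L * R x" for x
  have \<sigma>less: "\<sigma> x < \<sigma> y" if "x \<in> {-1..1}" "y \<in> {-1..1}" "x < y" for x y
    using Rless[of x y] that L0 unfolding \<sigma>_def by (simp add: divide_strict_right_mono)
  have \<sigma>0: "\<sigma> (-1) = -1" and \<sigma>1: "\<sigma> 1 = 1" unfolding \<sigma>_def R0 R1 using L0 by simp_all
  have \<sigma>c: "continuous_on {-1..1} \<sigma>"
    unfolding \<sigma>_def[abs_def] by (intro continuous_intros H1_continuous[OF HR])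
  have inj: "inj_on \<sigma> {-1..1}"
    by (rule inj_onI) (metis \<sigma>less less_irrefl linorder_neqE)
  have img: "\<sigma> ` {-1..1} = {-1..1}"
  proof
    show "\<sigma> ` {-1..1} \<subseteq> {-1..1}"
    proof
      fix y assume "y \<in> \<sigma> ` {-1..1}"
      then obtain x where x: "x \<in> {-1..1}" "y = \<sigma> x" by blast
      have "\<sigma> (-1) \<le> \<sigma> x" "\<sigma> x \<le> \<sigma> 1"
        using \<sigma>less[of "-1" x] \<sigma>less[of x 1] x by (cases "x = -1"; cases "x = 1"; force)+
      then show "y \<in> {-1..1}" using x \<sigma>0 \<sigma>1 by auto
    qed
    show "{-1..1} \<subseteq> \<sigma> ` {-1..1}"
    proof
      fix y :: real assume "y \<in> {-1..1}"
      then show "y \<in> \<sigma> ` {-1..1}"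
        using IVT'[of \<sigma> "-1" y 1] \<sigma>0 \<sigma>1 \<sigma>c by force
    qed
  qed
  define \<tau> where "\<tau> = the_inv_into {-1..1} \<sigma>"
  have \<tau>\<sigma>: "\<tau> (\<sigma> x) = x" if "x \<in> {-1..1}" for x
    unfolding \<tau>_def by (rule the_inv_into_f_f[OF inj that])
  have \<sigma>\<tau>: "\<sigma> (\<tau> x) = x" and \<tau>mem: "\<tau> x \<in> {-1..1}" if "x \<in> {-1..1}" for x
    using that f_the_inv_into_f[OF inj, of x] the_inv_into_into[OF inj, of x "{-1..1}"]
    unfolding img \<tau>_def by auto
  have \<tau>c: "continuous_on {-1..1} \<tau>"
    using continuous_on_inv_into[OF \<sigma>c _ inj] unfolding img \<tau>_def by simp
  have \<tau>mono: "\<tau> x \<le> \<tau> y" if "x \<in> {-1..1}" "y \<in> {-1..1}" "x \<le> y" for x y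
    using \<sigma>less[OF \<tau>mem[OF that(2)] \<tau>mem[OF that(1)]] \<sigma>\<tau>[OF that(1)] \<sigma>\<tau>[OF that(2)] that(3) by linarith
  define T' where "T' x = T (\<tau> x)" for x
  have T'c: "continuous_on {-1..1} T'"
    unfolding T'_def[abs_def]
    by (rule continuous_on_compose2[OF H1_continuous[OF T] \<tau>c]) (use \<tau>mem in auto)
  define e where "e x = (norm (w x))\<^sup>2 / \<rho> x" for x
  have ei: "e integrable_on {-1..1}"
    using L2_norm_square_divide(2)[OF H1_L2[OF T] \<rho>] unfolding e_def[abs_def] absolutely_integrable_on_def
    by simp
  \<comment> \<open>The energy of the piece of the curve that is passed up to the new parameter \<open>x\<close>.\<close>
  define \<Phi> where "\<Phi> x = L / 2 * integral {-1..\<tau> x} e" for x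
  have "dyadic_energy T' k \<le> \<Phi> 1 - \<Phi> (-1)" for k
  proof (rule dyadic_energy_le)
    fix x y :: real assume xy: "-1 \<le> x" "x \<le> y" "y \<le> 1"
    define a where "a = \<tau> x"
    define b where "b = \<tau> y"
    have ab: "-1 \<le> a" "a \<le> b" "b \<le> 1"
      using \<tau>mem[of x] \<tau>mem[of y] \<tau>mono[of x y] xy unfolding a_def b_def by auto
    have sub: "{a..b} \<subseteq> {-1..1}" using ab by auto
    have "(norm (T' y - T' x))\<^sup>2 \<le> (integral {a..b} (\<lambda>t. norm (w t)))\<^sup>2"
      using H1_norm_increment_le(1)[OF T ab] unfolding T'_def a_def b_def by (intro power_mono) auto
    also have "\<dots> \<le> integral {a..b} \<rho> * integral {a..b} e"
      unfolding e_def using \<rho>(2) sub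
      by (intro L2_Cauchy_Schwarz_weighted L2_subinterval[OF H1_L2[OF T]] continuous_on_subset[OF \<rho>(1)]) auto
    also have "integral {a..b} \<rho> = R b - R a" using H1_increment[OF HR ab] by simp
    also have "\<dots> = L / 2 * (y - x)"
      using \<sigma>\<tau>[of x] \<sigma>\<tau>[of y] xy L0 unfolding \<sigma>_def a_def b_def by (simp add: field_simps)
    also have "integral {a..b} e = integral {-1..b} e - integral {-1..a} e"
      using Henstock_Kurzweil_Integration.integral_combine[OF ab(1,2) integrable_on_subinterval[OF ei]] ab
      by (simp add: algebra_simps)
    finally show "(norm (T' y - T' x))\<^sup>2 \<le> (y - x) * (\<Phi> y - \<Phi> x)"
      unfolding \<Phi>_def a_def b_def by (simp add: algebra_simps)
  qed
  moreover have "\<tau> 1 = 1" "\<tau> (-1) = -1" using \<tau>\<sigma>[of 1] \<tau>\<sigma>[of "-1"] \<sigma>0 \<sigma>1 by auto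
  ultimately have "dyadic_energy T' k \<le> L / 2 * integral {-1..1} e" for k
    unfolding \<Phi>_def by simp
  from H1_if_dyadic_energy_bounded[OF T'c this] obtain w' where
    w': "H1 (-1) 1 T' w'" "integral {-1..1} (\<lambda>x. (norm (w' x))\<^sup>2) \<le> L / 2 * integral {-1..1} e" by blast
  have "((\<lambda>x. (2 / L * \<rho> x) *\<^sub>R T' (\<sigma> x)) has_integral integral {\<sigma> (-1)..\<sigma> 1} T') {-1..1}"
  proof (rule has_integral_substitution[where c="-1" and d=1])
    fix x :: real assume "x \<in> {-1..1}"
    then have "(R has_real_derivative \<rho> x) (at x within {-1..1})"
      using H1_has_vector_derivative[OF HR \<rho>(1)] by (simp add: has_real_derivative_iff_has_vector_derivative)
    then show "(\<sigma> has_real_derivative 2 / L * \<rho> x) (at x within {-1..1})"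
      unfolding \<sigma>_def[abs_def] using L0 by (auto intro!: derivative_eq_intros)
  qed (use img \<sigma>0 \<sigma>1 T'c in auto)
  then have "integral {-1..1} T' = integral {-1..1} (\<lambda>x. (2 / L * \<rho> x) *\<^sub>R T' (\<sigma> x))"
    unfolding \<sigma>0 \<sigma>1 by (simp add: integral_unique)
  also have "\<dots> = integral {-1..1} (\<lambda>x. (2 / L) *\<^sub>R (\<rho> x *\<^sub>R T x))"
    by (rule Henstock_Kurzweil_Integration.integral_cong) (simp add: T'_def \<tau>\<sigma>)
  also have "\<dots> = (2 / L) *\<^sub>R integral {-1..1} (\<lambda>x. \<rho> x *\<^sub>R T x)" by (rule integral_cmul)
  finally have I: "(L / 2) *\<^sub>R integral {-1..1} T' = integral {-1..1} (\<lambda>x. \<rho> x *\<^sub>R T x)"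
    using L0 by simp
  show ?thesis
  proof (rule that[OF w'(1) _ _ _ _ I])
    show "integral {-1..1} (\<lambda>x. (norm (w' x))\<^sup>2) \<le> L / 2 * integral {-1..1} (\<lambda>x. (norm (w x))\<^sup>2 / \<rho> x)"
      using w'(2) unfolding e_def .
  qed (use \<open>\<tau> 1 = 1\<close> \<open>\<tau> (-1) = -1\<close> \<tau>mem in \<open>auto simp: T'_def\<close>)
qed

text \<open>The data of an admissible curve with constant speed \<open>L / 2\<close>: the starting point \<open>p\<close>, the unit tangent
\<open>T\<close> and its derivative \<open>w\<close>. The end point is \<open>p + (L / 2) \<integral> T\<close>.\<close>

definition tangent_profile ::
    "'a::euclidean_space set \<Rightarrow> ('a \<Rightarrow> 'a) \<Rightarrow> (real \<Rightarrow> real) \<Rightarrow> real \<Rightarrow> 'a \<Rightarrow>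
      (real \<Rightarrow> 'a) \<Rightarrow> (real \<Rightarrow> 'a) \<Rightarrow> bool" where
  "tangent_profile M \<xi> \<tau> L p T w \<longleftrightarrow>
     H1 (-1) 1 T w \<and> (\<forall>x\<in>{-1..1}. norm (T x) = 1) \<and>
     p \<in> M \<and> p + (L / 2) *\<^sub>R integral {-1..1} T \<in> M \<and>
     T (-1) = \<tau> (-1) *\<^sub>R \<xi> p \<and> T 1 = \<tau> 1 *\<^sub>R \<xi> (p + (L / 2) *\<^sub>R integral {-1..1} T)"

lemma unit_tangent_eq_sgn:
  assumes "H1 (-1) 1 \<gamma> v" "continuous_on {-1..1} v" "x \<in> {-1..1}"
  shows "unit_tangent \<gamma> x = sgn (v x)"
  by (simp add: unit_tangent_def velocity_eq[OF assms] sgn_div_norm inverse_eq_divide)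

lemma admissible_imp_tangent_profile:
  assumes adm: "admissible M \<xi> \<tau> L \<gamma>"
  obtains T w where "tangent_profile M \<xi> \<tau> L (\<gamma> (-1)) T w"
    "2 / L * integral {-1..1} (\<lambda>x. (norm (w x))\<^sup>2) \<le> elastic_energy \<gamma>"
    "\<gamma> 1 - \<gamma> (-1) = (L / 2) *\<^sub>R integral {-1..1} T"
proof -
  have W: "W22_curve \<gamma>" and nz: "\<And>x. x \<in> {-1..1} \<Longrightarrow> velocity \<gamma> x \<noteq> 0"
    and len: "curve_length \<gamma> = L" and obc: "OBC M \<xi> \<tau> \<gamma>"
    using adm unfolding admissible_def W22_immersion_def by auto
  obtain v h where \<gamma>: "H1 (-1) 1 \<gamma> v" and v: "H1 (-1) 1 v h" using W22_curve_imp_H1[OF W] .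
  note vc = H1_continuous[OF v]
  have vnz: "v x \<noteq> 0" if "x \<in> {-1..1}" for x using nz[OF that] velocity_eq[OF \<gamma> vc that] by simp
  obtain w0 where w0: "H1 (-1) 1 (\<lambda>x. sgn (v x)) w0" using H1_normalise[OF v vnz] by blast
  have ut: "H1 (-1) 1 (unit_tangent \<gamma>) w0"
    by (rule H1_cong[OF w0]) (rule unit_tangent_eq_sgn[OF \<gamma> vc])
  have energy: "elastic_energy \<gamma> = integral {-1..1} (\<lambda>x. (norm (w0 x))\<^sup>2 / norm (v x))"
    by (rule elastic_energy_eq[OF \<gamma> vc _ ut]) (rule vnz)
  have vc': "continuous_on {-1..1} (\<lambda>x. norm (v x))" by (intro continuous_intros vc)
  have L: "L = integral {-1..1} (\<lambda>x. norm (v x))" using curve_length_eq[OF \<gamma> vc] len by simp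
  have pos: "norm (v x) > 0" if "x \<in> {-1..1}" for x using vnz[OF that] by simp
  obtain T w where T: "H1 (-1) 1 T w"
    and wle: "integral {-1..1} (\<lambda>x. (norm (w x))\<^sup>2) \<le>
        L / 2 * integral {-1..1} (\<lambda>x. (norm (w0 x))\<^sup>2 / norm (v x))"
    and ends: "T (-1) = unit_tangent \<gamma> (-1)" "T 1 = unit_tangent \<gamma> 1"
    and mem: "\<And>x. x \<in> {-1..1} \<Longrightarrow> T x \<in> unit_tangent \<gamma> ` {-1..1}"
    and int: "(L / 2) *\<^sub>R integral {-1..1} T = integral {-1..1} (\<lambda>x. norm (v x) *\<^sub>R unit_tangent \<gamma> x)"
    using arclength_reparametrisation[OF ut vc' pos L] by blast
  have "integral {-1..1} (\<lambda>x. norm (v x) *\<^sub>R unit_tangent \<gamma> x) = integral {-1..1} v"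
    by (rule Henstock_Kurzweil_Integration.integral_cong) (simp add: unit_tangent_eq_sgn[OF \<gamma> vc] sgn_div_norm vnz)
  also have "\<dots> = \<gamma> 1 - \<gamma> (-1)" using H1_increment[OF \<gamma>, of "-1" 1] by simp
  finally have disp: "\<gamma> 1 - \<gamma> (-1) = (L / 2) *\<^sub>R integral {-1..1} T" using int by simp
  have Lpos: "L \<ge> 0" unfolding L by (intro integral_nonneg integrable_continuous_real vc') auto
  show ?thesis
  proof (rule that[OF _ _ disp])
    have "\<gamma> (-1) + (L / 2) *\<^sub>R integral {-1..1} T = \<gamma> 1" using disp by (metis add.commute diff_add_cancel)
    moreover have "norm (T x) = 1" if "x \<in> {-1..1}" for x
      using mem[OF that] vnz by (auto simp: unit_tangent_eq_sgn[OF \<gamma> vc] norm_sgn)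
    ultimately show "tangent_profile M \<xi> \<tau> L (\<gamma> (-1)) T w"
      using T obc ends unfolding tangent_profile_def OBC_def by simp
    show "2 / L * integral {-1..1} (\<lambda>x. (norm (w x))\<^sup>2) \<le> elastic_energy \<gamma>"
    proof (cases "L = 0")
      case True
      have "0 \<le> elastic_energy \<gamma>" unfolding energy
        using L2_norm_square_divide(2)[OF H1_L2[OF w0] vc' pos]
        by (intro integral_nonneg) (auto simp: absolutely_integrable_on_def)
      then show ?thesis using True by simp
    next
      case False
      then have "L > 0" using Lpos by simp
      then show ?thesis using wle unfolding energy by (simp add: field_simps)
    qed
  qed
qed

lemma tangent_profile_imp_admissible:
  assumes prof: "tangent_profile M \<xi> \<tau> L p T w" and L: "L > 0"
  obtains \<gamma> where "admissible M \<xi> \<tau> L \<gamma>"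
    "elastic_energy \<gamma> = 2 / L * integral {-1..1} (\<lambda>x. (norm (w x))\<^sup>2)"
    "\<gamma> 1 - \<gamma> (-1) = (L / 2) *\<^sub>R integral {-1..1} T"
proof -
  from prof have T: "H1 (-1) 1 T w" and nT: "\<And>x. x \<in> {-1..1} \<Longrightarrow> norm (T x) = 1"
    unfolding tangent_profile_def by auto
  define v where "v x = (L / 2) *\<^sub>R T x" for x
  have v: "H1 (-1) 1 v (\<lambda>x. (L / 2) *\<^sub>R w x)"
    unfolding v_def[abs_def] by (rule H1_bounded_linear[OF bounded_linear_scaleR_right T])
  note vc = H1_continuous[OF v]
  define \<gamma> where "\<gamma> x = p + integral {-1..x} v" for x
  have \<gamma>: "H1 (-1) 1 \<gamma> v"
    unfolding \<gamma>_def[abs_def] by (intro H1_indefinite_integral L2_continuous vc)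
  have nv: "norm (v x) = L / 2" if "x \<in> {-1..1}" for x using nT[OF that] L by (simp add: v_def)
  then have vnz: "v x \<noteq> 0" if "x \<in> {-1..1}" for x using L that by fastforce
  have ut: "unit_tangent \<gamma> x = T x" if "x \<in> {-1..1}" for x
    using unit_tangent_eq_sgn[OF \<gamma> vc that] nT[OF that] L by (simp add: v_def sgn_scaleR sgn_div_norm)
  have Hut: "H1 (-1) 1 (unit_tangent \<gamma>) w" by (rule H1_cong[OF T]) (rule ut)
  have ends: "\<gamma> (-1) = p" "\<gamma> 1 = p + (L / 2) *\<^sub>R integral {-1..1} T"
    unfolding \<gamma>_def v_def by (simp_all add: integral_cmul)
  show ?thesis
  proof
    have "curve_length \<gamma> = integral {-1..1} (\<lambda>_::real. L / 2)"
      unfolding curve_length_eq[OF \<gamma> vc] using nv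
      by (intro Henstock_Kurzweil_Integration.integral_cong) auto
    moreover have "OBC M \<xi> \<tau> \<gamma>"
      using prof unfolding OBC_def tangent_profile_def by (simp add: ends ut)
    ultimately show "admissible M \<xi> \<tau> L \<gamma>"
      using H1_imp_W22_curve[OF \<gamma> v] vnz velocity_eq[OF \<gamma> vc]
      unfolding admissible_def W22_immersion_def by simp
    have "elastic_energy \<gamma> = integral {-1..1} (\<lambda>x. (norm (w x))\<^sup>2 / norm (v x))"
      by (rule elastic_energy_eq[OF \<gamma> vc vnz Hut])
    also have "\<dots> = integral {-1..1} (\<lambda>x. 2 / L * (norm (w x))\<^sup>2)"
      by (rule Henstock_Kurzweil_Integration.integral_cong) (simp add: nv)
    finally show "elastic_energy \<gamma> = 2 / L * integral {-1..1} (\<lambda>x. (norm (w x))\<^sup>2)"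
      by (simp only: integral_mult_right)
    show "\<gamma> 1 - \<gamma> (-1) = (L / 2) *\<^sub>R integral {-1..1} T" by (simp add: ends)
  qed
qed

section \<open>Compactness\<close>

text \<open>The energy bound makes the tangents equi-Hoelder continuous with exponent one half, so
Arzela-Ascoli applies. Every condition on a profile is closed under uniform convergence of the
tangents and convergence of the starting points. The limit has finite energy, with the right bound,
because each dyadic energy is a continuous function of finitely many values of \<open>T\<close>.\<close>

lemma tangent_profile_compactness:
  fixes M :: "'a::euclidean_space set"
  assumes M: "closed M" and \<xi>: "continuous_on M \<xi>"
    and prof: "\<And>n. tangent_profile M \<xi> \<tau> L (p n) (T n) (w n)"
    and p: "bounded (range p)"
    and S: "\<And>n. integral {-1..1} (\<lambda>x. (norm (w n x))\<^sup>2) \<le> S n" "S \<longlonglongrightarrow> s"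
  obtains p' T' w' r where "strict_mono r" "tangent_profile M \<xi> \<tau> L p' T' w'"
    "integral {-1..1} (\<lambda>x. (norm (w' x))\<^sup>2) \<le> s"
    "(\<lambda>n. integral {-1..1} (T (r n))) \<longlonglongrightarrow> integral {-1..1} T'"
proof -
  have H: "H1 (-1) 1 (T n) (w n)" and nT: "\<And>x. x \<in> {-1..1} \<Longrightarrow> norm (T n x) = 1"
    and pM: "p n \<in> M" and qM: "p n + (L / 2) *\<^sub>R integral {-1..1} (T n) \<in> M"
    and T0: "T n (-1) = \<tau> (-1) *\<^sub>R \<xi> (p n)"
    and T1: "T n 1 = \<tau> 1 *\<^sub>R \<xi> (p n + (L / 2) *\<^sub>R integral {-1..1} (T n))" for n
    using prof[of n] unfolding tangent_profile_def by auto
  obtain C where C: "C > 0" "\<And>n. norm (S n) \<le> C"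
    using BseqE[OF convergent_imp_Bseq[OF convergentI[OF S(2)]]] by blast
  have holder: "(norm (T n y - T n x))\<^sup>2 \<le> \<bar>y - x\<bar> * C" if "x \<in> {-1..1}" "y \<in> {-1..1}" for n x y
  proof -
    have *: "(norm (T n y - T n x))\<^sup>2 \<le> (y - x) * C" if "-1 \<le> x" "x \<le> y" "y \<le> 1" for x y
    proof -
      have "integral {x..y} (\<lambda>t. (norm (w n t))\<^sup>2) \<le> integral {-1..1} (\<lambda>t. (norm (w n t))\<^sup>2)"
        using that by (intro integral_subset_le L2_integrable(3)[OF H1_L2[OF H]]) auto
      also have "\<dots> \<le> C" using S(1)[of n] C(2)[of n] by simp
      finally have "(y - x) * integral {x..y} (\<lambda>t. (norm (w n t))\<^sup>2) \<le> (y - x) * C"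
        using that by (intro mult_left_mono) auto
      with H1_norm_increment_le(2)[OF H that, of n] show ?thesis by linarith
    qed
    show ?thesis
      using *[of x y] *[of y x] that by (cases "x \<le> y") (auto simp: norm_minus_commute abs_minus_commute)
  qed
  obtain g k where g: "continuous_on {-1..1} g" and k: "strict_mono (k :: nat \<Rightarrow> nat)"
    and unif: "\<And>e. 0 < e \<Longrightarrow> \<exists>N. \<forall>n x. n \<ge> N \<and> x \<in> {-1..1} \<longrightarrow> norm (T (k n) x - g x) < e"
  proof (rule Arzela_Ascoli[of "{-1..1::real}" T 1])
    show "norm (T n x) \<le> 1" if "x \<in> {-1..1}" for n x using nT[OF that] by simp
    fix x e :: real assume x: "x \<in> {-1..1}" and e: "0 < e"
    show "\<exists>d>0. \<forall>n y. y \<in> {-1..1} \<and> norm (x - y) < d \<longrightarrow> norm (T n x - T n y) < e"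
    proof (intro exI[of _ "e\<^sup>2 / C"] conjI allI impI)
      show "0 < e\<^sup>2 / C" using e C by simp
      fix n y assume y: "y \<in> {-1..1} \<and> norm (x - y) < e\<^sup>2 / C"
      have "(norm (T n x - T n y))\<^sup>2 \<le> \<bar>x - y\<bar> * C" using holder x y by auto
      also have "\<dots> < e\<^sup>2" using y C(1) by (simp add: field_simps)
      finally show "norm (T n x - T n y) < e" using e by (intro power_less_imp_less_base[of _ 2 e]) auto
    qed
  qed auto
  have "bounded (range (p \<circ> k))" by (rule bounded_subset[OF p]) auto
  from bounded_imp_convergent_subsequence[OF this] obtain p' q where
    q: "strict_mono q" "((p \<circ> k) \<circ> q) \<longlonglongrightarrow> p'" by blast
  define r where "r = k \<circ> q"
  have r: "strict_mono r" unfolding r_def by (rule strict_mono_o[OF k q(1)])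
  have pr: "(\<lambda>n. p (r n)) \<longlonglongrightarrow> p'" using q(2) by (simp add: r_def o_def)
  have Tr: "(\<lambda>n. T (r n) x) \<longlonglongrightarrow> g x" if x: "x \<in> {-1..1}" for x
  proof -
    have "(\<lambda>n. T (k n) x) \<longlonglongrightarrow> g x"
      unfolding LIMSEQ_iff using unif x by blast
    from LIMSEQ_subseq_LIMSEQ[OF this q(1)] show ?thesis by (simp add: r_def o_def)
  qed
  have int: "(\<lambda>n. integral {-1..1} (T (r n))) \<longlonglongrightarrow> integral {-1..1} g"
  proof (rule dominated_convergence(2))
    show "T (r n) integrable_on {-1..1}" for n by (intro integrable_continuous_real H1_continuous[OF H])
    show "(\<lambda>_. 1::real) integrable_on {-1..1::real}" by (intro integrable_continuous_real continuous_on_const)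
    show "norm (T (r n) x) \<le> 1" if "x \<in> {-1..1}" for n x using nT[OF that] by simp
  qed (rule Tr)
  have ng: "norm (g x) = 1" if "x \<in> {-1..1}" for x
    using tendsto_norm[OF Tr[OF that]] nT[OF that] by (simp add: LIMSEQ_const_iff)
  have "dyadic_energy g j \<le> s" for j
  proof (rule LIMSEQ_le)
    show "(\<lambda>n. dyadic_energy (T (r n)) j) \<longlonglongrightarrow> dyadic_energy g j"
      unfolding dyadic_energy_def
    proof (intro tendsto_sum tendsto_mult tendsto_const tendsto_power tendsto_norm tendsto_diff Tr)
      fix i assume "i \<in> {..<(2::nat) ^ j}"
      then show "dyadic j (Suc i) \<in> {-1..1}" "dyadic j i \<in> {-1..1}" by (intro dyadic_mem; simp)+
    qed
    show "(\<lambda>n. S (r n)) \<longlonglongrightarrow> s" using LIMSEQ_subseq_LIMSEQ[OF S(2) r] by (simp add: o_def)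
    show "\<exists>N. \<forall>n\<ge>N. dyadic_energy (T (r n)) j \<le> S (r n)"
      using order_trans[OF H1_dyadic_energy_le[OF H] S(1)] by blast
  qed
  from H1_if_dyadic_energy_bounded[OF g this] obtain w' where
    w': "H1 (-1) 1 g w'" "integral {-1..1} (\<lambda>x. (norm (w' x))\<^sup>2) \<le> s" by blast
  have q: "(\<lambda>n. p (r n) + (L / 2) *\<^sub>R integral {-1..1} (T (r n))) \<longlonglongrightarrow>
      p' + (L / 2) *\<^sub>R integral {-1..1} g"
    by (intro tendsto_intros pr int)
  have p'M: "p' \<in> M" using closed_sequentially[OF M _ pr] pM by blast
  have q'M: "p' + (L / 2) *\<^sub>R integral {-1..1} g \<in> M" using closed_sequentially[OF M _ q] qM by blast
  have "(\<lambda>n. \<tau> (-1) *\<^sub>R \<xi> (p (r n))) \<longlonglongrightarrow> \<tau> (-1) *\<^sub>R \<xi> p'"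
    by (intro tendsto_scaleR tendsto_const continuous_on_tendsto_compose[OF \<xi> pr p'M]) (simp add: pM)
  then have g0: "g (-1) = \<tau> (-1) *\<^sub>R \<xi> p'"
    using Tr[of "-1"] LIMSEQ_unique unfolding T0 by auto
  have "(\<lambda>n. \<tau> 1 *\<^sub>R \<xi> (p (r n) + (L / 2) *\<^sub>R integral {-1..1} (T (r n)))) \<longlonglongrightarrow>
      \<tau> 1 *\<^sub>R \<xi> (p' + (L / 2) *\<^sub>R integral {-1..1} g)"
    by (intro tendsto_scaleR tendsto_const continuous_on_tendsto_compose[OF \<xi> q q'M]) (simp add: qM)
  then have g1: "g 1 = \<tau> 1 *\<^sub>R \<xi> (p' + (L / 2) *\<^sub>R integral {-1..1} g)"
    using Tr[of 1] LIMSEQ_unique unfolding T1 by auto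
  show ?thesis
    by (rule that[OF r _ w'(2) int]) (use w'(1) ng p'M q'M g0 g1 in \<open>auto simp: tangent_profile_def\<close>)
qed

lemma smooth_map_on_imp_continuous_on:
  assumes "smooth_map_on M f"
  shows "continuous_on M f"
  unfolding continuous_on_def
proof
  fix x assume x: "x \<in> M"
  then obtain U g where U: "x \<in> U" "smooth_on_open U g" "\<forall>y\<in>M \<inter> U. g y = f y"
    using assms unfolding smooth_map_on_def by blast
  have "open U" "Ck_on 0 U g" using U(2) unfolding smooth_on_open_def by blast+
  then have "isCont g x" using U(1) by (simp add: continuous_on_eq_continuous_at)
  then have "(g \<longlongrightarrow> g x) (at x within M)" by (simp add: continuous_at_imp_continuous_at_within continuous_within[symmetric])
  moreover have "eventually (\<lambda>y. g y = f y) (at x within M)"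
    unfolding eventually_at_topological using U \<open>open U\<close> by blast
  moreover have "g x = f x" using U x by blast
  ultimately show "(f \<longlongrightarrow> f x) (at x within M)" using tendsto_cong by metis
qed

lemma Ck_on_const: "Ck_on k U (\<lambda>_. c)"
  by (induction k arbitrary: c) (auto simp: frechet_derivative_const)

lemma Ck_on_line: "Ck_on k U (\<lambda>t::real. x + t *\<^sub>R v)"
proof (cases k)
  case (Suc j)
  have d: "((\<lambda>t::real. x + t *\<^sub>R v) has_derivative (\<lambda>h. h *\<^sub>R v)) (at t)" for t
    by (auto intro!: derivative_eq_intros)
  have "frechet_derivative (\<lambda>t::real. x + t *\<^sub>R v) (at t) = (\<lambda>h. h *\<^sub>R v)" for t
    using frechet_derivative_at[OF d] by simp
  then show ?thesis using d unfolding Suc by (auto simp: Ck_on_const differentiable_def)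
qed (auto intro!: continuous_intros)

text \<open>Lines inside the hyperplane force \<open>\<xi>\<close> to be a multiple \<open>\<plusminus>n\<close> of a fixed unit vector; the sign is
continuous on the connected set \<open>M\<close> and takes two values at most, so it is constant. Describing \<open>M\<close>
by the normal \<open>\<nu>\<close> itself avoids a second normal vector later on.\<close>

lemma hyperplane_normal_constant:
  fixes M :: "'a::euclidean_space set"
  assumes M: "is_hyperplane M" and \<xi>: "smooth_unit_normal M \<xi>"
  obtains \<nu> c where "norm \<nu> = 1" "M = {x. \<nu> \<bullet> x = c}" "\<forall>x\<in>M. \<xi> x = \<nu>"
proof -
  from M obtain a b where a: "a \<noteq> 0" and M: "M = {x. a \<bullet> x = b}" unfolding is_hyperplane_def by blast
  define n where "n = sgn a"
  define c where "c = b / norm a"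
  have n: "norm n = 1" unfolding n_def using a by (simp add: norm_sgn)
  have "a \<bullet> x = norm a * (n \<bullet> x)" for x unfolding n_def using a by (simp add: sgn_div_norm)
  then have Mn: "M = {x. n \<bullet> x = c}" unfolding M c_def using a by (auto simp: field_simps)
  have nn: "n \<bullet> n = 1" using n by (simp add: norm_eq_1)
  have tangent: "v \<in> tangent_space M x" if "x \<in> M" "n \<bullet> v = 0" for x v
    unfolding tangent_space_def
  proof (intro CollectI exI[of _ "\<lambda>t. x + t *\<^sub>R v"] exI[of _ 1] conjI)
    show "smooth_on_open {-1<..<1::real} (\<lambda>t. x + t *\<^sub>R v)"
      unfolding smooth_on_open_def by (simp add: Ck_on_line)
    show "(\<lambda>t. x + t *\<^sub>R v) ` {-1<..<1::real} \<subseteq> M"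
      using that unfolding Mn by (auto simp: inner_add_right)
    show "((\<lambda>t. x + t *\<^sub>R v) has_vector_derivative v) (at 0)"
      by (auto intro!: derivative_eq_intros simp: has_vector_derivative_def)
  qed auto
  have \<xi>n: "\<xi> x = (n \<bullet> \<xi> x) *\<^sub>R n \<and> (n \<bullet> \<xi> x = 1 \<or> n \<bullet> \<xi> x = -1)" if x: "x \<in> M" for x
  proof -
    define u where "u = \<xi> x - (n \<bullet> \<xi> x) *\<^sub>R n"
    have nu: "n \<bullet> u = 0" unfolding u_def by (simp add: inner_diff_right nn)
    then have "\<xi> x \<bullet> u = 0" using \<xi> tangent[OF x] x unfolding smooth_unit_normal_def by blast
    then have "u \<bullet> u = 0" using nu unfolding u_def by (simp add: inner_diff_left inner_commute)
    then have 1: "\<xi> x = (n \<bullet> \<xi> x) *\<^sub>R n" unfolding u_def by simp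
    moreover have "norm (\<xi> x) = 1" using \<xi> x unfolding smooth_unit_normal_def by blast
    ultimately have "\<bar>n \<bullet> \<xi> x\<bar> = 1" using n by (metis mult.right_neutral norm_scaleR)
    with 1 show ?thesis by linarith
  qed
  have "(\<lambda>x. n \<bullet> \<xi> x) constant_on M"
  proof (rule continuous_finite_range_constant)
    show "connected M" unfolding M by (intro convex_connected convex_hyperplane)
    show "continuous_on M (\<lambda>x. n \<bullet> \<xi> x)"
      using \<xi> unfolding smooth_unit_normal_def
      by (intro continuous_intros smooth_map_on_imp_continuous_on) auto
    show "finite ((\<lambda>x. n \<bullet> \<xi> x) ` M)"
      by (rule finite_subset[of _ "{1, -1}"]) (use \<xi>n in auto)
  qed
  then obtain s where s: "\<And>x. x \<in> M \<Longrightarrow> n \<bullet> \<xi> x = s" unfolding constant_on_def by blast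
  obtain x0 where x0: "x0 \<in> M"
  proof
    show "c *\<^sub>R n \<in> M" unfolding Mn by (simp add: nn)
  qed
  have s1: "s = 1 \<or> s = -1" using \<xi>n[OF x0] s[OF x0] by simp
  show ?thesis
  proof
    show "norm (s *\<^sub>R n) = 1" using n s1 by auto
    show "M = {x. (s *\<^sub>R n) \<bullet> x = s * c}" using s1 unfolding Mn by auto
    show "\<forall>x\<in>M. \<xi> x = s *\<^sub>R n" using \<xi>n s by metis
  qed
qed

text \<open>Translations along a hyperplane preserve the hyperplane and its normal field.\<close>

lemma tangent_profile_translate:
  assumes prof: "tangent_profile M \<xi> \<tau> L p T w" and q: "q \<in> M"
    and M: "M = {x. \<nu> \<bullet> x = c}" and \<xi>: "\<forall>x\<in>M. \<xi> x = \<nu>"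
  shows "tangent_profile M \<xi> \<tau> L q T w"
proof -
  define d where "d = (L / 2) *\<^sub>R integral {-1..1} T"
  have p: "p \<in> M" "p + d \<in> M" using prof unfolding tangent_profile_def d_def by auto
  then have "q + d \<in> M" using q unfolding M by (simp add: inner_add_right)
  then show ?thesis
    using prof p q \<xi> unfolding tangent_profile_def d_def[symmetric] by simp
qed

section \<open>The energy of a quarter turn\<close>

text \<open>Expand \<open>0 \<le> \<integral> |w - p u|\<^sup>2\<close>. Since \<open>p' + p\<^sup>2 = -k\<^sup>2\<close>, the cross term is the integral of
\<open>(p |u|\<^sup>2)' - p' |u|\<^sup>2\<close>, and the boundary terms cancel by assumption. A solution \<open>p\<close> of the Riccati
equation thus certifies the inequality.\<close>

lemma Riccati_inequality:
  assumes u: "H1 a b u w" and ab: "a \<le> b"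
    and p: "\<And>x. x \<in> {a..b} \<Longrightarrow> (p has_real_derivative - (k\<^sup>2 + (p x)\<^sup>2)) (at x within {a..b})"
    and bc: "p b * (norm (u b))\<^sup>2 = p a * (norm (u a))\<^sup>2"
  shows "k\<^sup>2 * integral {a..b} (\<lambda>x. (norm (u x))\<^sup>2) \<le> integral {a..b} (\<lambda>x. (norm (w x))\<^sup>2)"
proof -
  define p' where "p' x = - (k\<^sup>2 + (p x)\<^sup>2)" for x
  note uc = H1_continuous[OF u] and w = H1_L2[OF u]
  have pc: "continuous_on {a..b} p"
    unfolding continuous_on_eq_continuous_within using DERIV_continuous[OF p] by blast
  have p'c: "continuous_on {a..b} p'" unfolding p'_def[abs_def] by (intro continuous_intros pc)
  have Hp: "H1 a b p p'"
    by (rule H1_of_C1[OF _ p'c])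
      (use p in \<open>unfold p'_def has_real_derivative_iff_has_vector_derivative\<close>)
  have L2pw: "L2 a b (\<lambda>x. p x *\<^sub>R w x)"
    by (rule L2_bilinear_continuous[OF bounded_bilinear.flip[OF bounded_bilinear_scaleR] w pc])
  have L2p'u: "L2 a b (\<lambda>x. p' x *\<^sub>R u x)" by (intro L2_continuous continuous_intros p'c uc)
  have Hpu: "H1 a b (\<lambda>x. p x *\<^sub>R u x) (\<lambda>x. p' x *\<^sub>R u x + p x *\<^sub>R w x)"
    unfolding H1_def
    using L2_add[OF L2p'u L2pw] H1_product_rule[OF bounded_bilinear_scaleR Hp u] by blast
  have "(p b *\<^sub>R u b) \<bullet> u b = (p a *\<^sub>R u a) \<bullet> u a +
      integral {a..b} (\<lambda>x. (p' x *\<^sub>R u x + p x *\<^sub>R w x) \<bullet> u x + (p x *\<^sub>R u x) \<bullet> w x)"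
    by (rule H1_product_rule[OF bounded_bilinear_inner Hpu u]) (use ab in auto)
  then have zero: "integral {a..b} (\<lambda>x. (p' x *\<^sub>R u x + p x *\<^sub>R w x) \<bullet> u x + (p x *\<^sub>R u x) \<bullet> w x) = 0"
    using bc by (simp add: power2_norm_eq_inner)
  have ii: "(\<lambda>x. f x \<bullet> g x) integrable_on {a..b}" if "L2 a b f" "L2 a b g" for f g :: "real \<Rightarrow> 'a"
    using L2_bilinear_absolutely_integrable[OF bounded_bilinear_inner that]
    unfolding absolutely_integrable_on_def by blast
  have zi: "(\<lambda>x. (p' x *\<^sub>R u x + p x *\<^sub>R w x) \<bullet> u x + (p x *\<^sub>R u x) \<bullet> w x) integrable_on {a..b}"
    by (intro integrable_add ii H1_L2[OF Hpu] L2_continuous uc w continuous_intros pc)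
  have wi: "(\<lambda>x. (norm (w x))\<^sup>2) integrable_on {a..b}" using w unfolding L2_def by simp
  have ui: "(\<lambda>x. k\<^sup>2 * (norm (u x))\<^sup>2) integrable_on {a..b}"
    by (intro integrable_continuous_real continuous_intros uc)
  have "0 \<le> integral {a..b} (\<lambda>x. (norm (w x - p x *\<^sub>R u x))\<^sup>2)"
    by (intro integral_nonneg L2_integrable(3)[OF L2_diff[OF w] order_refl] L2_continuous continuous_intros pc uc)
      auto
  also have "(\<lambda>x. (norm (w x - p x *\<^sub>R u x))\<^sup>2) = (\<lambda>x. (norm (w x))\<^sup>2 - k\<^sup>2 * (norm (u x))\<^sup>2 -
      ((p' x *\<^sub>R u x + p x *\<^sub>R w x) \<bullet> u x + (p x *\<^sub>R u x) \<bullet> w x))"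
    unfolding power2_norm_eq_inner
    by (auto simp: p'_def inner_commute algebra_simps power2_eq_square)
  also have "integral {a..b} \<dots> = integral {a..b} (\<lambda>x. (norm (w x))\<^sup>2) -
      k\<^sup>2 * integral {a..b} (\<lambda>x. (norm (u x))\<^sup>2) - 0"
    unfolding integral_diff[OF integrable_diff[OF wi ui] zi] zero integral_diff[OF wi ui]
    by simp
  finally show ?thesis by simp
qed

text \<open>The sharp constant for functions that vanish at one end point. The extremal functions are sines,
whose logarithmic derivative \<open>k cot\<close> solves the Riccati equation but has a pole at the zero of \<open>u\<close>.
The tangents used below are the translates whose zero lies at the other end point, so that both
boundary terms vanish; they stay bounded as long as \<open>k (b - a) < \<pi> / 2\<close>, and \<open>k\<close> may approach the
critical value.\<close>

lemma Wirtinger_inequality: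
  assumes u: "H1 a b u w" and ab: "a < b" and bc: "u a = 0 \<or> u b = 0"
  shows "(pi / 2)\<^sup>2 * integral {a..b} (\<lambda>x. (norm (u x))\<^sup>2) \<le>
    (b - a)\<^sup>2 * integral {a..b} (\<lambda>x. (norm (w x))\<^sup>2)"
proof (rule field_le_mult_one_interval)
  fix z :: real assume z: "0 < z" "z < 1"
  \<comment> \<open>Slightly below the critical value, such that \<open>k\<^sup>2\<close> is \<open>z\<close> times its square.\<close>
  define k where "k = sqrt z * (pi / 2) / (b - a)"
  have z1: "sqrt z < 1" "0 < sqrt z" using z by auto
  then have z2: "sqrt z * (pi / 2) < 1 * (pi / 2)" by (intro mult_strict_right_mono) auto
  have k0: "k > 0" unfolding k_def using ab z1 by simp
  have "b - a \<noteq> 0" using ab by simp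
  from nonzero_eq_divide_eq[THEN iffD1, OF this k_def] have "k * (b - a) = sqrt z * (pi / 2)" .
  then have kb: "k * (b - a) < pi / 2" using z2 by simp
  have cosn: "cos (k * t) \<noteq> 0" if "0 \<le> t" "t \<le> b - a" for t
  proof -
    have "k * t \<le> k * (b - a)" using that k0 by simp
    then have "k * t < pi / 2" using kb by linarith
    moreover have "0 \<le> k * t" using that k0 by simp
    then have "- (pi / 2) < k * t" using pi_gt_zero by linarith
    ultimately have "cos (k * t) > 0" by (intro cos_gt_zero_pi)
    then show ?thesis by simp
  qed
  have tan_sec: "inverse ((cos y)\<^sup>2) = 1 + (tan y)\<^sup>2" if "cos y \<noteq> 0" for y :: real
    using tan_sec[OF that] by (simp add: power_inverse)
  have "k\<^sup>2 * integral {a..b} (\<lambda>x. (norm (u x))\<^sup>2) \<le> integral {a..b} (\<lambda>x. (norm (w x))\<^sup>2)"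
    using bc
  proof
    assume ua: "u a = 0"
    show ?thesis
    proof (rule Riccati_inequality[OF u])
      fix x assume x: "x \<in> {a..b}"
      have "((\<lambda>x. k * tan (k * (b - x))) has_real_derivative
          k * (inverse ((cos (k * (b - x)))\<^sup>2) * (k * (0 - 1)))) (at x within {a..b})"
        using cosn[of "b - x"] x by (auto intro!: derivative_eq_intros)
      also have "k * (inverse ((cos (k * (b - x)))\<^sup>2) * (k * (0 - 1))) = - (k\<^sup>2 + (k * tan (k * (b - x)))\<^sup>2)"
        using cosn[of "b - x"] x by (subst tan_sec) (auto simp: power2_eq_square algebra_simps)
      finally show "((\<lambda>x. k * tan (k * (b - x))) has_real_derivative
          - (k\<^sup>2 + (k * tan (k * (b - x)))\<^sup>2)) (at x within {a..b})" .
    qed (use ab ua in auto)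
  next
    assume ub: "u b = 0"
    show ?thesis
    proof (rule Riccati_inequality[OF u])
      fix x assume x: "x \<in> {a..b}"
      have "((\<lambda>x. - k * tan (k * (x - a))) has_real_derivative
          - k * (inverse ((cos (k * (x - a)))\<^sup>2) * (k * (1 - 0)))) (at x within {a..b})"
        using cosn[of "x - a"] x by (auto intro!: derivative_eq_intros)
      also have "- k * (inverse ((cos (k * (x - a)))\<^sup>2) * (k * (1 - 0))) = - (k\<^sup>2 + (- k * tan (k * (x - a)))\<^sup>2)"
        using cosn[of "x - a"] x by (subst tan_sec) (auto simp: power2_eq_square algebra_simps)
      finally show "((\<lambda>x. - k * tan (k * (x - a))) has_real_derivative
          - (k\<^sup>2 + (- k * tan (k * (x - a)))\<^sup>2)) (at x within {a..b})" .
    qed (use ab ub in auto)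
  qed
  then have "(b - a)\<^sup>2 * (k\<^sup>2 * integral {a..b} (\<lambda>x. (norm (u x))\<^sup>2)) \<le>
      (b - a)\<^sup>2 * integral {a..b} (\<lambda>x. (norm (w x))\<^sup>2)"
    by (intro mult_left_mono) auto
  moreover have "(b - a)\<^sup>2 * k\<^sup>2 = z * (pi / 2)\<^sup>2"
    unfolding k_def power_mult_distrib power_divide using ab z by simp
  ultimately show "z * ((pi / 2)\<^sup>2 * integral {a..b} (\<lambda>x. (norm (u x))\<^sup>2)) \<le>
      (b - a)\<^sup>2 * integral {a..b} (\<lambda>x. (norm (w x))\<^sup>2)"
    by (simp add: mult.assoc[symmetric])
qed

lemma norm_orthogonal_decomposition:
  fixes v \<nu> :: "'a::euclidean_space"
  assumes "norm \<nu> = 1"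
  shows "(norm (v - (v \<bullet> \<nu>) *\<^sub>R \<nu>))\<^sup>2 + (norm (v \<bullet> \<nu>))\<^sup>2 = (norm v)\<^sup>2"
proof -
  have "\<nu> \<bullet> \<nu> = 1" using assms by (simp add: norm_eq_1)
  then show ?thesis
    unfolding power2_norm_eq_inner
    by (simp add: inner_diff_left inner_diff_right inner_commute)
qed

text \<open>Decompose \<open>T\<close> into its component along \<open>\<nu>\<close> and its orthogonal part. One vanishes at \<open>a\<close> and the other
at \<open>b\<close>, so the Wirtinger inequality applies to both with the same constant, and the sum of the two
inequalities bounds \<open>\<integral> |w|\<^sup>2\<close> by the integral of \<open>|T|\<^sup>2 = 1\<close>. This replaces an argument with the angle
between \<open>T\<close> and \<open>\<nu>\<close>, which is not differentiable at \<open>\<nu>\<close>.\<close>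

lemma quarter_turn_energy:
  assumes T: "H1 a b T w" and ab: "a < b" and unit: "\<And>x. x \<in> {a..b} \<Longrightarrow> norm (T x) = 1"
    and \<nu>: "norm \<nu> = 1"
    and turn: "T a = (T a \<bullet> \<nu>) *\<^sub>R \<nu> \<and> T b \<bullet> \<nu> = 0 \<or> T b = (T b \<bullet> \<nu>) *\<^sub>R \<nu> \<and> T a \<bullet> \<nu> = 0"
  shows "(pi / 2)\<^sup>2 \<le> (b - a) * integral {a..b} (\<lambda>x. (norm (w x))\<^sup>2)"
proof -
  define f where "f x = T x \<bullet> \<nu>" for x
  define R where "R x = T x - (T x \<bullet> \<nu>) *\<^sub>R \<nu>" for x
  have Hf: "H1 a b f (\<lambda>x. w x \<bullet> \<nu>)"
    unfolding f_def[abs_def] by (rule H1_bounded_linear[OF bounded_linear_inner_left T])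
  have "bounded_linear (\<lambda>v::'a. v - (v \<bullet> \<nu>) *\<^sub>R \<nu>)"
    by (intro bounded_linear_sub bounded_linear_ident bounded_linear_scaleR_const bounded_linear_inner_left)
  from H1_bounded_linear[OF this T] have HR: "H1 a b R (\<lambda>x. w x - (w x \<bullet> \<nu>) *\<^sub>R \<nu>)"
    unfolding R_def[abs_def] .
  have "R a = 0 \<or> R b = 0" "f a = 0 \<or> f b = 0" using turn unfolding R_def f_def by auto
  from Wirtinger_inequality[OF HR ab this(1)] Wirtinger_inequality[OF Hf ab this(2)]
  have "(pi / 2)\<^sup>2 * (integral {a..b} (\<lambda>x. (norm (R x))\<^sup>2) + integral {a..b} (\<lambda>x. (norm (f x))\<^sup>2)) \<le>
    (b - a)\<^sup>2 * (integral {a..b} (\<lambda>x. (norm (w x - (w x \<bullet> \<nu>) *\<^sub>R \<nu>))\<^sup>2) +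
      integral {a..b} (\<lambda>x. (norm (w x \<bullet> \<nu>))\<^sup>2))"
    by (simp add: distrib_left)
  also have "integral {a..b} (\<lambda>x. (norm (w x - (w x \<bullet> \<nu>) *\<^sub>R \<nu>))\<^sup>2) +
      integral {a..b} (\<lambda>x. (norm (w x \<bullet> \<nu>))\<^sup>2) =
      integral {a..b} (\<lambda>x. (norm (w x - (w x \<bullet> \<nu>) *\<^sub>R \<nu>))\<^sup>2 + (norm (w x \<bullet> \<nu>))\<^sup>2)"
    by (intro integral_add[symmetric] L2_integrable(3)[OF H1_L2[OF HR] order_refl]
        L2_integrable(3)[OF H1_L2[OF Hf] order_refl])
  also have "\<dots> = integral {a..b} (\<lambda>x. (norm (w x))\<^sup>2)" by (simp only: norm_orthogonal_decomposition[OF \<nu>])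
  also have "integral {a..b} (\<lambda>x. (norm (R x))\<^sup>2) + integral {a..b} (\<lambda>x. (norm (f x))\<^sup>2) =
      integral {a..b} (\<lambda>x. (norm (R x))\<^sup>2 + (norm (f x))\<^sup>2)"
    by (intro integral_add[symmetric] integrable_continuous_real continuous_intros
        H1_continuous[OF HR] H1_continuous[OF Hf])
  also have "\<dots> = integral {a..b} (\<lambda>x. 1)"
  proof (rule Henstock_Kurzweil_Integration.integral_cong)
    fix x assume "x \<in> {a..b}"
    then show "(norm (R x))\<^sup>2 + (norm (f x))\<^sup>2 = 1"
      unfolding R_def f_def norm_orthogonal_decomposition[OF \<nu>] using unit by simp
  qed
  also have "\<dots> = b - a" using ab by simp
  finally have "(b - a) * (pi / 2)\<^sup>2 \<le> (b - a) * ((b - a) * integral {a..b} (\<lambda>x. (norm (w x))\<^sup>2))"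
    by (simp add: power2_eq_square mult_ac)
  then show ?thesis using ab by (simp only: mult_le_cancel_left_pos[of "b - a"] diff_gt_0_iff_gt)
qed

text \<open>Both end points lie on the hyperplane, so \<open>T \<bullet> \<nu>\<close> has mean zero and vanishes at some \<open>t\<close>. The tangent
is \<open>\<plusminus>\<nu>\<close> at both ends and therefore makes a quarter turn on either side of \<open>t\<close>.\<close>

lemma hyperplane_energy_ge:
  fixes M :: "'a::euclidean_space set"
  assumes prof: "tangent_profile M \<xi> \<tau> L p T w" and L: "L > 0"
    and \<nu>: "norm \<nu> = 1" and M: "M = {x. \<nu> \<bullet> x = c}" and \<xi>: "\<forall>x\<in>M. \<xi> x = \<nu>"
  shows "pi\<^sup>2 / L \<le> 2 / L * integral {-1..1} (\<lambda>x. (norm (w x))\<^sup>2)"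
proof -
  have T: "H1 (-1) 1 T w" and unit: "\<And>x. x \<in> {-1..1} \<Longrightarrow> norm (T x) = 1"
    and p: "p \<in> M" "p + (L / 2) *\<^sub>R integral {-1..1} T \<in> M"
    and ends: "T (-1) = \<tau> (-1) *\<^sub>R \<nu>" "T 1 = \<tau> 1 *\<^sub>R \<nu>"
    using prof \<xi> unfolding tangent_profile_def by auto
  have \<nu>\<nu>: "\<nu> \<bullet> \<nu> = 1" using \<nu> by (simp add: norm_eq_1)
  define f where "f x = T x \<bullet> \<nu>" for x
  have fc: "continuous_on {-1..1} f"
    unfolding f_def[abs_def] by (intro continuous_intros H1_continuous[OF T])
  have "integral {-1..1} f = integral {-1..1} T \<bullet> \<nu>"
    using integral_linear[OF L2_integrable(1)[OF L2_continuous[OF H1_continuous[OF T]] order_refl] bounded_linear_inner_left[of \<nu>]]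
    by (simp add: o_def f_def[abs_def])
  also have "\<dots> = 0" using p L unfolding M by (simp add: inner_add_right inner_commute)
  finally have f0: "integral {-1..1} f = 0" .
  \<comment> \<open>A continuous function without zeros has constant sign, hence nonzero mean.\<close>
  have "\<exists>t\<in>{-1..1}. f t = 0"
  proof (rule ccontr)
    assume no: "\<not> (\<exists>t\<in>{-1..1}. f t = 0)"
    have same: "f x > 0" if f: "f (-1) > 0" "x \<in> {-1..1}" "continuous_on {-1..1} f"
      "\<not> (\<exists>t\<in>{-1..1}. f t = 0)" for f :: "real \<Rightarrow> real" and x
    proof (rule ccontr)
      assume "\<not> f x > 0"
      then obtain y where "y \<ge> -1" "y \<le> x" "f y = 0"
        using IVT2'[of f x 0 "-1"] f continuous_on_subset[OF f(3), of "{-1..x}"] by auto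
      then show False using f by auto
    qed
    have "integral {-1..1} g \<noteq> 0" if g: "g (-1) > 0" "continuous_on {-1..1} g"
      "\<not> (\<exists>t\<in>{-1..1}. g t = 0)" for g :: "real \<Rightarrow> real"
    proof
      assume "integral {-1..1} g = 0"
      then have "\<forall>x\<in>{-1..1}. g x = 0"
        by (subst (asm) integral_eq_0_iff[OF g(2)]) (simp, meson g same less_imp_le, simp)
      then show False using g(3) by auto
    qed
    from this[of f] this[of "\<lambda>x. - f x"] show False
      using f0 fc no by (cases "f (-1) > 0") (auto intro!: continuous_intros simp: not_less order_le_less)
  qed
  then obtain t where t: "t \<in> {-1..1}" "T t \<bullet> \<nu> = 0" unfolding f_def by blast
  have endnz: "T (-1) \<bullet> \<nu> \<noteq> 0" "T 1 \<bullet> \<nu> \<noteq> 0"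
    using unit[of "-1"] unit[of 1] unfolding ends by (auto simp: \<nu>\<nu> \<nu>)
  then have t1: "-1 < t" "t < 1" using t by (metis atLeastAtMost_iff order_le_less)+
  define A where "A = integral {-1..t} (\<lambda>x. (norm (w x))\<^sup>2)"
  define B where "B = integral {t..1} (\<lambda>x. (norm (w x))\<^sup>2)"
  have A: "(pi / 2)\<^sup>2 \<le> (t - (-1)) * A" unfolding A_def
    using t t1 unit by (intro quarter_turn_energy[OF H1_subinterval[OF T] _ _ \<nu>]) (auto simp: ends \<nu>\<nu>)
  have B: "(pi / 2)\<^sup>2 \<le> (1 - t) * B" unfolding B_def
    using t t1 unit by (intro quarter_turn_energy[OF H1_subinterval[OF T] _ _ \<nu>]) (auto simp: ends \<nu>\<nu>)
  have "A + B = integral {-1..1} (\<lambda>x. (norm (w x))\<^sup>2)" unfolding A_def B_def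
    using t1 by (intro Henstock_Kurzweil_Integration.integral_combine L2_integrable(3)[OF H1_L2[OF T] order_refl]) auto
  moreover have "pi\<^sup>2 / 2 \<le> A + B"
  proof -
    have "(pi / 2)\<^sup>2 / (1 + t) \<le> A" "(pi / 2)\<^sup>2 / (1 - t) \<le> B"
      using A B t1 by (auto simp: field_simps)
    moreover have "2 \<le> 1 / (1 + t) + 1 / (1 - t)"
    proof -
      have E: "1 / (1 + t) + 1 / (1 - t) = 2 / (1 - t\<^sup>2)"
        using t1 by (simp add: field_simps power2_eq_square)
      have "0 < 1 - t\<^sup>2" "1 - t\<^sup>2 \<le> 1" using t1 by (auto simp: abs_square_less_1)
      then show ?thesis unfolding E by (simp add: le_divide_eq)
    qed
    then have "(pi / 2)\<^sup>2 * 2 \<le> (pi / 2)\<^sup>2 * (1 / (1 + t) + 1 / (1 - t))" by (intro mult_left_mono) auto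
    moreover have "(pi / 2)\<^sup>2 * (1 / (1 + t) + 1 / (1 - t)) = (pi / 2)\<^sup>2 / (1 + t) + (pi / 2)\<^sup>2 / (1 - t)"
      by (simp only: distrib_left times_divide_eq_right mult_1_right)
    ultimately have "(pi / 2)\<^sup>2 * 2 \<le> A + B" by linarith
    then show ?thesis by (simp add: power_divide)
  qed
  ultimately show ?thesis using L by (simp add: field_simps)
qed

text \<open>The tangent of a semicircle in a plane spanned by \<open>\<nu>\<close> and a unit vector \<open>e\<close> orthogonal to it, turning
at constant speed from \<open>\<tau> (-1) \<nu>\<close> to its negative.\<close>

lemma semicircle_profile:
  fixes M :: "'a::euclidean_space set"
  assumes dim: "DIM('a) \<ge> 2" and \<tau>: "\<tau> (-1) \<in> {-1, 1}" "\<tau> 1 = - \<tau> (-1)"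
    and \<nu>: "norm \<nu> = 1" and M: "M = {x. \<nu> \<bullet> x = c}" and \<xi>: "\<forall>x\<in>M. \<xi> x = \<nu>"
  obtains p T w where "tangent_profile M \<xi> \<tau> L p T w"
    "integral {-1..1} (\<lambda>x. (norm (w x))\<^sup>2) = pi\<^sup>2 / 2"
proof -
  have \<nu>\<nu>: "\<nu> \<bullet> \<nu> = 1" using \<nu> by (simp add: norm_eq_1)
  obtain y where y: "y \<noteq> 0" "orthogonal \<nu> y" using orthogonal_to_vector_exists[OF dim] by blast
  define e where "e = sgn y"
  have e: "\<nu> \<bullet> e = 0" "e \<bullet> e = 1"
    using y unfolding e_def orthogonal_def
    by (simp_all add: sgn_div_norm inner_commute power2_norm_eq_inner[symmetric] power2_eq_square field_simps)
  have e': "e \<bullet> \<nu> = 0" using e by (simp add: inner_commute)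
  define s where "s = \<tau> (-1)"
  have s: "s * s = 1" using \<tau> unfolding s_def by auto
  define \<theta> where "\<theta> x = pi / 2 * (x + 1)" for x :: real
  define T where "T x = (s * cos (\<theta> x)) *\<^sub>R \<nu> + sin (\<theta> x) *\<^sub>R e" for x
  define w where "w x = (pi / 2) *\<^sub>R ((- s * sin (\<theta> x)) *\<^sub>R \<nu> + cos (\<theta> x) *\<^sub>R e)" for x
  have T: "H1 (-1) 1 T w"
  proof (rule H1_of_C1)
    fix x :: real
    show "(T has_vector_derivative w x) (at x within {-1..1})"
      unfolding T_def[abs_def] w_def \<theta>_def
      by (auto intro!: derivative_eq_intros simp: algebra_simps)
    show "continuous_on {-1..1} w" unfolding w_def[abs_def] \<theta>_def by (intro continuous_intros)
  qed
  have norm_comb: "(norm (\<alpha> *\<^sub>R \<nu> + \<beta> *\<^sub>R e))\<^sup>2 = \<alpha>\<^sup>2 + \<beta>\<^sup>2" for \<alpha> \<beta>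
    unfolding power2_norm_eq_inner
    by (simp add: inner_add_left inner_add_right \<nu>\<nu> e e' power2_eq_square)
  have nT: "norm (T x) = 1" for x
  proof -
    have "(norm (T x))\<^sup>2 = 1" unfolding T_def norm_comb using s
      by (simp add: power_mult_distrib power2_eq_square[of s])
    then show ?thesis by (simp add: power2_eq_1_iff) (metis norm_ge_zero neg_0_le_iff_le not_one_le_zero)
  qed
  have nw: "(norm (w x))\<^sup>2 = (pi / 2)\<^sup>2" for x
    unfolding w_def norm_scaleR power_mult_distrib norm_comb using s
    by (simp add: power_mult_distrib power2_eq_square[of s])
  have "((\<lambda>x. T x \<bullet> \<nu>) has_integral (s * (2 / pi) * sin (\<theta> 1) - s * (2 / pi) * sin (\<theta> (-1)))) {-1..1}"
  proof (rule fundamental_theorem_of_calculus)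
    fix x :: real
    have "((\<lambda>x. s * (2 / pi) * sin (\<theta> x)) has_real_derivative s * cos (\<theta> x)) (at x within {-1..1})"
      unfolding \<theta>_def by (auto intro!: derivative_eq_intros)
    then show "((\<lambda>x. s * (2 / pi) * sin (\<theta> x)) has_vector_derivative T x \<bullet> \<nu>) (at x within {-1..1})"
      by (simp add: T_def inner_add_left \<nu>\<nu> e' has_real_derivative_iff_has_vector_derivative)
  qed simp
  then have "integral {-1..1} (\<lambda>x. T x \<bullet> \<nu>) = 0" by (simp add: integral_unique \<theta>_def)
  then have I: "\<nu> \<bullet> integral {-1..1} T = 0"
    using integral_linear[OF L2_integrable(1)[OF L2_continuous[OF H1_continuous[OF T]] order_refl] bounded_linear_inner_left[of \<nu>]]
    by (simp add: o_def inner_commute)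
  show ?thesis
  proof
    have p: "c *\<^sub>R \<nu> \<in> M" unfolding M by (simp add: \<nu>\<nu>)
    moreover have "c *\<^sub>R \<nu> + (L / 2) *\<^sub>R integral {-1..1} T \<in> M"
      unfolding M by (simp add: \<nu>\<nu> inner_add_right I)
    moreover have "T (-1) = \<tau> (-1) *\<^sub>R \<nu>" "T 1 = \<tau> 1 *\<^sub>R \<nu>"
      unfolding T_def \<theta>_def by (simp_all add: s_def \<tau>(2))
    ultimately show "tangent_profile M \<xi> \<tau> L (c *\<^sub>R \<nu>) T w"
      unfolding tangent_profile_def using T nT \<xi> by simp
    show "integral {-1..1} (\<lambda>x. (norm (w x))\<^sup>2) = pi\<^sup>2 / 2" by (simp add: nw power_divide)
  qed
qed

section \<open>Minimisers and straight curves\<close>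

text \<open>Passing to tangent profiles changes neither the chord nor the start of the curve and does not
increase the energy. On a hyperplane the profiles are moved to a common starting point, which keeps
the chords.\<close>

lemma admissible_compactness:
  assumes \<xi>: "smooth_unit_normal M \<xi>" and L: "L > 0" and M: "is_hyperplane M \<or> compact M"
    and adm: "\<And>n. admissible M \<xi> \<tau> L (\<gamma> n)"
    and S: "\<And>n. elastic_energy (\<gamma> n) \<le> S n" "S \<longlonglongrightarrow> s"
  obtains \<gamma>' r where "admissible M \<xi> \<tau> L \<gamma>'" "elastic_energy \<gamma>' \<le> s" "strict_mono (r :: nat \<Rightarrow> nat)"
    "(\<lambda>n. norm (\<gamma> (r n) 1 - \<gamma> (r n) (-1))) \<longlonglongrightarrow> norm (\<gamma>' 1 - \<gamma>' (-1))"
proof -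
  have "\<forall>n. \<exists>T w. tangent_profile M \<xi> \<tau> L (\<gamma> n (-1)) T w \<and>
      2 / L * integral {-1..1} (\<lambda>x. (norm (w x))\<^sup>2) \<le> elastic_energy (\<gamma> n) \<and>
      \<gamma> n 1 - \<gamma> n (-1) = (L / 2) *\<^sub>R integral {-1..1} T"
    using admissible_imp_tangent_profile[OF adm] by metis
  then obtain T w where prof: "\<And>n. tangent_profile M \<xi> \<tau> L (\<gamma> n (-1)) (T n) (w n)"
    and energy: "\<And>n. 2 / L * integral {-1..1} (\<lambda>x. (norm (w n x))\<^sup>2) \<le> elastic_energy (\<gamma> n)"
    and disp: "\<And>n. \<gamma> n 1 - \<gamma> n (-1) = (L / 2) *\<^sub>R integral {-1..1} (T n)"
    by metis
  have memM: "\<gamma> n (-1) \<in> M" for n using prof[of n] unfolding tangent_profile_def by blast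
  obtain p where p: "\<And>n. tangent_profile M \<xi> \<tau> L (p n) (T n) (w n)" "bounded (range p)"
    using M
  proof
    assume "compact M"
    then have "bounded (range (\<lambda>n. \<gamma> n (-1)))"
      by (intro bounded_subset[OF compact_imp_bounded]) (use memM in auto)
    with prof show ?thesis by (rule that)
  next
    assume hyp: "is_hyperplane M"
    obtain \<nu> c where "norm \<nu> = 1" and h: "M = {x. \<nu> \<bullet> x = c}" "\<forall>x\<in>M. \<xi> x = \<nu>"
      using hyperplane_normal_constant[OF hyp \<xi>] .
    show ?thesis
    proof (rule that[of "\<lambda>_. \<gamma> 0 (-1)"])
      show "tangent_profile M \<xi> \<tau> L (\<gamma> 0 (-1)) (T n) (w n)" for n
        by (rule tangent_profile_translate[OF prof memM h])
    qed simp
  qed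
  have closed: "closed M"
    using M by (auto simp: is_hyperplane_def compact_imp_closed closed_hyperplane)
  have cont: "continuous_on M \<xi>"
    using \<xi> unfolding smooth_unit_normal_def by (intro smooth_map_on_imp_continuous_on) blast
  have le: "integral {-1..1} (\<lambda>x. (norm (w n x))\<^sup>2) \<le> L / 2 * S n" for n
    using order_trans[OF energy S(1), of n] L by (simp add: field_simps)
  have lim: "(\<lambda>n. L / 2 * S n) \<longlonglongrightarrow> L / 2 * s" by (intro tendsto_mult tendsto_const S(2))
  obtain p' T' w' r where r: "strict_mono (r :: nat \<Rightarrow> nat)" and prof': "tangent_profile M \<xi> \<tau> L p' T' w'"
    and w': "integral {-1..1} (\<lambda>x. (norm (w' x))\<^sup>2) \<le> L / 2 * s"
    and int: "(\<lambda>n. integral {-1..1} (T (r n))) \<longlonglongrightarrow> integral {-1..1} T'"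
    using tangent_profile_compactness[OF closed cont p le lim] .
  obtain \<gamma>' where \<gamma>': "admissible M \<xi> \<tau> L \<gamma>'"
    "elastic_energy \<gamma>' = 2 / L * integral {-1..1} (\<lambda>x. (norm (w' x))\<^sup>2)"
    "\<gamma>' 1 - \<gamma>' (-1) = (L / 2) *\<^sub>R integral {-1..1} T'"
    using tangent_profile_imp_admissible[OF prof' L] .
  show ?thesis
  proof (rule that[OF \<gamma>'(1) _ r])
    show "elastic_energy \<gamma>' \<le> s" using w' L unfolding \<gamma>'(2) by (simp add: field_simps)
    show "(\<lambda>n. norm (\<gamma> (r n) 1 - \<gamma> (r n) (-1))) \<longlonglongrightarrow> norm (\<gamma>' 1 - \<gamma>' (-1))"
      unfolding disp \<gamma>'(3) by (intro tendsto_norm tendsto_scaleR tendsto_const int)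
  qed
qed

lemma elastic_energy_nonneg:
  assumes "admissible M \<xi> \<tau> L \<gamma>" "L > 0"
  shows "elastic_energy \<gamma> \<ge> 0"
proof -
  obtain T w where prof: "tangent_profile M \<xi> \<tau> L (\<gamma> (-1)) T w"
    and e: "2 / L * integral {-1..1} (\<lambda>x. (norm (w x))\<^sup>2) \<le> elastic_energy \<gamma>"
    and "\<gamma> 1 - \<gamma> (-1) = (L / 2) *\<^sub>R integral {-1..1} T"
    using admissible_imp_tangent_profile[OF assms(1)] .
  have "H1 (-1) 1 T w" using prof unfolding tangent_profile_def by blast
  then have "0 \<le> 2 / L * integral {-1..1} (\<lambda>x. (norm (w x))\<^sup>2)"
    using assms(2) by (intro mult_nonneg_nonneg integral_nonneg L2_integrable(3)[OF H1_L2 order_refl]) auto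
  with e show ?thesis by linarith
qed

lemma integral_unit_norm_le:
  fixes T :: "real \<Rightarrow> 'a::euclidean_space"
  assumes "continuous_on {-1..1} T" "\<And>x. x \<in> {-1..1} \<Longrightarrow> norm (T x) = 1"
  shows "norm (integral {-1..1} T) \<le> 2"
proof -
  have "norm (integral {-1..1} T) \<le> integral {-1..1} (\<lambda>_::real. 1::real)"
    using assms by (intro integral_norm_bound_integral integrable_continuous_real continuous_on_const) auto
  then show ?thesis by simp
qed

text \<open>Equality in the triangle inequality: with \<open>u\<close> the direction of the integral, \<open>1 - T \<bullet> u\<close> is a
nonnegative continuous function of mean zero.\<close>

lemma integral_unit_norm_eq_imp_constant:
  fixes T :: "real \<Rightarrow> 'a::euclidean_space"
  assumes c: "continuous_on {-1..1} T" and unit: "\<And>x. x \<in> {-1..1} \<Longrightarrow> norm (T x) = 1"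
    and eq: "norm (integral {-1..1} T) = 2" and x: "x \<in> {-1..1}"
  shows "T x = T (-1)"
proof -
  define u where "u = (1 / 2) *\<^sub>R integral {-1..1} T"
  have nu: "norm u = 1" unfolding u_def using eq by simp
  have Ti: "T integrable_on {-1..1}" by (intro integrable_continuous_real c)
  have "integral {-1..1} (\<lambda>x. T x \<bullet> u) = integral {-1..1} T \<bullet> u"
    using integral_linear[OF Ti bounded_linear_inner_left[of u]] by (simp add: o_def)
  also have "\<dots> = 2 * (u \<bullet> u)" unfolding u_def by simp
  also have "\<dots> = 2" using nu by (simp add: norm_eq_1)
  finally have I: "integral {-1..1} (\<lambda>x. T x \<bullet> u) = 2" .
  have i1: "(\<lambda>x. T x \<bullet> u) integrable_on {-1..1}"
    by (intro integrable_continuous_real continuous_intros c)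
  have "integral {-1..1} (\<lambda>x. 1 - T x \<bullet> u) = integral {-1..1} (\<lambda>_::real. 1::real) - integral {-1..1} (\<lambda>x. T x \<bullet> u)"
    by (intro integral_diff i1 integrable_continuous_real continuous_on_const)
  then have zero: "integral {-1..1} (\<lambda>x. 1 - T x \<bullet> u) = 0" using I by simp
  have le: "T x \<bullet> u \<le> 1" if "x \<in> {-1..1}" for x
    using norm_cauchy_schwarz[of "T x" u] unit[OF that] nu by simp
  have "\<forall>x\<in>{-1..1}. 1 - T x \<bullet> u = 0"
    using zero by (subst (asm) integral_eq_0_iff) (use le in \<open>auto intro!: continuous_intros c\<close>)
  then have "T x = u" if "x \<in> {-1..1}" for x
  proof -
    have "T x \<bullet> u = 1" using \<open>\<forall>x\<in>{-1..1}. 1 - T x \<bullet> u = 0\<close> that by auto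
    then have "(norm (T x - u))\<^sup>2 = 0"
      using unit[OF that] nu
      by (simp add: power2_norm_eq_inner inner_diff_left inner_diff_right inner_commute norm_eq_1)
    then show ?thesis by simp
  qed
  then show ?thesis using x by simp
qed

lemma admissible_chord_le:
  assumes "admissible M \<xi> \<tau> L \<gamma>" "L > 0"
  shows "norm (\<gamma> 1 - \<gamma> (-1)) \<le> L"
proof -
  obtain T w where prof: "tangent_profile M \<xi> \<tau> L (\<gamma> (-1)) T w"
    and "2 / L * integral {-1..1} (\<lambda>x. (norm (w x))\<^sup>2) \<le> elastic_energy \<gamma>"
    and d: "\<gamma> 1 - \<gamma> (-1) = (L / 2) *\<^sub>R integral {-1..1} T"
    using admissible_imp_tangent_profile[OF assms(1)] .
  have "norm (integral {-1..1} T) \<le> 2"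
    using prof H1_continuous[of "-1" 1 T w] unfolding tangent_profile_def
    by (intro integral_unit_norm_le) auto
  then show ?thesis using assms(2) unfolding d by simp
qed

text \<open>The curve itself may be parametrised with variable speed; its constant speed version is a segment
whose tangent has derivative zero.\<close>

lemma straight_if_chord_eq_length:
  assumes adm: "admissible M \<xi> \<tau> L \<gamma>" and L: "L > 0" and chord: "norm (\<gamma> 1 - \<gamma> (-1)) = L"
  obtains \<gamma>' where "admissible M \<xi> \<tau> L \<gamma>'" "elastic_energy \<gamma>' = 0"
proof -
  obtain T w where prof: "tangent_profile M \<xi> \<tau> L (\<gamma> (-1)) T w"
    and "2 / L * integral {-1..1} (\<lambda>x. (norm (w x))\<^sup>2) \<le> elastic_energy \<gamma>"
    and d: "\<gamma> 1 - \<gamma> (-1) = (L / 2) *\<^sub>R integral {-1..1} T"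
    using admissible_imp_tangent_profile[OF adm] .
  have T: "H1 (-1) 1 T w" and unit: "\<And>x. x \<in> {-1..1} \<Longrightarrow> norm (T x) = 1"
    using prof unfolding tangent_profile_def by auto
  have "norm (integral {-1..1} T) = 2" using chord L unfolding d by simp
  from integral_unit_norm_eq_imp_constant[OF H1_continuous[OF T] unit this]
  have const: "T x = T (-1)" if "x \<in> {-1..1}" for x using that by blast
  have "H1 (-1) 1 (\<lambda>x. T (-1) + integral {-1..x} (\<lambda>_. 0)) (\<lambda>_. 0)"
    by (intro H1_indefinite_integral L2_continuous continuous_on_const)
  then have "H1 (-1) 1 T (\<lambda>_. 0)"
  proof (rule H1_cong)
    show "T x = T (-1) + integral {-1..x} (\<lambda>_. 0)" if "x \<in> {-1..1}" for x
      using const[OF that] by simp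
  qed
  then have "tangent_profile M \<xi> \<tau> L (\<gamma> (-1)) T (\<lambda>_. 0)"
    using prof unfolding tangent_profile_def by blast
  from tangent_profile_imp_admissible[OF this L] show ?thesis using that by auto
qed

lemma straight_if_energy_zero:
  assumes adm: "admissible M \<xi> \<tau> L \<gamma>" and L: "L > 0" and energy: "elastic_energy \<gamma> = 0"
  shows "\<gamma> 1 = \<gamma> (-1) + L *\<^sub>R (\<tau> (-1) *\<^sub>R \<xi> (\<gamma> (-1)))" "norm (\<tau> (-1) *\<^sub>R \<xi> (\<gamma> (-1))) = 1"
    "\<gamma> (-1) \<in> M" "\<gamma> 1 \<in> M"
proof -
  obtain T w where prof: "tangent_profile M \<xi> \<tau> L (\<gamma> (-1)) T w"
    and e: "2 / L * integral {-1..1} (\<lambda>x. (norm (w x))\<^sup>2) \<le> elastic_energy \<gamma>"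
    and d: "\<gamma> 1 - \<gamma> (-1) = (L / 2) *\<^sub>R integral {-1..1} T"
    using admissible_imp_tangent_profile[OF adm] .
  have T: "H1 (-1) 1 T w" and unit: "\<And>x. x \<in> {-1..1} \<Longrightarrow> norm (T x) = 1"
    and T0: "T (-1) = \<tau> (-1) *\<^sub>R \<xi> (\<gamma> (-1))"
    using prof unfolding tangent_profile_def by auto
  have w0: "integral {-1..1} (\<lambda>x. (norm (w x))\<^sup>2) \<le> 0"
    using e L unfolding energy by (simp add: mult_le_0_iff divide_le_0_iff)
  have const: "T x = T (-1)" if x: "x \<in> {-1..1}" for x
  proof -
    have "integral {-1..x} (\<lambda>t. (norm (w t))\<^sup>2) \<le> integral {-1..1} (\<lambda>t. (norm (w t))\<^sup>2)"
      using x by (intro integral_subset_le L2_integrable(3)[OF H1_L2[OF T]]) auto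
    with w0 have "integral {-1..x} (\<lambda>t. (norm (w t))\<^sup>2) \<le> 0" by linarith
    then have "(x - (-1)) * integral {-1..x} (\<lambda>t. (norm (w t))\<^sup>2) \<le> 0"
      using x by (intro mult_nonneg_nonpos) auto
    moreover have "(norm (T x - T (-1)))\<^sup>2 \<le> (x - (-1)) * integral {-1..x} (\<lambda>t. (norm (w t))\<^sup>2)"
      using x by (intro H1_norm_increment_le(2)[OF T]) auto
    ultimately have "(norm (T x - T (-1)))\<^sup>2 \<le> 0" by linarith
    then show ?thesis by simp
  qed
  have "integral {-1..1} T = integral {-1..1} (\<lambda>_::real. T (-1))"
    by (rule Henstock_Kurzweil_Integration.integral_cong) (rule const)
  then have "integral {-1..1} T = 2 *\<^sub>R T (-1)" by simp
  then have "\<gamma> 1 - \<gamma> (-1) = L *\<^sub>R T (-1)" unfolding d by simp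
  then show "\<gamma> 1 = \<gamma> (-1) + L *\<^sub>R (\<tau> (-1) *\<^sub>R \<xi> (\<gamma> (-1)))" unfolding T0 by (metis add.commute diff_add_cancel)
  show "norm (\<tau> (-1) *\<^sub>R \<xi> (\<gamma> (-1))) = 1" unfolding T0[symmetric] by (rule unit) simp
  show "\<gamma> (-1) \<in> M" "\<gamma> 1 \<in> M" using adm unfolding admissible_def OBC_def by auto
qed

text \<open>The direct method: a minimising sequence has an admissible limit.\<close>

lemma elastic_energy_minimiser:
  assumes \<xi>: "smooth_unit_normal M \<xi>" and L: "L > 0" and M: "is_hyperplane M \<or> compact M"
    and ex: "admissible M \<xi> \<tau> L \<gamma>1"
  obtains \<gamma>0 where "admissible M \<xi> \<tau> L \<gamma>0"
    "\<And>\<gamma>. admissible M \<xi> \<tau> L \<gamma> \<Longrightarrow> elastic_energy \<gamma>0 \<le> elastic_energy \<gamma>"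
proof -
  define A where "A = {elastic_energy \<gamma> |\<gamma>. admissible M \<xi> \<tau> L \<gamma>}"
  have ne: "A \<noteq> {}" and bdd: "bdd_below A"
    unfolding A_def using ex elastic_energy_nonneg[OF _ L] by (auto intro!: bdd_belowI[of _ 0])
  have "\<exists>\<gamma>. admissible M \<xi> \<tau> L \<gamma> \<and> elastic_energy \<gamma> \<le> Inf A + inverse (real (Suc n))" for n
  proof -
    have "Inf A < Inf A + inverse (real (Suc n))" by simp
    then obtain a where "a \<in> A" "a < Inf A + inverse (real (Suc n))"
      using cInf_less_iff[OF ne bdd] by blast
    then show ?thesis unfolding A_def by force
  qed
  then obtain \<gamma> where \<gamma>: "\<And>n. admissible M \<xi> \<tau> L (\<gamma> n)"
    "\<And>n. elastic_energy (\<gamma> n) \<le> Inf A + inverse (real (Suc n))"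
    by metis
  have "(\<lambda>n. Inf A + inverse (real (Suc n))) \<longlonglongrightarrow> Inf A + 0"
    by (intro tendsto_add tendsto_const LIMSEQ_inverse_real_of_nat)
  then have lim: "(\<lambda>n. Inf A + inverse (real (Suc n))) \<longlonglongrightarrow> Inf A" by simp
  obtain \<gamma>0 r where \<gamma>0: "admissible M \<xi> \<tau> L \<gamma>0" "elastic_energy \<gamma>0 \<le> Inf A"
    and "strict_mono (r :: nat \<Rightarrow> nat)"
    and "(\<lambda>n. norm (\<gamma> (r n) 1 - \<gamma> (r n) (-1))) \<longlonglongrightarrow> norm (\<gamma>0 1 - \<gamma>0 (-1))"
    using admissible_compactness[OF \<xi> L M \<gamma> lim] .
  show ?thesis
  proof (rule that[OF \<gamma>0(1)])
    fix \<eta> assume "admissible M \<xi> \<tau> L \<eta>"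
    then have "Inf A \<le> elastic_energy \<eta>" by (intro cInf_lower bdd) (auto simp: A_def)
    then show "elastic_energy \<gamma>0 \<le> elastic_energy \<eta>" using \<gamma>0(2) by linarith
  qed
qed

text \<open>By compactness: otherwise a sequence of admissible curves whose chord deficits tend to zero would
have an admissible limit with chord \<open>L\<close>, which is straight.\<close>

lemma chord_deficit_if_no_straight_curve:
  assumes \<xi>: "smooth_unit_normal M \<xi>" and L: "L > 0" and M: "is_hyperplane M \<or> compact M"
    and pos: "\<And>\<gamma>. admissible M \<xi> \<tau> L \<gamma> \<Longrightarrow> elastic_energy \<gamma> \<noteq> 0"
  shows "\<exists>\<zeta>>0. \<forall>\<gamma>. admissible M \<xi> \<tau> L \<gamma> \<and> elastic_energy \<gamma> \<le> E \<longrightarrow>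
    L - norm (\<gamma> 1 - \<gamma> (-1)) \<ge> \<zeta>"
proof (rule ccontr)
  assume "\<not> ?thesis"
  then have no: "\<exists>\<gamma>. (admissible M \<xi> \<tau> L \<gamma> \<and> elastic_energy \<gamma> \<le> E) \<and> L - norm (\<gamma> 1 - \<gamma> (-1)) < \<zeta>"
    if "\<zeta> > 0" for \<zeta> using that by (force simp: not_le)
  have "\<exists>\<gamma>. (admissible M \<xi> \<tau> L \<gamma> \<and> elastic_energy \<gamma> \<le> E) \<and>
      L - norm (\<gamma> 1 - \<gamma> (-1)) < inverse (real (Suc n))" for n
    by (rule no) simp
  then obtain \<gamma> where \<gamma>: "\<And>n. admissible M \<xi> \<tau> L (\<gamma> n)" "\<And>n. elastic_energy (\<gamma> n) \<le> E"
    "\<And>n. L - norm (\<gamma> n 1 - \<gamma> n (-1)) < inverse (real (Suc n))"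
    by metis
  obtain \<gamma>' r where \<gamma>': "admissible M \<xi> \<tau> L \<gamma>'" and "elastic_energy \<gamma>' \<le> E"
    and r: "strict_mono (r :: nat \<Rightarrow> nat)"
    and lim: "(\<lambda>n. norm (\<gamma> (r n) 1 - \<gamma> (r n) (-1))) \<longlonglongrightarrow> norm (\<gamma>' 1 - \<gamma>' (-1))"
    using admissible_compactness[OF \<xi> L M \<gamma>(1,2) tendsto_const] .
  have "L - norm (\<gamma>' 1 - \<gamma>' (-1)) \<le> 0"
  proof (rule LIMSEQ_le)
    show "(\<lambda>n. L - norm (\<gamma> (r n) 1 - \<gamma> (r n) (-1))) \<longlonglongrightarrow> L - norm (\<gamma>' 1 - \<gamma>' (-1))"
      by (intro tendsto_diff tendsto_const lim)
    show "(\<lambda>n. inverse (real (Suc (r n)))) \<longlonglongrightarrow> 0"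
      using LIMSEQ_subseq_LIMSEQ[OF LIMSEQ_inverse_real_of_nat r] by (simp add: o_def)
  qed (use \<gamma>(3) less_imp_le in blast)
  then have "norm (\<gamma>' 1 - \<gamma>' (-1)) = L" using admissible_chord_le[OF \<gamma>' L] by simp
  then obtain \<eta> where "admissible M \<xi> \<tau> L \<eta>" "elastic_energy \<eta> = 0"
    by (rule straight_if_chord_eq_length[OF \<gamma>' L])
  then show False using pos by blast
qed

text \<open>A curve without energy is the segment from \<open>p\<close> to \<open>p + L \<xi> p\<close>. Both end points belong to the convex
set, hence so does the whole segment, although \<open>\<xi> p\<close> points out of the set.\<close>

lemma no_straight_curve_if_convex:
  assumes \<Omega>: "closed \<Omega>" "convex \<Omega>" "M = frontier \<Omega>" "outward_pointing \<Omega> \<xi>" and \<tau>: "\<tau> (-1) = 1"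
    and L: "L > 0" and adm: "admissible M \<xi> \<tau> L \<gamma>"
  shows "elastic_energy \<gamma> \<noteq> 0"
proof
  assume "elastic_energy \<gamma> = 0"
  note straight = straight_if_energy_zero[OF adm L this]
  define p where "p = \<gamma> (-1)"
  have p: "p \<in> \<Omega>" "p + L *\<^sub>R \<xi> p \<in> \<Omega>"
    using straight \<Omega>(1,3) frontier_subset_closed[of \<Omega>] unfolding p_def \<tau> by auto
  have "p \<in> frontier \<Omega>" using straight(3) \<Omega>(3) unfolding p_def by simp
  then obtain \<epsilon> where \<epsilon>: "\<epsilon> > 0" "\<And>t. t \<in> {0<..<\<epsilon>} \<Longrightarrow> p + t *\<^sub>R \<xi> p \<notin> \<Omega>"
    using \<Omega>(4) unfolding outward_pointing_def by blast
  define t where "t = min (\<epsilon> / 2) L"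
  have t: "0 < t" "t < \<epsilon>" "t \<le> L" unfolding t_def using \<epsilon>(1) L by auto
  have "(1 - t / L) *\<^sub>R p + (t / L) *\<^sub>R (p + L *\<^sub>R \<xi> p) \<in> \<Omega>"
    using t L p by (intro convexD[OF \<Omega>(2)]) auto
  also have "(1 - t / L) *\<^sub>R p + (t / L) *\<^sub>R (p + L *\<^sub>R \<xi> p) = p + t *\<^sub>R \<xi> p"
    using L by (simp add: algebra_simps)
  finally show False using \<epsilon>(2)[of t] t by simp
qed

theorem proposition4p13:
  fixes M :: "(real ^ 'n) set"
    and \<xi> :: "real ^ 'n \<Rightarrow> real ^ 'n"
    and \<tau>\<^sub>0 :: "real \<Rightarrow> real"
    and L\<^sub>0 E :: real
  assumes "CARD('n) \<ge> 2"
    and "embedded_hypersurface M"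
    and "riemannian_complete M"
    and "smooth_unit_normal M \<xi>"
    and "uniform_tubular_neighborhood M \<xi>"
    and "\<tau>\<^sub>0 ` {-1, 1} \<subseteq> {-1, 1}"
    and "L\<^sub>0 > 0"
    and "E > 0"
    and "\<exists>\<gamma>. admissible M \<xi> \<tau>\<^sub>0 L\<^sub>0 \<gamma> \<and> elastic_energy \<gamma> \<le> E"
    and "is_hyperplane M \<or> compact M"
  shows "\<exists>E_min.
    (E_min \<in> {elastic_energy \<gamma> |\<gamma>. admissible M \<xi> \<tau>\<^sub>0 L\<^sub>0 \<gamma>} \<and>
     (\<forall>e \<in> {elastic_energy \<gamma> |\<gamma>. admissible M \<xi> \<tau>\<^sub>0 L\<^sub>0 \<gamma>}. E_min \<le> e)) \<and>
    (E_min > 0 \<longleftrightarrow>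
      (\<exists>\<zeta>>0. \<forall>\<gamma>. admissible M \<xi> \<tau>\<^sub>0 L\<^sub>0 \<gamma> \<and> elastic_energy \<gamma> \<le> E \<longrightarrow>
         L\<^sub>0 - norm (\<gamma> 1 - \<gamma> (-1)) \<ge> \<zeta>)) \<and>
    (is_hyperplane M \<longrightarrow>
      E_min \<ge> pi\<^sup>2 / L\<^sub>0 \<and> (\<tau>\<^sub>0 (-1) \<noteq> \<tau>\<^sub>0 1 \<longrightarrow> E_min = pi\<^sup>2 / L\<^sub>0)) \<and>
    (\<forall>\<Omega>. compact \<Omega> \<and> convex \<Omega> \<and> M = frontier \<Omega> \<and> outward_pointing \<Omega> \<xi> \<and> \<tau>\<^sub>0 (-1) = 1 \<longrightarrow>
      E_min > 0)"
proof -
  note \<xi> = assms(4) and \<tau> = assms(6) and L = assms(7) and E = assms(8) and M = assms(10)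
  obtain \<gamma>0 where \<gamma>0: "admissible M \<xi> \<tau>\<^sub>0 L\<^sub>0 \<gamma>0"
    and min: "\<And>\<gamma>. admissible M \<xi> \<tau>\<^sub>0 L\<^sub>0 \<gamma> \<Longrightarrow> elastic_energy \<gamma>0 \<le> elastic_energy \<gamma>"
    using assms(9) elastic_energy_minimiser[OF \<xi> L M] by metis
  have nonneg: "elastic_energy \<gamma>0 \<ge> 0" by (rule elastic_energy_nonneg[OF \<gamma>0 L])
  show ?thesis
  proof (intro exI[of _ "elastic_energy \<gamma>0"] conjI)
    show "elastic_energy \<gamma>0 \<in> {elastic_energy \<gamma> |\<gamma>. admissible M \<xi> \<tau>\<^sub>0 L\<^sub>0 \<gamma>}" using \<gamma>0 by blast
    show "\<forall>e \<in> {elastic_energy \<gamma> |\<gamma>. admissible M \<xi> \<tau>\<^sub>0 L\<^sub>0 \<gamma>}. elastic_energy \<gamma>0 \<le> e"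
      using min by blast
    show "elastic_energy \<gamma>0 > 0 \<longleftrightarrow>
      (\<exists>\<zeta>>0. \<forall>\<gamma>. admissible M \<xi> \<tau>\<^sub>0 L\<^sub>0 \<gamma> \<and> elastic_energy \<gamma> \<le> E \<longrightarrow>
         L\<^sub>0 - norm (\<gamma> 1 - \<gamma> (-1)) \<ge> \<zeta>)"
    proof
      assume "elastic_energy \<gamma>0 > 0"
      then show "\<exists>\<zeta>>0. \<forall>\<gamma>. admissible M \<xi> \<tau>\<^sub>0 L\<^sub>0 \<gamma> \<and> elastic_energy \<gamma> \<le> E \<longrightarrow>
         L\<^sub>0 - norm (\<gamma> 1 - \<gamma> (-1)) \<ge> \<zeta>"
        using min by (intro chord_deficit_if_no_straight_curve[OF \<xi> L M]) force
    next
      assume "\<exists>\<zeta>>0. \<forall>\<gamma>. admissible M \<xi> \<tau>\<^sub>0 L\<^sub>0 \<gamma> \<and> elastic_energy \<gamma> \<le> E \<longrightarrow>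
         L\<^sub>0 - norm (\<gamma> 1 - \<gamma> (-1)) \<ge> \<zeta>"
      then obtain \<zeta> where \<zeta>: "\<zeta> > 0"
        "admissible M \<xi> \<tau>\<^sub>0 L\<^sub>0 \<gamma>0 \<and> elastic_energy \<gamma>0 \<le> E \<longrightarrow> L\<^sub>0 - norm (\<gamma>0 1 - \<gamma>0 (-1)) \<ge> \<zeta>"
        by blast
      show "elastic_energy \<gamma>0 > 0"
      proof (rule ccontr)
        assume "\<not> elastic_energy \<gamma>0 > 0"
        then have zero: "elastic_energy \<gamma>0 = 0" using nonneg by simp
        note straight = straight_if_energy_zero[OF \<gamma>0 L zero]
        have "\<gamma>0 1 - \<gamma>0 (-1) = L\<^sub>0 *\<^sub>R (\<tau>\<^sub>0 (-1) *\<^sub>R \<xi> (\<gamma>0 (-1)))"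
          using straight(1) by (metis add_diff_cancel_left')
        then have "norm (\<gamma>0 1 - \<gamma>0 (-1)) = L\<^sub>0"
          using straight(2) L by (metis norm_scaleR abs_of_pos mult.right_neutral)
        then show False using \<zeta> \<gamma>0 zero E by simp
      qed
    qed
    show "is_hyperplane M \<longrightarrow>
      elastic_energy \<gamma>0 \<ge> pi\<^sup>2 / L\<^sub>0 \<and> (\<tau>\<^sub>0 (-1) \<noteq> \<tau>\<^sub>0 1 \<longrightarrow> elastic_energy \<gamma>0 = pi\<^sup>2 / L\<^sub>0)"
    proof
      assume hyp: "is_hyperplane M"
      obtain \<nu> c where \<nu>: "norm \<nu> = 1" "M = {x. \<nu> \<bullet> x = c}" "\<forall>x\<in>M. \<xi> x = \<nu>"
        using hyperplane_normal_constant[OF hyp \<xi>] .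
      obtain T w where prof: "tangent_profile M \<xi> \<tau>\<^sub>0 L\<^sub>0 (\<gamma>0 (-1)) T w"
        and le: "2 / L\<^sub>0 * integral {-1..1} (\<lambda>x. (norm (w x))\<^sup>2) \<le> elastic_energy \<gamma>0"
        and "\<gamma>0 1 - \<gamma>0 (-1) = (L\<^sub>0 / 2) *\<^sub>R integral {-1..1} T"
        using admissible_imp_tangent_profile[OF \<gamma>0] .
      have ge: "pi\<^sup>2 / L\<^sub>0 \<le> elastic_energy \<gamma>0"
        using hyperplane_energy_ge[OF prof L \<nu>] le by linarith
      moreover have "elastic_energy \<gamma>0 \<le> pi\<^sup>2 / L\<^sub>0" if ne: "\<tau>\<^sub>0 (-1) \<noteq> \<tau>\<^sub>0 1"
      proof -
        have \<tau>1: "\<tau>\<^sub>0 (-1) \<in> {-1, 1}" "\<tau>\<^sub>0 1 = - \<tau>\<^sub>0 (-1)" using \<tau> ne by auto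
        have dim: "DIM(real ^ 'n) \<ge> 2" using assms(1) by simp
        obtain p T w where prof: "tangent_profile M \<xi> \<tau>\<^sub>0 L\<^sub>0 p T w"
          and w: "integral {-1..1} (\<lambda>x. (norm (w x))\<^sup>2) = pi\<^sup>2 / 2"
          using semicircle_profile[where L = "L\<^sub>0", OF dim \<tau>1 \<nu>] .
        obtain \<gamma> where "admissible M \<xi> \<tau>\<^sub>0 L\<^sub>0 \<gamma>"
          "elastic_energy \<gamma> = 2 / L\<^sub>0 * integral {-1..1} (\<lambda>x. (norm (w x))\<^sup>2)"
          "\<gamma> 1 - \<gamma> (-1) = (L\<^sub>0 / 2) *\<^sub>R integral {-1..1} T"
          using tangent_profile_imp_admissible[OF prof L] .
        with min[of \<gamma>] show ?thesis unfolding w by simp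
      qed
      ultimately show "elastic_energy \<gamma>0 \<ge> pi\<^sup>2 / L\<^sub>0 \<and>
          (\<tau>\<^sub>0 (-1) \<noteq> \<tau>\<^sub>0 1 \<longrightarrow> elastic_energy \<gamma>0 = pi\<^sup>2 / L\<^sub>0)" by (meson order_antisym)
    qed
    show "\<forall>\<Omega>. compact \<Omega> \<and> convex \<Omega> \<and> M = frontier \<Omega> \<and> outward_pointing \<Omega> \<xi> \<and> \<tau>\<^sub>0 (-1) = 1 \<longrightarrow>
      elastic_energy \<gamma>0 > 0"
      using no_straight_curve_if_convex[OF compact_imp_closed _ _ _ _ L \<gamma>0] nonneg
      by (metis order_le_less)
  qed
qed

end
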